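(* Let $\mathfrak{so}_8$ be the complex simple Lie algebra of type $D_4$ with simple roots $\alpha_1,\alpha_2,\alpha_3,\alpha_4$ (Bourbaki numbering, $\alpha_2$ the central node), equipped with the action of $\mathfrak{S}_4$ in which $(1\,2)$ acts by the diagram automorphism $\gamma_{13}$ swapping $\alpha_1,\alpha_3$ and fixing $\alpha_2,\alpha_4$; $(2\,3)$ acts by the diagram automorphism $\gamma_{34}$ swapping $\alpha_3,\alpha_4$; and $(3\,4)$ acts by $\gamma_{13}\circ\mathrm{Ad}(\alpha_1^\vee(\sqrt{-1})\alpha_3^\vee(-\sqrt{-1}))$. Let $\mathcal{O}_{\min}$ be the minimal nilpotent orbit of $\mathfrak{so}_8$. Let $V=\mathbb{C}^3$ with standard basis $v_1,v_2,v_3$ and dual basis $\chi_1,\chi_2,\chi_3$ of $V^*$, and let $\mathfrak{z}=\{(\lambda_1,\lambda_2,\lambda_3)\in\mathbb{C}^3:\lambda_1+\lambda_2+\lambda_3=0\}$; for $z=(\lambda_1,\lambda_2,\lambda_3)$ put $\Delta(z)=\mathrm{diag}(\lambda_1,\lambda_2,\lambda_3)$, with indices read modulo $3$. Define $\psi:\mathrm{SL}_3\times\mathfrak{z}\to\mathfrak{sl}_3\oplus S^2V\oplus S^2V^*$ by $$\psi(g,z)=\Big(g\Delta(z)g^{-1},\ \sum_{i}(\lambda_i-\lambda_{i+1})^2\,gv_i\otimes gv_i,\ \sum_i(\lambda_i-\lambda_{i-1})^2\,\chi_ig^{-1}\otimes\chi_ig^{-1}\Big).$$ Then $\overline{\mathcal{O}_{\min}}/\mathfrak{S}_4$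 is isomorphic to the closure of the image of $\psi$.
   Context: The action of $\mathfrak{S}_4$ described is a well-defined action by automorphisms; its fixed-point subalgebra is isomorphic to $\mathfrak{sl}_3$. Here $S^2V$ and $S^2V^*$ denote symmetric squares, and $gv$ (resp. $\chi g^{-1}$) is the natural action of $\mathrm{SL}_3$ on column (resp. row) vectors. *)

theory Defs
  imports "HOL-Analysis.Analysis" "HOL-Library.Numeral_Type"
begin

inductive_set polyfun :: "('a \<Rightarrow> complex) set \<Rightarrow> ('a \<Rightarrow> complex) set"
  for C :: "('a \<Rightarrow> complex) set" where
  const: "(\<lambda>x. c) \<in> polyfun C"
| coord: "p \<in> C \<Longrightarrow> p \<in> polyfun C"
| add: "p \<in> polyfun C \<Longrightarrow> q \<in> polyfun C \<Longrightarrow> (\<lambda>x. p x + q x) \<in> polyfun C"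
| mult: "p \<in> polyfun C \<Longrightarrow> q \<in> polyfun C \<Longrightarrow> (\<lambda>x. p x * q x) \<in> polyfun C"

definition zariski_closure :: "('a \<Rightarrow> complex) set \<Rightarrow> 'a set \<Rightarrow> 'a set" where
  "zariski_closure C S = {x. \<forall>p\<in>polyfun C. (\<forall>y\<in>S. p y = 0) \<longrightarrow> p x = 0}"

type_synonym mat8 = "complex^8^8"
type_synonym mat3 = "complex^3^3"
type_synonym tgt = "mat3 \<times> mat3 \<times> mat3"

definition coords8 :: "(mat8 \<Rightarrow> complex) set" where
  "coords8 = (\<lambda>(i,j). \<lambda>A. A$i$j) ` UNIV"

definition coords_tgt :: "(tgt \<Rightarrow> complex) set" where
  "coords_tgt = (\<lambda>(i,j). \<lambda>(A,B,C). A$i$j) ` UNIV \<union> (\<lambda>(i,j). \<lambda>(A,B,C). B$i$j) ` UNIV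
      \<union> (\<lambda>(i,j). \<lambda>(A,B,C). C$i$j) ` UNIV"

definition J8 :: mat8 where "J8 = (\<chi> i j. if i + j = 7 then 1 else 0)"

definition so8 :: "mat8 set" where
  "so8 = {A. transpose A ** J8 + J8 ** A = 0}"

definition SO8 :: "mat8 set" where
  "SO8 = {g. transpose g ** J8 ** g = J8 \<and> det g = 1}"

definition bracket :: "mat8 \<Rightarrow> mat8 \<Rightarrow> mat8" where
  "bracket x y = x ** y - y ** x"

definition cmul :: "complex \<Rightarrow> mat8 \<Rightarrow> mat8" where
  "cmul c A = (\<chi> i j. c * A$i$j)"

definition Em :: "8 \<Rightarrow> 8 \<Rightarrow> mat8" where
  "Em a b = (\<chi> i j. if i = a \<and> j = b then 1 else 0)"

text \<open>Pinning (Bourbaki numbering): Cartan subalgebra = diagonal matrices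
  diag(t1,t2,t3,t4,-t4,-t3,-t2,-t1); alpha1 = e1-e2, alpha2 = e2-e3, alpha3 = e3-e4,
  alpha4 = e3+e4 (alpha2 central).\<close>
definition e_simple :: "nat \<Rightarrow> mat8" where
  "e_simple k = (if k = 1 then Em 0 1 - Em 6 7 else if k = 2 then Em 1 2 - Em 5 6
     else if k = 3 then Em 2 3 - Em 4 5 else Em 2 4 - Em 3 5)"

definition f_simple :: "nat \<Rightarrow> mat8" where
  "f_simple k = transpose (e_simple k)"

text \<open>Highest root vector, root theta = e1 + e2.\<close>
definition e_theta :: mat8 where "e_theta = Em 0 6 - Em 1 7"

definition O_min :: "mat8 set" where
  "O_min = {g ** e_theta ** matrix_inv g | g. g \<in> SO8}"

definition is_so8_aut :: "(mat8 \<Rightarrow> mat8) \<Rightarrow> bool" where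
  "is_so8_aut \<phi> \<longleftrightarrow> bij_betw \<phi> so8 so8
     \<and> (\<forall>x\<in>so8. \<forall>y\<in>so8. \<phi> (x + y) = \<phi> x + \<phi> y \<and> \<phi> (bracket x y) = bracket (\<phi> x) (\<phi> y))
     \<and> (\<forall>c. \<forall>x\<in>so8. \<phi> (cmul c x) = cmul c (\<phi> x))
     \<and> (\<forall>x. x \<notin> so8 \<longrightarrow> \<phi> x = 0)"

definition diagram_aut :: "(nat \<Rightarrow> nat) \<Rightarrow> mat8 \<Rightarrow> mat8" where
  "diagram_aut \<pi> = (THE \<phi>. is_so8_aut \<phi> \<and>
     (\<forall>k\<in>{1..4}. \<phi> (e_simple k) = e_simple (\<pi> k) \<and> \<phi> (f_simple k) = f_simple (\<pi> k)))"

definition gamma13 :: "mat8 \<Rightarrow> mat8" where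
  "gamma13 = diagram_aut (\<lambda>k. if k = 1 then 3 else if k = 3 then 1 else k)"

definition gamma34 :: "mat8 \<Rightarrow> mat8" where
  "gamma34 = diagram_aut (\<lambda>k. if k = 3 then 4 else if k = 4 then 3 else k)"

text \<open>The torus element alpha1^vee(i) alpha3^vee(-i) = diag(i,-i,-i,i,-i,i,i,-i).\<close>
definition torus_T :: mat8 where
  "torus_T = (\<chi> i j. if i = j then (if i \<in> {0,3,5,6} then \<i> else - \<i>) else 0)"

definition Ad :: "mat8 \<Rightarrow> mat8 \<Rightarrow> mat8" where
  "Ad g x = g ** x ** matrix_inv g"

definition sigma12 :: "mat8 \<Rightarrow> mat8" where "sigma12 = gamma13"
definition sigma23 :: "mat8 \<Rightarrow> mat8" where "sigma23 = gamma34"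
definition sigma34 :: "mat8 \<Rightarrow> mat8" where "sigma34 = gamma13 \<circ> Ad torus_T"

inductive_set S4_action :: "(mat8 \<Rightarrow> mat8) set" where
  ident: "id \<in> S4_action"
| gen: "\<phi> \<in> S4_action \<Longrightarrow> \<sigma> \<in> {sigma12, sigma23, sigma34} \<Longrightarrow> \<sigma> \<circ> \<phi> \<in> S4_action"

text \<open>S^2 V identified with symmetric 3x3 matrices via v\<otimes>v \<mapsto> v v^T, and S^2 V^* likewise
  via \<chi>\<otimes>\<chi> \<mapsto> \<chi>^T \<chi>. Indices 1,2,3 are represented by 0,1,2 :: 3 (cyclic).\<close>
definition psi :: "mat3 \<Rightarrow> complex^3 \<Rightarrow> tgt" where
  "psi g z =
    (g ** (\<chi> i j. if i = j then z$i else 0) ** matrix_inv g,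
     (\<chi> a b. \<Sum>i\<in>UNIV. (z$i - z$(i+1))^2 * (g$a$i * g$b$i)),
     (\<chi> a b. \<Sum>i\<in>UNIV. (z$i - z$(i-1))^2 * (matrix_inv g$i$a * matrix_inv g$i$b)))"

definition psi_image :: "tgt set" where
  "psi_image = {psi g z | g z. det g = 1 \<and> (\<Sum>i\<in>UNIV. z$i) = 0}"

text \<open>X/G \<cong> Y for a finite group G acting on an affine variety X: there is a morphism
  F : X \<rightarrow> Y (restriction of a polynomial map) whose pullback C[Y] \<rightarrow> C[X] is an
  isomorphism onto C[X]^G.\<close>
definition quotient_iso ::
  "('a \<Rightarrow> complex) set \<Rightarrow> 'a set \<Rightarrow> ('a \<Rightarrow> 'a) set \<Rightarrow> ('b \<Rightarrow> complex) set \<Rightarrow> 'b set \<Rightarrow> bool" where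
  "quotient_iso CX X G CY Y \<longleftrightarrow> (\<exists>F.
     (\<forall>c\<in>CY. (\<lambda>x. c (F x)) \<in> polyfun CX)
     \<and> F ` X \<subseteq> Y
     \<and> (\<forall>\<sigma>\<in>G. \<forall>x\<in>X. F (\<sigma> x) = F x)
     \<and> (\<forall>p\<in>polyfun CY. (\<forall>x\<in>X. p (F x) = 0) \<longrightarrow> (\<forall>y\<in>Y. p y = 0))
     \<and> (\<forall>q\<in>polyfun CX. (\<forall>\<sigma>\<in>G. \<forall>x\<in>X. q (\<sigma> x) = q x) \<longrightarrow>
          (\<exists>p\<in>polyfun CY. \<forall>x\<in>X. p (F x) = q x)))"

end

theory Submission
  imports Defs
begin

text \<open>
  Write \<open>so\<^sub>8 = sl\<^sub>3 \<oplus> z \<oplus> \<Oplus>\<^sub>i (V \<oplus> V\<^sup>*)\<close> with \<open>i\<close> ranging over three indices, so that an element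
  has coordinates \<open>(A, \<lambda>, v\<^sub>i, \<chi>\<^sub>i)\<close>. The group acts by permuting the indices and by changing an even number
  of the signs of the pairs \<open>(v\<^sub>i, \<chi>\<^sub>i)\<close>. The quotient map is
  \<open>(A, \<Sum> v\<^sub>i \<otimes> v\<^sub>i, \<Sum> \<chi>\<^sub>i \<otimes> \<chi>\<^sub>i)\<close>.

  A generic point of the minimal orbit has \<open>A = g \<Delta>(\<lambda>) g\<^sup>-\<^sup>1\<close>, \<open>v\<^sub>i = (\<lambda>\<^sub>i - \<lambda>\<^sub>i\<^sub>+\<^sub>1) g e\<^sub>i\<close>,
  \<open>\<chi>\<^sub>i = (\<lambda>\<^sub>i - \<lambda>\<^sub>i\<^sub>-\<^sub>1) e\<^sub>i\<^sup>* g\<^sup>-\<^sup>1\<close>, so the image is the closure of the image of \<open>\<psi>\<close>. On the orbit closure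
  \<open>v\<^sub>i \<otimes> \<chi>\<^sub>i\<close> is a polynomial in \<open>A\<close> and \<open>\<lambda>\<^sub>i\<close>, while \<open>v\<^sub>i \<otimes> v\<^sub>j\<close> for \<open>i \<noteq> j\<close> is linear in \<open>\<chi>\<^sub>k\<close>
  over polynomials in \<open>A\<close> and \<open>\<lambda>\<close>, and dually. Hence every average over the group reduces to
  averages of \<open>f(\<lambda>) v\<^sub>i\<^sup>2\<^sup>a \<chi>\<^sub>j\<^sup>2\<^sup>b\<close> with \<open>i \<noteq> j\<close>, and an induction on the number of factors \<open>v, \<chi>\<close> shows that
  these are polynomials in the three components of the quotient map.
\<close>

section \<open>Coordinates on \<open>so\<^sub>8\<close> adapted to \<open>sl\<^sub>3\<close>\<close>

text \<open>The eigenvalues are not functions on the target; only their symmetric functions are, as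
  traces of powers of \<open>A\<close>. A power of an eigenvalue beside one of its eigenvectors is
  absorbed by \<open>A v = l v\<close>; one standing alone is lowered by the characteristic cubic.

  A second obstacle is an apparent circularity. Averaging a normal form over ordered pairs of
  distinct indices gives a product of power sums minus the power sum of the concatenated word. That
  word has the full length, so induction on length does not reach it. For words in vectors alone, or
  in covectors alone, the identity is read backwards: the pair average reduces by the relation for
  \<open>v_i\<close> and \<open>v_j\<close>, and thereby determines the long power sum.

  These computations live on the set \<open>rels\<close> cut out by explicit equations, in which the
  orbit closure lies. Equations on the closure are tested on the family \<open>Phi g z\<close>. That
  this family is large enough is proved by spreading the vanishing of a linear functional along
  unipotent shears, in place of an appeal to irreducibility of the orbit.\<close>

lemma UNIV_3: "(UNIV::3 set) = {0,1,2}"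
proof -
  have "card {0,1,2::3} = 3" by simp
  then show ?thesis by (intro card_subset_eq[symmetric]) auto
qed

lemma UNIV_8: "(UNIV::8 set) = {0,1,2,3,4,5,6,7}"
proof -
  have "card {0,1,2,3,4,5,6,7::8} = 8" by simp
  then show ?thesis by (intro card_subset_eq[symmetric]) auto
qed

lemma sum_UNIV_3: "sum f (UNIV::3 set) = f 0 + f 1 + f 2"
  unfolding UNIV_3 by (simp add: add.assoc)

lemma sum_UNIV_8: "sum f (UNIV::8 set) = f 0 + f 1 + f 2 + f 3 + f 4 + f 5 + f 6 + f 7"
  unfolding UNIV_8 by (simp add: add.assoc)

lemma all_3: "(\<forall>i::3. P i) \<longleftrightarrow> P 0 \<and> P 1 \<and> P 2"
  using UNIV_3 by (metis UNIV_I empty_iff insert_iff)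

lemma all_8: "(\<forall>i::8. P i) \<longleftrightarrow> P 0 \<and> P 1 \<and> P 2 \<and> P 3 \<and> P 4 \<and> P 5 \<and> P 6 \<and> P 7"
  using UNIV_8 by (metis UNIV_I empty_iff insert_iff)

lemma so8_iff: "x \<in> so8 \<longleftrightarrow> (\<forall>i j. x$i$j = - x$(7 - j)$(7 - i))"
proof -
  have J: "i + j = 7 \<longleftrightarrow> j = 7 - i" "i + j = 7 \<longleftrightarrow> i = 7 - j" for i j :: 8
    by (auto simp: algebra_simps)
  have 1: "(transpose x ** J8 + J8 ** x)$i$j = x$(7-j)$i + x$(7-i)$j" for i j
    by (simp add: matrix_matrix_mult_def transpose_def J8_def if_distrib if_distribR sum.delta J(2)[of _ j]
        J(1)[of i] cong: if_cong)
  have "x \<in> so8 \<longleftrightarrow> (\<forall>i j. x$(7-j)$i + x$(7-i)$j = 0)"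
    unfolding so8_def mem_Collect_eq vec_eq_iff 1 by simp
  also have "\<dots> \<longleftrightarrow> (\<forall>i j. x$i$j = - x$(7 - j)$(7 - i))"
  proof safe
    fix i j assume "\<forall>i j. x$(7-j)$i + x$(7-i)$j = 0"
    then have "x$(7-(7-i))$j + x$(7-j)$(7-i) = 0" by blast
    then show "x$i$j = - x$(7 - j)$(7 - i)" by (simp add: eq_neg_iff_add_eq_0)
  next
    fix i j assume "\<forall>i j. x$i$j = - x$(7 - j)$(7 - i)"
    then have "x$(7-j)$i = - x$(7-i)$(7-(7-j))" by blast
    then show "x$(7-j)$i + x$(7-i)$j = 0" by simp
  qed
  finally show ?thesis .
qed

lemma so8_add: "x \<in> so8 \<Longrightarrow> y \<in> so8 \<Longrightarrow> x + y \<in> so8"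
  unfolding so8_iff vector_add_component by (metis minus_add_distrib)

lemma so8_cmul: "x \<in> so8 \<Longrightarrow> cmul c x \<in> so8"
  unfolding so8_iff cmul_def vec_lambda_beta by (metis mult_minus_right)

lemma so8_zero: "0 \<in> so8"
  by (simp add: so8_iff)

lemma so8_sum: "(\<And>i. i \<in> I \<Longrightarrow> f i \<in> so8) \<Longrightarrow> sum f I \<in> so8"
  by (induction I rule: infinite_finite_induct) (auto simp: so8_add so8_zero)

definition Fm :: "8 \<Rightarrow> 8 \<Rightarrow> mat8" where
  "Fm i j = Em i j - Em (7 - j) (7 - i)"

lemma Fm_nth: "Fm p q $ i $ j = (if i = p \<and> j = q then 1 else 0) - (if i = 7 - q \<and> j = 7 - p then 1 else 0)"
  by (simp add: Fm_def Em_def)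

lemma Fm_so8: "Fm i j \<in> so8"
  unfolding so8_iff Fm_nth by (auto simp: algebra_simps)

text \<open>
  The vector representation restricts to \<open>V \<oplus> V\<^sup>* \<oplus> C \<oplus> C\<close> over \<open>sl\<^sub>3\<close>, where \<open>V\<close> is spanned by the
  basis vectors 7, 1, 2 and \<open>V\<^sup>*\<close> by 0, 6, 5. A coordinate vector is \<open>(A, \<lambda>, v, \<chi>)\<close>; the indices 0, 1, 2 of
  \<open>v\<close> and \<open>\<chi>\<close> belong to the simple roots \<open>\<alpha>\<^sub>1, \<alpha>\<^sub>3, \<alpha>\<^sub>4\<close>.
\<close>
type_synonym coord = "mat3 \<times> (complex^3) \<times> mat3 \<times> mat3"

definition vpos :: "3 \<Rightarrow> 8" where "vpos a = (if a = 0 then 7 else if a = 1 then 1 else 2)"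
definition dpos :: "3 \<Rightarrow> 8" where "dpos a = 7 - vpos a"

definition vtrace :: "mat8 \<Rightarrow> complex" where "vtrace x = x$7$7 + x$1$1 + x$2$2"

text \<open>The \<open>sl_3\<close> has the roots with equal coefficients at \<open>alpha_1\<close>,
  \<open>alpha_3\<close>, \<open>alpha_4\<close>: up to sign \<open>e2 - e3\<close>,
  \<open>e1 + e2\<close>, \<open>e1 + e3\<close>. The other 18 roots are three copies of the weights
  of \<open>V\<close> and its dual, one copy for each outer simple root. The thirds and halves in
  the second component make its entries sum to zero and be permuted by triality.\<close>

definition coords_of :: "mat8 \<Rightarrow> coord" where
  "coords_of x =
    ((\<chi> a b. x$vpos a$vpos b - (if a = b then vtrace x / 3 else 0)),
     (\<chi> i. if i = 0 then - vtrace x / 3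
           else if i = 1 then (vtrace x / 3 - x$3$3) / 2 else (vtrace x / 3 + x$3$3) / 2),
     (\<chi> i a. if i = 0 then x$dpos (a + 2)$vpos (a + 1) else if i = 1 then x$4$dpos a else x$3$dpos a),
     (\<chi> i a. if i = 0 then x$vpos (a + 2)$dpos (a + 1) else if i = 1 then x$3$vpos a else x$4$vpos a))"

definition mat_of :: "coord \<Rightarrow> mat8" where
  "mat_of = (\<lambda>(A, l, v, c).
     (\<Sum>a\<in>UNIV. \<Sum>b\<in>UNIV. cmul (A$a$b - (if a = b then l$0 else 0)) (Fm (vpos a) (vpos b)))
     + cmul (l$2 - l$1) (Fm 3 3)
     + (\<Sum>a\<in>UNIV. cmul (v$0$a) (Fm (dpos (a + 2)) (vpos (a + 1)))
          + cmul (v$1$a) (Fm 4 (dpos a)) + cmul (v$2$a) (Fm 3 (dpos a))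
          + cmul (c$0$a) (Fm (vpos (a + 2)) (dpos (a + 1)))
          + cmul (c$1$a) (Fm 3 (vpos a)) + cmul (c$2$a) (Fm 4 (vpos a))))"

definition coord_space :: "coord set" where
  "coord_space = {(A, l, v, c). (\<Sum>a\<in>UNIV. A$a$a) = 0 \<and> (\<Sum>i\<in>UNIV. l$i) = 0}"

text \<open>The formula singles out no index: the cross-product terms are symmetric in
  \<open>i+1\<close> and \<open>i+2\<close>. Compatibility with permutations of the indices is
  therefore visible here, while it is hidden in the matrix form of \<open>so8\<close>.\<close>

definition coord_bracket :: "coord \<Rightarrow> coord \<Rightarrow> coord" where
  "coord_bracket = (\<lambda>(A, l, v, c) (A', l', v', c').
     let d = (\<lambda>i. \<Sum>a\<in>UNIV. v$i$a * c'$i$a - v'$i$a * c$i$a); D = (\<Sum>i\<in>UNIV. d i) / 3 in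
     ((\<chi> a b. (\<Sum>e\<in>UNIV. A$a$e * A'$e$b - A'$a$e * A$e$b)
        - (\<Sum>i\<in>UNIV. v$i$a * c'$i$b - v'$i$a * c$i$b) + (if a = b then D else 0)),
      (\<chi> i. D - d i),
      (\<chi> i a. (\<Sum>b\<in>UNIV. A$a$b * v'$i$b - A'$a$b * v$i$b) + 2 * l$i * v'$i$a - 2 * l'$i * v$i$a
        + (c$(i+1)$(a+1) * c'$(i+2)$(a+2) - c$(i+1)$(a+2) * c'$(i+2)$(a+1))
        + (c$(i+2)$(a+1) * c'$(i+1)$(a+2) - c$(i+2)$(a+2) * c'$(i+1)$(a+1))),
      (\<chi> i a. (\<Sum>b\<in>UNIV. A'$b$a * c$i$b - A$b$a * c'$i$b) - 2 * l$i * c'$i$a + 2 * l'$i * c$i$a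
        + (v$(i+1)$(a+1) * v'$(i+2)$(a+2) - v$(i+1)$(a+2) * v'$(i+2)$(a+1))
        + (v$(i+2)$(a+1) * v'$(i+1)$(a+2) - v$(i+2)$(a+2) * v'$(i+1)$(a+1)))))"

lemmas vpos_simps = vpos_def dpos_def

lemma mat_of_so8: "mat_of k \<in> so8"
  unfolding mat_of_def by (auto simp: case_prod_unfold intro!: so8_add so8_sum so8_cmul Fm_so8)

text \<open>Oriented as rewrite rules that leave only 28 independent entries, so that identities on
  \<open>so8\<close> become polynomial identities.\<close>

lemma so8_rel:
  assumes "x \<in> so8"
  shows "x$0$7 = 0" "x$1$6 = 0" "x$2$5 = 0" "x$3$4 = 0" "x$4$3 = 0" "x$5$2 = 0" "x$6$1 = 0" "x$7$0 = 0"
    "x$4$4 = - x$3$3" "x$5$5 = - x$2$2" "x$6$6 = - x$1$1" "x$7$7 = - x$0$0"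
    "x$6$7 = - x$0$1" "x$5$7 = - x$0$2" "x$4$7 = - x$0$3" "x$3$7 = - x$0$4" "x$2$7 = - x$0$5" "x$1$7 = - x$0$6"
    "x$7$6 = - x$1$0" "x$5$6 = - x$1$2" "x$4$6 = - x$1$3" "x$3$6 = - x$1$4" "x$2$6 = - x$1$5"
    "x$7$5 = - x$2$0" "x$6$5 = - x$2$1" "x$4$5 = - x$2$3" "x$3$5 = - x$2$4"
    "x$7$4 = - x$3$0" "x$6$4 = - x$3$1" "x$5$4 = - x$3$2"
    "x$7$3 = - x$4$0" "x$6$3 = - x$4$1" "x$5$3 = - x$4$2"
    "x$7$2 = - x$5$0" "x$6$2 = - x$5$1" "x$7$1 = - x$6$0"
proof -
  have *: "x$i$j = - x$(7-j)$(7-i)" for i j using assms so8_iff by blast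
  show "x$0$7 = 0" "x$1$6 = 0" "x$2$5 = 0" "x$3$4 = 0" "x$4$3 = 0" "x$5$2 = 0" "x$6$1 = 0" "x$7$0 = 0"
    using *[of 0 7] *[of 1 6] *[of 2 5] *[of 3 4] *[of 4 3] *[of 5 2] *[of 6 1] *[of 7 0] by simp_all
  show "x$4$4 = - x$3$3" "x$5$5 = - x$2$2" "x$6$6 = - x$1$1" "x$7$7 = - x$0$0"
    "x$6$7 = - x$0$1" "x$5$7 = - x$0$2" "x$4$7 = - x$0$3" "x$3$7 = - x$0$4" "x$2$7 = - x$0$5" "x$1$7 = - x$0$6"
    "x$7$6 = - x$1$0" "x$5$6 = - x$1$2" "x$4$6 = - x$1$3" "x$3$6 = - x$1$4" "x$2$6 = - x$1$5"
    "x$7$5 = - x$2$0" "x$6$5 = - x$2$1" "x$4$5 = - x$2$3" "x$3$5 = - x$2$4"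
    "x$7$4 = - x$3$0" "x$6$4 = - x$3$1" "x$5$4 = - x$3$2"
    "x$7$3 = - x$4$0" "x$6$3 = - x$4$1" "x$5$3 = - x$4$2"
    "x$7$2 = - x$5$0" "x$6$2 = - x$5$1" "x$7$1 = - x$6$0"
    by (subst *, simp)+
qed

lemma coords_of_mat_of: "k \<in> coord_space \<Longrightarrow> coords_of (mat_of k) = k"
proof -
  assume "k \<in> coord_space"
  then obtain A l v c where k: "k = (A, l, v, c)"
    and t: "A$0$0 + A$1$1 + A$2$2 = 0" "l$0 + l$1 + l$2 = 0"
    by (cases k) (auto simp: coord_space_def sum_UNIV_3)
  have t': "A$0$0 = - A$1$1 - A$2$2" "l$0 = - l$1 - l$2" using t by (simp_all add: eq_neg_iff_add_eq_0 algebra_simps)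
  show ?thesis
    unfolding k coords_of_def mat_of_def vtrace_def
    by (simp add: vec_eq_iff all_3 sum_UNIV_3 vpos_simps Fm_nth cmul_def t' field_simps)
qed

lemma mat_of_coords_of:
  assumes "x \<in> so8"
  shows "mat_of (coords_of x) = x"
  unfolding coords_of_def mat_of_def vtrace_def vec_eq_iff all_8
  by (simp add: sum_UNIV_3 vpos_simps Fm_nth cmul_def so8_rel[OF assms] field_simps)

lemma coords_of_in_space: "coords_of x \<in> coord_space"
  by (simp add: coords_of_def coord_space_def sum_UNIV_3 vpos_simps vtrace_def field_simps)

lemma bracket_nth: "bracket x y $ i $ j = (\<Sum>k\<in>UNIV. x$i$k * y$k$j - y$i$k * x$k$j)"
  by (simp add: bracket_def matrix_matrix_mult_def sum_subtractf)

lemma coords_of_bracket: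
  assumes "x \<in> so8" "y \<in> so8"
  shows "coords_of (bracket x y) = coord_bracket (coords_of x) (coords_of y)"
  unfolding coords_of_def coord_bracket_def vtrace_def
  by (simp add: vec_eq_iff all_3 Let_def sum_UNIV_3 sum_UNIV_8 bracket_nth vpos_simps so8_rel[OF assms(1)] so8_rel[OF assms(2)] field_simps)

(* Quantifiers over coord would otherwise be split into four components. *)
declare split_paired_All [simp del] split_paired_Ex [simp del]

section \<open>Averages of polynomials modulo the relations of the minimal orbit\<close>

lemma polyfun_sum:
  assumes "\<And>i. i \<in> I \<Longrightarrow> f i \<in> polyfun C"
  shows "(\<lambda>x. \<Sum>i\<in>I. f i x) \<in> polyfun C"
  using assms by (induction I rule: infinite_finite_induct) (auto intro: polyfun.intros)

lemma polyfun_uminus: "p \<in> polyfun C \<Longrightarrow> (\<lambda>x. - p x) \<in> polyfun C"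
  using polyfun.mult[OF polyfun.const[of "-1"], of p] by simp

lemma polyfun_diff: "p \<in> polyfun C \<Longrightarrow> q \<in> polyfun C \<Longrightarrow> (\<lambda>x. p x - q x) \<in> polyfun C"
  using polyfun.add[OF _ polyfun_uminus, of p C q] by simp

lemma polyfun_power: "p \<in> polyfun C \<Longrightarrow> (\<lambda>x. p x ^ n) \<in> polyfun C"
  by (induction n) (auto intro: polyfun.intros)

lemma polyfun_compose:
  assumes "p \<in> polyfun C" "\<And>c. c \<in> C \<Longrightarrow> (\<lambda>x. c (f x)) \<in> polyfun D"
  shows "(\<lambda>x. p (f x)) \<in> polyfun D"
  using assms(1) by induction (auto intro: polyfun.intros assms(2))

lemmas polyfun_intros = polyfun.const polyfun.add polyfun.mult polyfun_sum polyfun_uminus polyfun_diff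
  polyfun_power

text \<open>Reduces statements that are linear in a polynomial to single monomials, kept as lists of
  factors.\<close>

lemma polyfun_monomial_sum:
  assumes "q \<in> polyfun C"
  obtains L where "\<And>x. q x = (\<Sum>(a, ms)\<leftarrow>L. a * (\<Prod>m\<leftarrow>ms. m x))" "\<forall>(a, ms)\<in>set L. set ms \<subseteq> C"
proof -
  have "\<exists>L. (\<forall>x. q x = (\<Sum>(a, ms)\<leftarrow>L. a * (\<Prod>m\<leftarrow>ms. m x))) \<and> (\<forall>(a, ms)\<in>set L. set ms \<subseteq> C)"
    using assms
  proof induction
    case (const c)
    show ?case by (rule exI[of _ "[(c, [])]"]) simp
  next
    case (coord p)
    then show ?case by (intro exI[of _ "[(1, [p])]"]) simp
  next
    case (add p q)
    then obtain L M where "\<forall>x. p x = (\<Sum>(a, ms)\<leftarrow>L. a * (\<Prod>m\<leftarrow>ms. m x))" "\<forall>(a, ms)\<in>set L. set ms \<subseteq> C"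
      "\<forall>x. q x = (\<Sum>(a, ms)\<leftarrow>M. a * (\<Prod>m\<leftarrow>ms. m x))" "\<forall>(a, ms)\<in>set M. set ms \<subseteq> C" by blast
    then show ?case by (intro exI[of _ "L @ M"]) auto
  next
    case (mult p q)
    then obtain L M where L: "\<forall>x. p x = (\<Sum>(a, ms)\<leftarrow>L. a * (\<Prod>m\<leftarrow>ms. m x))" "\<forall>(a, ms)\<in>set L. set ms \<subseteq> C"
      and M: "\<forall>x. q x = (\<Sum>(a, ms)\<leftarrow>M. a * (\<Prod>m\<leftarrow>ms. m x))" "\<forall>(a, ms)\<in>set M. set ms \<subseteq> C" by blast
    let ?N = "concat (map (\<lambda>(a, ms). map (\<lambda>(b, ns). (a * b, ms @ ns)) M) L)"
    have 1: "(\<Sum>(b, ns)\<leftarrow>map (\<lambda>(b, ns). (a * b, ms @ ns)) M. b * (\<Prod>m\<leftarrow>ns. m x))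
      = a * (\<Prod>m\<leftarrow>ms. m x) * (\<Sum>(b, ns)\<leftarrow>M. b * (\<Prod>m\<leftarrow>ns. m x))" for a ms and x
      by (induction M) (auto simp: algebra_simps)
    have "(\<Sum>(b, ns)\<leftarrow>?N. b * (\<Prod>m\<leftarrow>ns. m x))
      = (\<Sum>(a, ms)\<leftarrow>L. a * (\<Prod>m\<leftarrow>ms. m x)) * (\<Sum>(b, ns)\<leftarrow>M. b * (\<Prod>m\<leftarrow>ns. m x))" for x
      by (induction L) (auto simp: 1 algebra_simps simp del: map_map)
    moreover have "\<forall>(a, ms)\<in>set ?N. set ms \<subseteq> C" using L(2) M(2) by fastforce
    ultimately show ?case using L(1) M(1) by (intro exI[of _ ?N]) auto
  qed
  then show ?thesis using that by blast
qed

section \<open>Index symmetries, the averaging operator and the relations\<close>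

definition cA :: "coord \<Rightarrow> mat3" where "cA k = fst k"
definition cl :: "coord \<Rightarrow> complex^3" where "cl k = fst (snd k)"
(* True selects the vectors v, False the covectors chi; relations are stated uniformly in this flag. *)
definition cv :: "bool \<Rightarrow> coord \<Rightarrow> mat3" where
  "cv b k = (if b then fst (snd (snd k)) else snd (snd (snd k)))"

text \<open>The affine maps \<open>i \<mapsto> a + e i\<close> with \<open>e = 1\<close> or \<open>e = -1\<close> are all permutations of three indices.\<close>
definition relab :: "3 \<Rightarrow> 3 \<Rightarrow> coord \<Rightarrow> coord" where
  "relab a e k = (cA k, (\<chi> i. cl k$(a + e * i)), (\<chi> i. cv True k$(a + e * i)), (\<chi> i. cv False k$(a + e * i)))"

definition flip_sign :: "3 \<Rightarrow> 3 \<Rightarrow> complex" where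
  "flip_sign m i = (if i = m then 1 else -1)"

text \<open>Together with the identity the three flips form the Klein four-group of even sign
  changes.\<close>

definition flip :: "3 \<Rightarrow> coord \<Rightarrow> coord" where
  "flip m k = (cA k, cl k, (\<chi> i a. flip_sign m i * cv True k$i$a), (\<chi> i a. flip_sign m i * cv False k$i$a))"

text \<open>The sum over all 24 products of one of six relabellings with the identity or a flip. The
  division by 24 is postponed to the end.\<close>

definition avg :: "(coord \<Rightarrow> complex) \<Rightarrow> coord \<Rightarrow> complex" where
  "avg f k = (\<Sum>e\<in>{1,-1}. \<Sum>a\<in>UNIV. f (relab a e k) + (\<Sum>m\<in>UNIV. f (flip m (relab a e k))))"

definition tgt_of :: "coord \<Rightarrow> tgt" where
  "tgt_of k = (cA k, (\<chi> a b. \<Sum>i\<in>UNIV. cv True k$i$a * cv True k$i$b),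
     (\<chi> a b. \<Sum>i\<in>UNIV. cv False k$i$a * cv False k$i$b))"

definition cAt :: "bool \<Rightarrow> coord \<Rightarrow> 3 \<Rightarrow> 3 \<Rightarrow> complex" where
  "cAt b k a e = (if b then cA k$a$e else cA k$e$a)"

definition tr2 :: "mat3 \<Rightarrow> complex" where
  "tr2 A = (\<Sum>a\<in>UNIV. \<Sum>b\<in>UNIV. A$a$b * A$b$a)"
definition tr3 :: "mat3 \<Rightarrow> complex" where
  "tr3 A = (\<Sum>a\<in>UNIV. \<Sum>b\<in>UNIV. \<Sum>d\<in>UNIV. A$a$b * A$b$d * A$d$a)"

text \<open>Eigenvectors \<open>v\<^sub>i\<close> and \<open>\<chi>\<^sub>i\<close> of a matrix \<open>A\<close> with eigenvalues \<open>\<lambda>\<^sub>i\<close>, scaled so that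
  \<open>v\<^sub>i \<otimes> \<chi>\<^sub>i = (A - \<lambda>\<^sub>j)(A - \<lambda>\<^sub>k)\<close>, \<open>v\<^sub>i \<times> v\<^sub>j = (\<lambda>\<^sub>j - \<lambda>\<^sub>i) \<chi>\<^sub>k\<close> and
  \<open>\<chi>\<^sub>i \<times> \<chi>\<^sub>j = (\<lambda>\<^sub>i - \<lambda>\<^sub>j) v\<^sub>k\<close>. The third index is \<open>-i-j\<close>.\<close>
definition rels :: "coord set" where
  "rels = {k. (\<Sum>i\<in>UNIV. cl k$i) = 0 \<and> (\<Sum>i\<in>UNIV. (cl k$i)^2) = tr2 (cA k) \<and> (\<Sum>i\<in>UNIV. (cl k$i)^3) = tr3 (cA k)
     \<and> (\<forall>b i a. cl k$i * cv b k$i$a = (\<Sum>e\<in>UNIV. cAt b k a e * cv b k$i$e))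
     \<and> (\<forall>i a a'. cv True k$i$a * cv False k$i$a' = (\<Sum>e\<in>UNIV. cA k$a$e * cA k$e$a') + cl k$i * cA k$a$a'
          + (if a = a' then (cl k$i)^2 - tr2 (cA k) / 2 else 0))
     \<and> (\<forall>b i j a a'. i \<noteq> j \<longrightarrow> cv b k$i$a * cv b k$j$a' =
          (if b then 1 else -1) *
          ((cAt b k a' (a+1) - (if a' = a+1 then cl k$i else 0)) * cv (\<not>b) k$(-i-j)$(a+2)
           - (cAt b k a' (a+2) - (if a' = a+2 then cl k$i else 0)) * cv (\<not>b) k$(-i-j)$(a+1)))}"

lemma relsD:
  assumes "k \<in> rels"
  shows "(\<Sum>i\<in>UNIV. cl k$i) = 0" "(\<Sum>i\<in>UNIV. (cl k$i)^2) = tr2 (cA k)" "(\<Sum>i\<in>UNIV. (cl k$i)^3) = tr3 (cA k)"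
    "cl k$i * cv b k$i$a = (\<Sum>e\<in>UNIV. cAt b k a e * cv b k$i$e)"
    "cv True k$i$a * cv False k$i$a' = (\<Sum>e\<in>UNIV. cA k$a$e * cA k$e$a') + cl k$i * cA k$a$a'
          + (if a = a' then (cl k$i)^2 - tr2 (cA k) / 2 else 0)"
    "i \<noteq> j \<Longrightarrow> cv b k$i$a * cv b k$j$a' =
          (if b then 1 else -1) *
          ((cAt b k a' (a+1) - (if a' = a+1 then cl k$i else 0)) * cv (\<not>b) k$(-i-j)$(a+2)
           - (cAt b k a' (a+2) - (if a' = a+2 then cl k$i else 0)) * cv (\<not>b) k$(-i-j)$(a+1))"
  using assms unfolding rels_def mem_Collect_eq by blast+

lemma coord_proj_simps [simp]:
  "cA (relab a e k) = cA k" "cl (relab a e k) = (\<chi> i. cl k$(a + e * i))"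
  "cv b (relab a e k) = (\<chi> i. cv b k$(a + e * i))"
  "cA (flip m k) = cA k" "cl (flip m k) = cl k"
  "cv b (flip m k) = (\<chi> i a. flip_sign m i * cv b k$i$a)"
  "cAt b (relab a e k) = cAt b k" "cAt b (flip m k) = cAt b k"
  by (auto simp: cA_def cl_def cv_def relab_def flip_def cAt_def fun_eq_iff)

lemma numeral_3_simps: "(3::3) = 0" "(4::3) = 1" "(-1::3) = 2" "(-2::3) = 1" by simp_all

lemma unit_sum: 
  fixes f :: "3 \<Rightarrow> complex"
  assumes "e = 1 \<or> e = -1" shows "(\<Sum>i\<in>UNIV. f (a + e * i)) = (\<Sum>i\<in>UNIV. f i)"
proof -
  have "bij (\<lambda>i::3. a + e * i)"
    using assms by (intro o_bij[of "\<lambda>i. e * (i - a)"]) (auto simp: fun_eq_iff algebra_simps)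
  then show ?thesis by (rule sum.reindex_bij_betw)
qed

lemma triple_3: "(a::3) + a + a = 0"
  using all_3[of "\<lambda>a. a + a + a = 0"] by auto

text \<open>For distinct \<open>i\<close> and \<open>j\<close> the third index is
  \<open>- i - j\<close>, because all three indices sum to 0 modulo 3. An affine map respects this
  because \<open>a + a + a = 0\<close>.\<close>

lemma third_index: "- (a + e * i) - (a + e * j) = a + e * (- i - j)" for a e i j :: 3
proof -
  have "a + e * (- i - j) - (- (a + e * i) - (a + e * j)) = a + a + a" by (simp add: algebra_simps)
  then show ?thesis by (simp only: triple_3 eq_iff_diff_eq_0[symmetric] right_minus_eq)
qed

lemma relab_inj: "e = 1 \<or> e = -1 \<Longrightarrow> i \<noteq> j \<Longrightarrow> a + e * i \<noteq> a + e * (j::3)"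
  by auto

lemma relab_rels: 
  assumes "k \<in> rels" "e = 1 \<or> e = -1" shows "relab a e k \<in> rels"
  using assms(1) relab_inj[OF assms(2), of _ _ a]
  unfolding rels_def mem_Collect_eq
  by (simp add: third_index[symmetric] unit_sum[OF assms(2), where f="\<lambda>i. cl k$i"]
      unit_sum[OF assms(2), where f="\<lambda>i. (cl k$i)^2"] unit_sum[OF assms(2), where f="\<lambda>i. (cl k$i)^3"])

lemma flip_sign_sq: "flip_sign m i * flip_sign m i = 1"
  by (simp add: flip_sign_def)

text \<open>The three signs of a flip multiply to 1 and each is its own inverse. Hence the relation
  trading two vectors for the covector of the third index survives a flip.\<close>

lemma flip_sign_mult: "i \<noteq> j \<Longrightarrow> flip_sign m i * flip_sign m j = flip_sign m (-i-j)"
proof -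
  have "\<forall>i j m. i \<noteq> j \<longrightarrow> flip_sign m i * flip_sign m j = flip_sign m (-i-j)"
    unfolding all_3 by (simp add: flip_sign_def)
  then show "i \<noteq> j \<Longrightarrow> ?thesis" by blast
qed

lemma flip_sign_cancel: "flip_sign m i * x * (flip_sign m i * y) = x * y"
proof -
  have "flip_sign m i * x * (flip_sign m i * y) = (flip_sign m i * flip_sign m i) * (x * y)" by (simp only: ac_simps)
  then show ?thesis by (simp add: flip_sign_sq)
qed

lemma flip_rels:
  assumes k: "k \<in> rels" shows "flip m k \<in> rels"
proof -
  have 2: "flip_sign m i * x * (flip_sign m j * y) = flip_sign m (-i-j) * (x * y)" if "i \<noteq> j" for i j x y
    unfolding flip_sign_mult[OF that, symmetric] by (simp only: ac_simps)
  show ?thesis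
    unfolding rels_def mem_Collect_eq coord_proj_simps vec_lambda_beta
  proof (intro conjI allI impI)
    fix b i a
    have "cl k$i * (flip_sign m i * cv b k$i$a) = flip_sign m i * (\<Sum>e\<in>UNIV. cAt b k a e * cv b k$i$e)"
      unfolding relsD(4)[OF k, symmetric] by (rule mult.left_commute)
    then show "cl k$i * (flip_sign m i * cv b k$i$a) = (\<Sum>e\<in>UNIV. cAt b k a e * (flip_sign m i * cv b k$i$e))"
      by (simp only: sum_distrib_left mult.left_commute)
  next
    fix b i j a a' assume ij: "i \<noteq> (j::3)"
    have d: "s * (t * (x * y - x' * y')) = t * (x * (s * y) - x' * (s * y'))" for s t x y x' y' :: complex
      by (simp add: algebra_simps)
    show "flip_sign m i * cv b k$i$a * (flip_sign m j * cv b k$j$a') =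
          (if b then 1 else -1) *
          ((cAt b k a' (a+1) - (if a' = a+1 then cl k$i else 0)) * (flip_sign m (-i-j) * cv (\<not>b) k$(-i-j)$(a+2))
           - (cAt b k a' (a+2) - (if a' = a+2 then cl k$i else 0)) * (flip_sign m (-i-j) * cv (\<not>b) k$(-i-j)$(a+1)))"
      unfolding 2[OF ij] relsD(6)[OF k ij] by (rule d)
  qed (simp_all only: flip_sign_cancel relsD[OF k])
qed

text \<open>\<open>rels\<close> is stable under relabellings and flips, so the relations may be
  applied under \<open>avg\<close>.\<close>

lemma avg_cong:
  assumes "\<And>k. k \<in> rels \<Longrightarrow> f k = g k" "k \<in> rels"
  shows "avg f k = avg g k"
  unfolding avg_def using assms by (intro sum.cong refl arg_cong2[where f="(+)"]) (auto simp: relab_rels flip_rels)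

lemma avg_add: "avg (\<lambda>k. f k + g k) k = avg f k + avg g k"
  unfolding avg_def by (simp add: sum.distrib algebra_simps)

lemma avg_mult:
  assumes "\<And>a e k. h (relab a e k) = h k" "\<And>m k. h (flip m k) = h k"
  shows "avg (\<lambda>k. h k * f k) k = h k * avg f k"
  unfolding avg_def by (simp only: assms sum_distrib_left distrib_left)

section \<open>Functions on \<open>rels\<close> that factor through the quotient map\<close>

definition good :: "(coord \<Rightarrow> complex) \<Rightarrow> bool" where
  "good f \<longleftrightarrow> (\<exists>p\<in>polyfun coords_tgt. \<forall>k\<in>rels. f k = p (tgt_of k))"

lemma good_cong:
  assumes "\<And>k. k \<in> rels \<Longrightarrow> f k = g k" "good g" shows "good f"
proof -
  obtain p where "p \<in> polyfun coords_tgt" "\<forall>k\<in>rels. g k = p (tgt_of k)" using assms(2) good_def by blast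
  with assms(1) show ?thesis unfolding good_def by (intro bexI[of _ p] ballI) simp_all
qed

lemma good_const: "good (\<lambda>k. c)"
  unfolding good_def by (rule bexI[OF _ polyfun.const[of c]]) simp

lemma
  assumes "good f" "good g"
  shows good_add: "good (\<lambda>k. f k + g k)" and good_mult: "good (\<lambda>k. f k * g k)"
proof -
  obtain p q where "p \<in> polyfun coords_tgt" "\<forall>k\<in>rels. f k = p (tgt_of k)"
    "q \<in> polyfun coords_tgt" "\<forall>k\<in>rels. g k = q (tgt_of k)"
    using assms good_def by blast
  then show "good (\<lambda>k. f k + g k)" "good (\<lambda>k. f k * g k)"
    unfolding good_def by (intro bexI[OF _ polyfun.add[of p _ q]] bexI[OF _ polyfun.mult[of p _ q]]; simp)+
qed

lemma good_uminus: "good f \<Longrightarrow> good (\<lambda>k. - f k)"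
  using good_mult[OF good_const[of "-1"]] by simp

lemma good_diff: "good f \<Longrightarrow> good g \<Longrightarrow> good (\<lambda>k. f k - g k)"
  using good_add[of f "\<lambda>k. - g k"] good_uminus[of g] by simp

lemma good_sum: "(\<And>i. i \<in> I \<Longrightarrow> good (f i)) \<Longrightarrow> good (\<lambda>k. \<Sum>i\<in>I. f i k)"
  by (induction I rule: infinite_finite_induct) (auto intro: good_const good_add)

lemma good_A: "good (\<lambda>k. cA k$a$b)"
  unfolding good_def
  by (rule bexI[of _ "\<lambda>(A,B,C). A$a$b"]) (auto simp: tgt_of_def coords_tgt_def intro!: polyfun.coord)

lemma good_cAt: "good (\<lambda>k. cAt b k a e)"
  unfolding cAt_def by (cases b) (auto intro: good_A)

lemma good_quadratic: "good (\<lambda>k. \<Sum>i\<in>UNIV. cv b k$i$a * cv b k$i$a')"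
proof (cases b)
  case True
  then show ?thesis unfolding good_def
    by (intro bexI[of _ "\<lambda>(A,B,C). B$a$a'"]) (auto simp: tgt_of_def coords_tgt_def intro!: polyfun.coord)
next
  case False
  then show ?thesis unfolding good_def
    by (intro bexI[of _ "\<lambda>(A,B,C). C$a$a'"]) (auto simp: tgt_of_def coords_tgt_def intro!: polyfun.coord)
qed

lemma good_tr: "good (\<lambda>k. tr2 (cA k))" "good (\<lambda>k. tr3 (cA k))"
  unfolding tr2_def tr3_def by (intro good_sum good_mult good_A)+

definition avgood :: "(coord \<Rightarrow> complex) \<Rightarrow> bool" where "avgood f \<longleftrightarrow> good (avg f)"

lemma avgood_cong: "(\<And>k. k \<in> rels \<Longrightarrow> f k = g k) \<Longrightarrow> avgood g \<Longrightarrow> avgood f"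
  unfolding avgood_def by (rule good_cong[OF avg_cong])

lemma avgood_add: "avgood f \<Longrightarrow> avgood g \<Longrightarrow> avgood (\<lambda>k. f k + g k)"
  unfolding avgood_def avg_add by (rule good_add)

text \<open>Averaging is linear over invariants, and all 24 maps leave \<open>A\<close>
  unchanged.\<close>

lemma avgood_mult:
  assumes "\<And>k k'. cA k = cA k' \<Longrightarrow> h k = h k'" "good h" "avgood f"
  shows "avgood (\<lambda>k. h k * f k)"
proof -
  have "h (relab a e k) = h k" "h (flip m k) = h k" for a e m k
    by (rule assms(1), simp)+
  then have "avg (\<lambda>k. h k * f k) = (\<lambda>k. h k * avg f k)"
    by (intro ext avg_mult)
  then show ?thesis using assms(2,3) good_mult[of h "avg f"] unfolding avgood_def by simp
qed

lemma avgood_cmult: "avgood f \<Longrightarrow> avgood (\<lambda>k. c * f k)"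
  by (rule avgood_mult[where h="\<lambda>_. c"]) (auto intro: good_const)

lemma avgood_zero: "avgood (\<lambda>k. 0)"
  unfolding avgood_def avg_def by (simp add: good_const)

section \<open>Words in the vectors and covectors\<close>

definition letter :: "bool \<times> 3 \<times> 3 \<Rightarrow> coord \<Rightarrow> complex" where
  "letter = (\<lambda>(b, i, a) k. cv b k$i$a)"
definition word :: "(bool \<times> 3 \<times> 3) list \<Rightarrow> coord \<Rightarrow> complex" where
  "word w k = (\<Prod>x\<leftarrow>w. letter x k)"
definition lcoords :: "(coord \<Rightarrow> complex) set" where
  "lcoords = range (\<lambda>i k. cl k$i)"

lemma word_simps [simp]: "word [] k = 1" "word (x # w) k = letter x k * word w k"
  "word (w @ w') k = word w k * word w' k"
  by (auto simp: word_def)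

lemma word_remove1: "x \<in> set w \<Longrightarrow> word w k = letter x k * word (remove1 x w) k"
  by (induction w) auto

lemma lcoord_poly: "(\<lambda>k. cl k$i) \<in> polyfun lcoords"
  by (auto simp: lcoords_def intro: polyfun.coord)

definition words_good :: "nat \<Rightarrow> bool" where
  "words_good n \<longleftrightarrow> (\<forall>w f. length w < n \<longrightarrow> f \<in> polyfun lcoords \<longrightarrow> avgood (\<lambda>k. f k * word w k))"

lemma words_goodD: "words_good n \<Longrightarrow> length w < n \<Longrightarrow> f \<in> polyfun lcoords \<Longrightarrow> avgood (\<lambda>k. f k * word w k)"
  unfolding words_good_def by blast

text \<open>Two letters become one: vectors of two distinct indices are traded for a covector of the
  third index, and dually.\<close>

lemma avgood_same_type:
  assumes n: "words_good n" "length w + 2 \<le> n" and ij: "i \<noteq> j" and f: "f \<in> polyfun lcoords"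
  shows "avgood (\<lambda>k. f k * (letter (b,i,a) k * letter (b,j,a') k * word w k))"
proof -
  let ?s = "if b then 1 else - 1 :: complex"
  let ?d = "\<lambda>m. if a' = m then 1 else 0 :: complex"
  let ?x = "\<lambda>m. (\<not>b, -i-j, m) # w"
  have 1: "avgood (\<lambda>k. g k * word (?x m) k)" if "g \<in> polyfun lcoords" for g m
    using words_goodD[OF n(1) _ that, of "?x m"] n(2) by simp
  have 2: "avgood (\<lambda>k. cAt b k p q * (f k * word (?x m) k))" for p q m
    by (rule avgood_mult[OF _ good_cAt 1[OF f]]) (simp add: cAt_def)
  have 3: "avgood (\<lambda>k. (f k * cl k$i) * word (?x m) k)" for m
    by (intro 1 polyfun.mult f lcoord_poly)
  have "avgood (\<lambda>k. (?s * (cAt b k a' (a+1) * (f k * word (?x (a+2)) k)) + (- ?s * ?d (a+1)) * ((f k * cl k$i) * word (?x (a+2)) k))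
     + ((- ?s) * (cAt b k a' (a+2) * (f k * word (?x (a+1)) k)) + (?s * ?d (a+2)) * ((f k * cl k$i) * word (?x (a+1)) k)))"
    by (intro avgood_add avgood_cmult 2 3)
  then show ?thesis
    by (rule avgood_cong[rotated]) (simp only: letter_def prod.case relsD(6)[OF _ ij], simp add: letter_def algebra_simps)
qed

text \<open>Two letters become none. The right side of the relation is
  \<open>(A - l_j)(A - l_k)\<close>, rewritten with the zero sum of the eigenvalues so that only
  \<open>l_i\<close> occurs: \<open>l_j + l_k = - l_i\<close> and
  \<open>l_j l_k = l_i^2 - tr2 / 2\<close>.\<close>

lemma avgood_same_index:
  assumes n: "words_good n" "length w + 2 \<le> n" and f: "f \<in> polyfun lcoords"
  shows "avgood (\<lambda>k. f k * (letter (True,i,a) k * letter (False,i,a') k * word w k))"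
proof -
  let ?d = "if a = a' then 1 else 0 :: complex"
  have 1: "avgood (\<lambda>k. g k * word w k)" if "g \<in> polyfun lcoords" for g
    using words_goodD[OF n(1) _ that, of w] n(2) by simp
  have "avgood (\<lambda>k. (\<Sum>e\<in>UNIV. cA k$a$e * cA k$e$a') * (f k * word w k) + cA k$a$a' * ((f k * cl k$i) * word w k)
    + (?d * ((f k * (cl k$i)^2) * word w k) + (- ?d / 2) * (tr2 (cA k) * (f k * word w k))))"
    by (intro avgood_add avgood_cmult avgood_mult[OF _ _ 1] good_sum good_mult good_A good_tr f polyfun_intros lcoord_poly 1) auto
  then show ?thesis
    by (rule avgood_cong[rotated]) (simp only: letter_def prod.case relsD(5), simp add: algebra_simps)
qed

section \<open>Power sums weighted by words at a single index\<close>

definition iword :: "(bool \<times> 3) list \<Rightarrow> 3 \<Rightarrow> coord \<Rightarrow> complex" where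
  "iword u i k = (\<Prod>(b, a)\<leftarrow>u. cv b k$i$a)"

lemma iword_simps [simp]: "iword [] i k = 1" "iword ((b, a) # u) i k = cv b k$i$a * iword u i k"
  "iword (u @ u') i k = iword u i k * iword u' i k"
  by (auto simp: iword_def)

lemma iword_word: "iword u i k = word (map (\<lambda>(b, a). (b, i, a)) u) k"
  by (induction u) (auto simp: letter_def)

lemma iword_relab: "iword u i (relab a e k) = iword u (a + e * i) k"
  by (induction u) auto

lemma iword_flip: "iword u i (flip m k) = flip_sign m i ^ length u * iword u i k"
  by (induction u) (auto simp: algebra_simps)

lemma flip_sign_even: "even n \<Longrightarrow> flip_sign m i ^ n = 1"
  by (auto simp: flip_sign_def elim: evenE)

lemma iword_flip_even: "even (length u) \<Longrightarrow> iword u i (flip m k) = iword u i k"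
  by (simp add: iword_flip flip_sign_even)

definition psum :: "nat \<Rightarrow> (bool \<times> 3) list \<Rightarrow> coord \<Rightarrow> complex" where
  "psum s u k = (\<Sum>i\<in>UNIV. (cl k$i)^s * iword u i k)"

lemma avg_flip_invariant:
  assumes "\<And>m k. f (flip m k) = f k"
  shows "avg f k = 4 * (\<Sum>e\<in>{1,-1}. \<Sum>a\<in>UNIV. f (relab a e k))"
  unfolding avg_def assms by (simp add: sum_distrib_left sum.distrib)

text \<open>The 8 counts four sign patterns and, for each target index, the two affine maps sending
  0 to it.\<close>

lemma avg_single: "even (length u) \<Longrightarrow> avg (\<lambda>k. (cl k$0)^s * iword u 0 k) = (\<lambda>k. 8 * psum s u k)"
  by (rule ext, subst avg_flip_invariant) (simp_all add: iword_flip_even iword_relab psum_def)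

text \<open>The six affine maps are sharply 2-transitive, so the images of \<open>(i, j)\<close> run
  once through all ordered pairs of distinct indices.\<close>

lemma sum_affine_pairs:
  fixes h :: "3 \<Rightarrow> 3 \<Rightarrow> complex"
  assumes "i \<noteq> j"
  shows "(\<Sum>e\<in>{1,-1}. \<Sum>a\<in>UNIV. h (a + e * i) (a + e * j)) = (\<Sum>i\<in>UNIV. \<Sum>j\<in>UNIV. h i j) - (\<Sum>i\<in>UNIV. h i i)"
proof -
  have "\<forall>i j. i \<noteq> j \<longrightarrow> (\<Sum>e\<in>{1,-1}. \<Sum>a\<in>UNIV. h (a + e * i) (a + e * j)) = (\<Sum>i\<in>UNIV. \<Sum>j\<in>UNIV. h i j) - (\<Sum>i\<in>UNIV. h i i)"
    unfolding all_3 by (simp add: sum_UNIV_3 numeral_3_simps)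
  then show ?thesis using assms by blast
qed

lemma avg_pair:
  assumes "i \<noteq> j" "even (length u)" "even (length u')"
  shows "avg (\<lambda>k. ((cl k$i)^s * iword u i k) * ((cl k$j)^t * iword u' j k))
    = (\<lambda>k. 4 * (psum s u k * psum t u' k - psum (s + t) (u @ u') k))"
proof
  fix k
  have "avg (\<lambda>k. ((cl k$i)^s * iword u i k) * ((cl k$j)^t * iword u' j k)) k
    = 4 * (\<Sum>e\<in>{1,-1}. \<Sum>a\<in>UNIV. ((cl k$(a+e*i))^s * iword u (a+e*i) k) * ((cl k$(a+e*j))^t * iword u' (a+e*j) k))"
    by (subst avg_flip_invariant) (simp_all add: iword_flip_even iword_relab assms)
  also have "\<dots> = 4 * (psum s u k * psum t u' k - psum (s + t) (u @ u') k)"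
    by (subst sum_affine_pairs[OF assms(1), where h="\<lambda>i j. ((cl k$i)^s * iword u i k) * ((cl k$j)^t * iword u' j k)"])
       (simp add: psum_def sum_product power_add algebra_simps)
  finally show "avg (\<lambda>k. ((cl k$i)^s * iword u i k) * ((cl k$j)^t * iword u' j k)) k
    = 4 * (psum s u k * psum t u' k - psum (s + t) (u @ u') k)" .
qed

lemma good_scale: "good (\<lambda>k. c * f k) \<Longrightarrow> c \<noteq> 0 \<Longrightarrow> good f"
  using good_mult[OF good_const[of "1/c"], of "\<lambda>k. c * f k"] by simp

lemma good_psum_short:
  assumes "words_good n" "length u < n" "even (length u)"
  shows "good (psum s u)"
proof -
  have "avgood (\<lambda>k. (cl k$0)^s * word (map (\<lambda>(b, a). (b, 0, a)) u) k)"
    by (rule words_goodD[OF assms(1)]) (auto simp: assms polyfun_intros lcoord_poly)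
  then have "good (\<lambda>k. 8 * psum s u k)"
    by (simp add: avgood_def avg_single[OF assms(3)] iword_word[symmetric])
  then show ?thesis by (rule good_scale) simp
qed

text \<open>Each eigenvalue is a root of the characteristic cubic. Since the eigenvalues sum to
  zero, Newton's identities give its coefficients as \<open>tr2 / 2\<close> and
  \<open>tr3 / 3\<close>.\<close>

lemma psum_3:
  assumes "k \<in> rels"
  shows "psum (Suc (Suc (Suc s))) [] k = tr2 (cA k) / 2 * psum (Suc s) [] k + tr3 (cA k) / 3 * psum s [] k"
proof -
  let ?l = "\<lambda>i. cl k$i"
  have l0: "?l 0 = - ?l 1 - ?l 2"
    using relsD(1)[OF assms] by (simp add: sum_UNIV_3 eq_neg_iff_add_eq_0 algebra_simps)
  have *: "?l i ^ 3 = tr2 (cA k) / 2 * ?l i + tr3 (cA k) / 3" for i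
  proof -
    have "\<forall>i. ?l i ^ 3 = tr2 (cA k) / 2 * ?l i + tr3 (cA k) / 3"
      unfolding relsD(2,3)[OF assms, symmetric] sum_UNIV_3 all_3 l0
      by (simp add: field_simps power2_eq_square power3_eq_cube)
    then show ?thesis by blast
  qed
  have "?l i ^ (Suc (Suc (Suc s))) = tr2 (cA k) / 2 * ?l i ^ Suc s + tr3 (cA k) / 3 * ?l i ^ s" for i
  proof -
    have "?l i ^ (Suc (Suc (Suc s))) = ?l i ^ s * ?l i ^ 3" by (simp add: power3_eq_cube)
    then show ?thesis by (simp add: * algebra_simps)
  qed
  then show ?thesis by (simp add: psum_def sum.distrib sum_distrib_left)
qed

lemma good_psum_Nil: "good (psum s [])"
proof (induction s rule: less_induct)
  case (less s)
  consider "s = 0" | "s = 1" | "s = 2" | t where "s = Suc (Suc (Suc t))"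
    by (metis One_nat_def Suc_1 not0_implies_Suc)
  then show ?case
  proof cases
    case 1
    then show ?thesis using good_const[of 3] by (simp add: psum_def[abs_def])
  next
    case 2
    then show ?thesis using relsD(1) by (intro good_cong[OF _ good_const[of 0]]) (simp add: psum_def)
  next
    case 3
    then show ?thesis using relsD(2) by (intro good_cong[OF _ good_tr(1)]) (simp add: psum_def)
  next
    case (4 t)
    have "good (psum (Suc t) [])" "good (psum t [])" using less 4 by simp_all
    then have "good (\<lambda>k. tr2 (cA k) / 2 * psum (Suc t) [] k + tr3 (cA k) / 3 * psum t [] k)"
      unfolding divide_inverse by (intro good_add good_mult good_tr good_const)
    then show ?thesis unfolding 4 by (rule good_cong[rotated]) (rule psum_3)
  qed
qed

lemma iword_remove1: "x \<in> set u \<Longrightarrow> iword u i k = iword (x # remove1 x u) i k"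
  by (induction u) (auto simp: iword_def)

text \<open>Induction on the exponent of the eigenvalue. A positive exponent drops by one through
  the eigenvector equation, which keeps the length of the word. At exponent zero a long word is
  split between two different indices.\<close>

lemma good_psum_pure:
  assumes n: "words_good n" "length u \<le> n" and even: "even (length u)" and pure: "\<forall>x\<in>set u. fst x = b"
  shows "good (psum s u)"
  using n(2) even pure
proof (induction s arbitrary: u)
  case 0
  consider "u = []" | a a' where "u = [(b,a),(b,a')]" | a a' d u' where "u = (b,a) # (b,a') # (b,d) # u'"
  proof (cases u)
    case (Cons x v)
    then obtain y v' where v: "v = y # v'" using 0 by (cases v) auto
    have xy: "x = (b, snd x)" "y = (b, snd y)" using 0 Cons v by (auto simp: prod_eq_iff)
    show ?thesis
    proof (cases v')
      case Nil
      show ?thesis by (rule that(2)[of "snd x" "snd y"]) (use Cons v Nil xy in simp)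
    next
      case (Cons z v'')
      have z: "z = (b, snd z)" using 0 \<open>u = x # v\<close> v Cons by (auto simp: prod_eq_iff)
      show ?thesis by (rule that(3)[of "snd x" "snd y" "snd z" v'']) (use \<open>u = x # v\<close> Cons v xy z in simp)
    qed
  qed auto
  then show ?case
  proof cases
    case 1
    then show ?thesis by (simp add: good_psum_Nil)
  next
    case (2 a a')
    then show ?thesis using good_quadratic[of b a a'] by (simp add: psum_def[abs_def])
  next
    case (3 a a' d u')
    let ?u = "(b,d) # u'" let ?p = "[(b,a),(b,a')]"
    have len: "length u' + 3 \<le> n" "even (length ?u)" using 0 3 by auto
    \<comment> \<open>Letters of one kind now sit at the indices 0 and 1, so this average reduces to
      shorter words. By \<open>avg_pair\<close> it is also a product of two good power sums minus
      the desired one, up to a factor.\<close>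
    have "avgood (\<lambda>k. 1 * (letter (b,0,a) k * letter (b,1,d) k * word ((b,0,a') # map (\<lambda>(b, a). (b, 1, a)) u') k))"
      by (rule avgood_same_type[OF n(1)]) (use len in \<open>auto intro: polyfun.const\<close>)
    then have "avgood (\<lambda>k. ((cl k$0)^0 * iword ?p 0 k) * ((cl k$1)^0 * iword ?u 1 k))"
      by (rule avgood_cong[rotated]) (simp add: iword_word letter_def)
    then have "good (\<lambda>k. 4 * (psum 0 ?p k * psum 0 ?u k - psum 0 (?p @ ?u) k))"
      unfolding avgood_def using len by (subst (asm) avg_pair) auto
    then have g1: "good (\<lambda>k. psum 0 ?p k * psum 0 ?u k - psum 0 (?p @ ?u) k)"
      by (rule good_scale) simp
    have g2: "good (\<lambda>k. psum 0 ?p k * psum 0 ?u k)"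
      using good_quadratic[of b a a'] good_psum_short[OF n(1), of ?u] len
      by (intro good_mult) (auto simp: psum_def[of _ ?p, abs_def])
    show ?thesis using good_diff[OF g2 g1] 3 by simp
  qed
next
  case (Suc s)
  show ?case
  proof (cases u)
    case Nil
    then show ?thesis by (simp add: good_psum_Nil)
  next
    case (Cons x u')
    then obtain a where u: "u = (b,a) # u'" using Suc.prems by (cases x) auto
    have IH: "good (psum s ((b,e) # u'))" for e
      by (rule Suc.IH) (use Suc.prems u in auto)
    show ?thesis
    proof (rule good_cong)
      show "good (\<lambda>k. \<Sum>e\<in>UNIV. cAt b k a e * psum s ((b,e) # u') k)"
        by (intro good_sum good_mult good_cAt IH)
      fix k assume k: "k \<in> rels"
      have "psum (Suc s) u k = (\<Sum>i\<in>UNIV. (cl k$i)^s * ((cl k$i * cv b k$i$a) * iword u' i k))"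
        by (simp add: psum_def u algebra_simps)
      also have "\<dots> = (\<Sum>i\<in>UNIV. \<Sum>e\<in>UNIV. cAt b k a e * ((cl k$i)^s * iword ((b,e) # u') i k))"
        by (simp add: relsD(4)[OF k] sum_distrib_left sum_distrib_right algebra_simps)
      also have "\<dots> = (\<Sum>e\<in>UNIV. cAt b k a e * psum s ((b,e) # u') k)"
        by (subst sum.swap) (simp add: psum_def sum_distrib_left)
      finally show "psum (Suc s) u k = (\<Sum>e\<in>UNIV. cAt b k a e * psum s ((b,e) # u') k)" .
    qed
  qed
qed

text \<open>The relation at a single index removes two letters and raises the exponent by at most
  two. This is harmless because the statement for shorter words is uniform in the exponent.\<close>

lemma good_psum_mixed:
  assumes n: "words_good n" "length u + 2 \<le> n" and even: "even (length u)"
  shows "good (psum s ((True,a) # (False,a') # u))"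
proof (rule good_cong)
  let ?d = "if a = a' then 1 else 0 :: complex"
  have g: "good (psum t u)" for t by (rule good_psum_short[OF n(1) _ even]) (use n(2) in simp)
  show "good (\<lambda>k. (\<Sum>e\<in>UNIV. cA k$a$e * cA k$e$a') * psum s u k + cA k$a$a' * psum (Suc s) u k
     + (?d * psum (Suc (Suc s)) u k + (- ?d / 2) * (tr2 (cA k) * psum s u k)))"
    by (intro good_add good_mult good_sum good_A good_const good_tr g)
  fix k assume k: "k \<in> rels"
  have "psum s ((True,a) # (False,a') # u) k = (\<Sum>i\<in>UNIV. (cl k$i)^s * ((cv True k$i$a * cv False k$i$a') * iword u i k))"
    by (simp add: psum_def algebra_simps)
  also have "\<dots> = (\<Sum>e\<in>UNIV. cA k$a$e * cA k$e$a') * psum s u k + cA k$a$a' * psum (Suc s) u k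
     + (?d * psum (Suc (Suc s)) u k + (- ?d / 2) * (tr2 (cA k) * psum s u k))"
    unfolding relsD(5)[OF k] sum_UNIV_3 psum_def by (simp add: algebra_simps power2_eq_square)
  finally show "psum s ((True,a) # (False,a') # u) k = (\<Sum>e\<in>UNIV. cA k$a$e * cA k$e$a') * psum s u k + cA k$a$a' * psum (Suc s) u k
     + (?d * psum (Suc (Suc s)) u k + (- ?d / 2) * (tr2 (cA k) * psum s u k))" .
qed

lemma good_psum:
  assumes n: "words_good n" "length u \<le> n" and even: "even (length u)"
  shows "good (psum s u)"
proof (cases "\<exists>a a'. (True,a) \<in> set u \<and> (False,a') \<in> set u")
  case True
  then obtain a a' where a: "(True,a) \<in> set u" "(False,a') \<in> set u" by blast
  let ?u = "remove1 (False,a') (remove1 (True,a) u)"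
  have in': "(False,a') \<in> set (remove1 (True,a) u)" using a(2) by (simp add: in_set_remove1)
  have l: "length u = length ?u + 2"
  proof -
    have "Suc (length (remove1 x v)) = length v" if "x \<in> set v" for x :: "bool \<times> 3" and v
      using that length_pos_if_in_set[OF that] by (simp add: length_remove1)
    from this[OF a(1)] this[OF in'] show ?thesis by simp
  qed
  have "psum s u = psum s ((True,a) # (False,a') # ?u)"
    unfolding psum_def[abs_def] iword_remove1[OF a(1)] iword_simps(2) iword_remove1[OF in'] ..
  then show ?thesis using good_psum_mixed[OF n(1), of ?u] n(2) even l by simp
next
  case False
  then have "(\<forall>x\<in>set u. fst x = True) \<or> (\<forall>x\<in>set u. fst x = False)"
    by (metis (full_types) prod.collapse)
  then show ?thesis using good_psum_pure[OF n even] by blast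
qed

section \<open>Averages of words in normal form\<close>

lemma lcoords_two:
  assumes "f \<in> polyfun lcoords" "i \<noteq> j"
  shows "\<exists>g\<in>polyfun {\<lambda>k. cl k$i, \<lambda>k. cl k$j}. \<forall>k\<in>rels. f k = g k"
  using assms(1)
proof induction
  case (coord p)
  let ?C = "{\<lambda>k. cl k$i, \<lambda>k. cl k$j}"
  obtain m where p: "p = (\<lambda>k. cl k$m)" using coord by (auto simp: lcoords_def)
  have C: "(\<lambda>k. cl k$i) \<in> polyfun ?C" "(\<lambda>k. cl k$j) \<in> polyfun ?C" by (auto intro: polyfun.coord)
  have "\<forall>i j m. i \<noteq> j \<longrightarrow> m \<noteq> i \<longrightarrow> m \<noteq> j \<longrightarrow> (\<forall>k\<in>rels. cl k$m = - (cl k$i + cl k$j))"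
    unfolding all_3 using relsD(1) by (simp add: sum_UNIV_3 eq_neg_iff_add_eq_0 algebra_simps)
  then consider "m = i" | "m = j" | "\<forall>k\<in>rels. cl k$m = - (cl k$i + cl k$j)" using assms(2) by blast
  then show ?case
  proof cases
    case 3
    then show ?thesis unfolding p by (intro bexI[OF _ polyfun_uminus[OF polyfun.add[OF C]]])
  next
    case 1
    show ?thesis unfolding p 1 by (rule bexI[OF _ C(1)]) simp
  next
    case 2
    show ?thesis unfolding p 2 by (rule bexI[OF _ C(2)]) simp
  qed
qed (blast intro: polyfun_intros | fastforce intro: polyfun_intros)+

lemma avgood_monomials:
  assumes "q \<in> polyfun C" "\<And>ms. set ms \<subseteq> C \<Longrightarrow> avgood (\<lambda>k. (\<Prod>m\<leftarrow>ms. m k) * h k)"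
  shows "avgood (\<lambda>k. q k * h k)"
proof -
  obtain L where L: "\<And>x. q x = (\<Sum>(a, ms)\<leftarrow>L. a * (\<Prod>m\<leftarrow>ms. m x))" "\<forall>(a, ms)\<in>set L. set ms \<subseteq> C"
    by (rule polyfun_monomial_sum[OF assms(1)]) (rule that)
  have "avgood (\<lambda>k. (\<Sum>(a, ms)\<leftarrow>L. a * (\<Prod>m\<leftarrow>ms. m k)) * h k)"
    using L(2)
  proof (induction L)
    case Nil
    then show ?case by (simp add: avgood_zero)
  next
    case (Cons x L)
    obtain a ms where x: "x = (a, ms)" by (cases x)
    have "avgood (\<lambda>k. a * ((\<Prod>m\<leftarrow>ms. m k) * h k) + (\<Sum>(a, ms)\<leftarrow>L. a * (\<Prod>m\<leftarrow>ms. m k)) * h k)"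
      using Cons x by (intro avgood_add avgood_cmult assms(2)) auto
    then show ?case by (simp add: x algebra_simps)
  qed
  then show ?thesis by (simp add: L(1))
qed

lemma avgood_normal_even:
  assumes n: "words_good n" "length u + length u' \<le> n" and ij: "i \<noteq> j"
    and even: "even (length u)" "even (length u')" and f: "f \<in> polyfun lcoords"
  shows "avgood (\<lambda>k. f k * (iword u i k * iword u' j k))"
proof -
  \<comment> \<open>The third eigenvalue is eliminated by the zero sum, so each monomial of the
    coefficient can be shared out between the indices \<open>i\<close> and \<open>j\<close>.\<close>
  obtain g where g: "g \<in> polyfun {\<lambda>k. cl k$i, \<lambda>k. cl k$j}" "\<forall>k\<in>rels. f k = g k"
    using lcoords_two[OF f ij] by blast
  have "avgood (\<lambda>k. g k * (iword u i k * iword u' j k))"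
  proof (rule avgood_monomials[OF g(1)])
    fix ms assume "set ms \<subseteq> {\<lambda>k. cl k$i, \<lambda>k. cl k$j}"
    then have "\<exists>s t. \<forall>k. (\<Prod>m\<leftarrow>ms. m k) = (cl k$i)^s * (cl k$j)^t"
    proof (induction ms)
      case Nil
      show ?case by (rule exI[of _ 0], rule exI[of _ 0]) simp
    next
      case (Cons m ms)
      then obtain s t where st: "\<forall>k. (\<Prod>m\<leftarrow>ms. m k) = (cl k$i)^s * (cl k$j)^t" by auto
      consider "m = (\<lambda>k. cl k$i)" | "m = (\<lambda>k. cl k$j)" using Cons.prems by auto
      then show ?case
      proof cases
        case 1
        show ?thesis by (rule exI[of _ "Suc s"], rule exI[of _ t]) (simp add: 1 st)
      next
        case 2
        show ?thesis by (rule exI[of _ s], rule exI[of _ "Suc t"]) (simp add: 2 st)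
      qed
    qed
    then obtain s t where st: "\<And>k. (\<Prod>m\<leftarrow>ms. m k) = (cl k$i)^s * (cl k$j)^t" by blast
    have "good (\<lambda>k. 4 * (psum s u k * psum t u' k - psum (s + t) (u @ u') k))"
      using n even by (intro good_mult good_diff good_const good_psum[OF n(1)]) auto
    then have "avgood (\<lambda>k. ((cl k$i)^s * iword u i k) * ((cl k$j)^t * iword u' j k))"
      unfolding avgood_def avg_pair[OF ij even] by simp
    then show "avgood (\<lambda>k. (\<Prod>m\<leftarrow>ms. m k) * (iword u i k * iword u' j k))"
      by (simp add: st algebra_simps)
  qed
  then show ?thesis using g(2) by (rule_tac avgood_cong[rotated]) auto
qed

lemma lcoords_invariant:
  assumes "f \<in> polyfun lcoords" shows "f (flip m k) = f k"
  using assms by induction (auto simp: lcoords_def)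

text \<open>Orthogonality of characters of the Klein four-group: the signs at two distinct indices
  generate its character group, so the character is trivial only if both exponents are even. The
  summand 1 belongs to the identity.\<close>

lemma flip_sign_sum:
  assumes "i \<noteq> j" "odd p \<or> odd q"
  shows "1 + (\<Sum>m\<in>UNIV. flip_sign m i ^ p * flip_sign m j ^ q) = 0"
proof -
  have *: "(-1::complex) ^ p = (if even p then 1 else -1)" "(-1::complex) ^ q = (if even q then 1 else -1)" by auto
  have "\<forall>i j. i \<noteq> j \<longrightarrow> 1 + (\<Sum>m\<in>UNIV. flip_sign m i ^ p * flip_sign m j ^ q) = 0"
    unfolding all_3 using assms(2) by (auto simp: sum_UNIV_3 flip_sign_def *)
  then show ?thesis using assms(1) by blast
qed

lemma avgood_normal_odd:
  assumes ij: "i \<noteq> j" and odd: "odd (length u) \<or> odd (length u')" and f: "f \<in> polyfun lcoords"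
  shows "avgood (\<lambda>k. f k * (iword u i k * iword u' j k))"
proof -
  have "avg (\<lambda>k. f k * (iword u i k * iword u' j k)) k = 0" for k
  proof -
    let ?g = "\<lambda>k. f k * (iword u i k * iword u' j k)"
    have "?g k + (\<Sum>m\<in>UNIV. ?g (flip m k)) = (1 + (\<Sum>m\<in>UNIV. flip_sign m i ^ length u * flip_sign m j ^ length u')) * ?g k" for k
      by (simp add: lcoords_invariant[OF f] iword_flip sum_UNIV_3 algebra_simps)
    then show ?thesis unfolding avg_def by (simp add: flip_sign_sum[OF ij odd])
  qed
  then have "avg (\<lambda>k. f k * (iword u i k * iword u' j k)) = (\<lambda>k. 0)" by (rule ext)
  then show ?thesis by (simp add: avgood_def good_const)
qed

lemma avgood_word: "f \<in> polyfun lcoords \<Longrightarrow> avgood (\<lambda>k. f k * word w k)"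
proof (induction "length w" arbitrary: w f rule: less_induct)
  case less
  then have n: "words_good (length w)" unfolding words_good_def by blast
  have split: "\<exists>w'. word w = (\<lambda>k. letter x k * letter y k * word w' k) \<and> length w' + 2 \<le> length w"
    if "x \<in> set w" "y \<in> set w" "x \<noteq> y" for x y
  proof -
    have y: "y \<in> set (remove1 x w)" using that by (simp add: in_set_remove1)
    have "Suc (length (remove1 y (remove1 x w))) = length (remove1 x w)" "Suc (length (remove1 x w)) = length w"
      using y that by (metis One_nat_def Suc_pred length_pos_if_in_set length_remove1)+
    then show ?thesis
      using word_remove1[OF that(1)] word_remove1[OF y] by (intro exI[of _ "remove1 y (remove1 x w)"]) (auto simp: fun_eq_iff)
  qed
  \<comment> \<open>Either one of the two length-reducing relations applies, or all vectors share
    one index and all covectors share another.\<close>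
  consider b i j a a' where "(b,i,a) \<in> set w" "(b,j,a') \<in> set w" "i \<noteq> j"
    | i a a' where "(True,i,a) \<in> set w" "(False,i,a') \<in> set w"
    | "\<And>b i j a a'. (b,i,a) \<in> set w \<Longrightarrow> (b,j,a') \<in> set w \<Longrightarrow> i = j"
      "\<And>i j a a'. (True,i,a) \<in> set w \<Longrightarrow> (False,j,a') \<in> set w \<Longrightarrow> i \<noteq> j" by metis
  then show ?case
  proof cases
    case (1 b i j a a')
    then obtain w' where "word w = (\<lambda>k. letter (b,i,a) k * letter (b,j,a') k * word w' k)" "length w' + 2 \<le> length w"
      using split[of "(b,i,a)" "(b,j,a')"] by auto
    then show ?thesis using avgood_same_type[OF n _ 1(3) less.prems] by simp
  next
    case (2 i a a')
    then obtain w' where "word w = (\<lambda>k. letter (True,i,a) k * letter (False,i,a') k * word w' k)" "length w' + 2 \<le> length w"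
      using split[of "(True,i,a)" "(False,i,a')"] by auto
    then show ?thesis using avgood_same_index[OF n _ less.prems] by simp
  next
    case 3
    have same: "fst (snd x) = i" if "(b,i,a) \<in> set w" "x \<in> set w" "fst x = b" for x b i a
      using 3(1)[of b "fst (snd x)" "snd (snd x)" i a] that by (cases x) simp
    \<comment> \<open>If one kind of letter is absent, its index is free and is chosen different
      from the other.\<close>
    have nn: "\<exists>j::3. i \<noteq> j" for i by (metis zero_neq_one)
    have "\<exists>i j. i \<noteq> j \<and> (\<forall>x\<in>set w. fst x \<longrightarrow> fst (snd x) = i) \<and> (\<forall>x\<in>set w. \<not> fst x \<longrightarrow> fst (snd x) = j)"
    proof (cases "\<exists>x\<in>set w. fst x")
      case True
      then obtain i a where i: "(True,i,a) \<in> set w" by (metis (full_types) prod.collapse)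
      show ?thesis
      proof (cases "\<exists>x\<in>set w. \<not> fst x")
        case True
        then obtain j a' where j: "(False,j,a') \<in> set w" by (metis (full_types) prod.collapse)
        have "i \<noteq> j" using 3(2) i j by blast
        moreover have "\<forall>x\<in>set w. fst x \<longrightarrow> fst (snd x) = i" by (intro ballI impI same[OF i]) simp_all
        moreover have "\<forall>x\<in>set w. \<not> fst x \<longrightarrow> fst (snd x) = j" by (intro ballI impI same[OF j]) simp_all
        ultimately show ?thesis by (intro exI conjI)
      next
        case False
        obtain j where "i \<noteq> j" using nn by blast
        moreover have "\<forall>x\<in>set w. fst x \<longrightarrow> fst (snd x) = i" by (intro ballI impI same[OF i]) simp_all
        moreover have "\<forall>x\<in>set w. \<not> fst x \<longrightarrow> fst (snd x) = j" using False by blast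
        ultimately show ?thesis by (intro exI conjI)
      qed
    next
      case none: False
      show ?thesis
      proof (cases "\<exists>x\<in>set w. \<not> fst x")
        case True
        then obtain j a' where j: "(False,j,a') \<in> set w" by (metis (full_types) prod.collapse)
        obtain i where "i \<noteq> j" using nn[of j] by metis
        moreover have "\<forall>x\<in>set w. fst x \<longrightarrow> fst (snd x) = i" using none by blast
        moreover have "\<forall>x\<in>set w. \<not> fst x \<longrightarrow> fst (snd x) = j" by (intro ballI impI same[OF j]) simp_all
        ultimately show ?thesis by (intro exI conjI)
      next
        case False
        then have "w = []" using none by (cases w) auto
        then show ?thesis by (intro exI[of _ 0] exI[of _ 1]) simp
      qed
    qed
    then obtain i j where ij: "i \<noteq> j" and i: "\<forall>x\<in>set w. fst x \<longrightarrow> fst (snd x) = i"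
      and j: "\<forall>x\<in>set w. \<not> fst x \<longrightarrow> fst (snd x) = j" by blast
    obtain u u' where w: "\<And>k. word w k = iword u i k * iword u' j k" "length u + length u' = length w"
    proof -
      have "\<exists>u u'. (\<forall>k. word w k = iword u i k * iword u' j k) \<and> length u + length u' = length w"
        using i j
      proof (induction w)
        case Nil
        show ?case by (rule exI[of _ "[]"], rule exI[of _ "[]"]) simp
      next
        case (Cons x w)
        then obtain u u' where IH: "\<forall>k. word w k = iword u i k * iword u' j k" "length u + length u' = length w" by auto
        obtain b m a where x: "x = (b,m,a)" by (cases x)
        show ?case
        proof (cases b)
          case True
          then have "m = i" using Cons.prems x by auto
          then show ?thesis using IH x
            by (intro exI[of _ "(b,a) # u"] exI[of _ u']) (auto simp: letter_def algebra_simps)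
        next
          case False
          then have "m = j" using Cons.prems x by auto
          then show ?thesis using IH x
            by (intro exI[of _ u] exI[of _ "(b,a) # u'"]) (auto simp: letter_def algebra_simps)
        qed
      qed
      then show ?thesis using that by blast
    qed
    show ?thesis
      unfolding w(1)
      using avgood_normal_even[OF n _ ij _ _ less.prems, of u u'] avgood_normal_odd[OF ij _ less.prems, of u u'] w(2)
      by (cases "even (length u) \<and> even (length u')") simp_all
  qed
qed

definition coords_coord :: "(coord \<Rightarrow> complex) set" where
  "coords_coord = range (\<lambda>(a, b) k. cA k$a$b) \<union> lcoords \<union> range letter"

text \<open>The factors of a monomial sort into entries of \<open>A\<close>, which form an invariant
  coefficient, eigenvalues, and letters.\<close>

lemma avgood_polyfun:
  assumes "q \<in> polyfun coords_coord"
  shows "avgood q"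
proof -
  have "avgood (\<lambda>k. q k * 1)"
  proof (rule avgood_monomials[OF assms])
    fix ms assume "set ms \<subseteq> coords_coord"
    then have "\<exists>h f w. (\<forall>k k'. cA k = cA k' \<longrightarrow> h k = h k') \<and> good h \<and> f \<in> polyfun lcoords
       \<and> (\<forall>k. (\<Prod>m\<leftarrow>ms. m k) = h k * (f k * word w k))"
    proof (induction ms)
      case Nil
      show ?case
        by (rule exI[of _ "\<lambda>_. 1"], rule exI[of _ "\<lambda>_. 1"], rule exI[of _ "[]"]) (simp add: good_const polyfun.const)
    next
      case (Cons m ms)
      have "set ms \<subseteq> coords_coord" using Cons.prems by simp
      from Cons.IH[OF this] obtain h f w where IH: "\<forall>k k'. cA k = cA k' \<longrightarrow> h k = h k'" "good h" "f \<in> polyfun lcoords"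
        "\<forall>k. (\<Prod>m\<leftarrow>ms. m k) = h k * (f k * word w k)" by (elim exE conjE)
      consider a b where "m = (\<lambda>k. cA k$a$b)" | i where "m = (\<lambda>k. cl k$i)" | x where "m = letter x"
        using Cons.prems by (auto simp: coords_coord_def lcoords_def)
      then show ?case
      proof cases
        case (1 a b)
        show ?thesis
        proof (intro exI conjI)
          show "\<forall>k k'. cA k = cA k' \<longrightarrow> cA k$a$b * h k = cA k'$a$b * h k'" using IH(1) by metis
          show "good (\<lambda>k. cA k$a$b * h k)" by (intro good_mult good_A IH)
          show "\<forall>k. (\<Prod>m\<leftarrow>m # ms. m k) = cA k$a$b * h k * (f k * word w k)" using 1 IH(4) by (simp add: mult.assoc)
        qed (rule IH)
      next
        case (2 i)
        show ?thesis
        proof (intro exI conjI)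
          show "(\<lambda>k. cl k$i * f k) \<in> polyfun lcoords" by (intro polyfun.mult lcoord_poly IH)
          show "\<forall>k. (\<Prod>m\<leftarrow>m # ms. m k) = h k * (cl k$i * f k * word w k)" using 2 IH(4) by (simp add: algebra_simps)
        qed (rule IH)+
      next
        case (3 x)
        show ?thesis
        proof (intro exI conjI)
          show "\<forall>k. (\<Prod>m\<leftarrow>m # ms. m k) = h k * (f k * word (x # w) k)" using 3 IH(4) by (simp add: algebra_simps)
        qed (rule IH)+
      qed
    qed
    then obtain h f w where h: "\<forall>k k'. cA k = cA k' \<longrightarrow> h k = h k'" "good h" "f \<in> polyfun lcoords"
       "\<And>k. (\<Prod>m\<leftarrow>ms. m k) = h k * (f k * word w k)" by blast
    have "avgood (\<lambda>k. h k * (f k * word w k))"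
      by (rule avgood_mult[OF _ h(2) avgood_word[OF h(3)]]) (use h(1) in blast)
    then show "avgood (\<lambda>k. (\<Prod>m\<leftarrow>ms. m k) * 1)" by (simp add: h(4))
  qed
  then show ?thesis by simp
qed

section \<open>The action of the symmetric group\<close>

lemma Em_mult: "Em i j ** Em k l = (if j = k then Em i l else 0)"
proof -
  have "(Em i j ** Em k l)$p$q = (\<Sum>r\<in>UNIV. if r = j then (if p = i \<and> j = k \<and> q = l then 1 else 0) else 0)" for p q
    unfolding matrix_matrix_mult_def Em_def vec_lambda_beta by (intro sum.cong refl) auto
  then have "(Em i j ** Em k l)$p$q = (if p = i \<and> j = k \<and> q = l then 1 else 0)" for p q
    by simp
  then show ?thesis by (auto simp: vec_eq_iff Em_def)
qed

lemma matrix_inv_eqI: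
  fixes A :: "'a::semiring_1^'n^'n"
  assumes "A ** B = mat 1" "B ** A = mat 1"
  shows "matrix_inv A = B"
proof -
  have "A ** matrix_inv A = mat 1 \<and> matrix_inv A ** A = mat 1"
    unfolding matrix_inv_def by (rule someI[of _ B]) (use assms in blast)
  then have "matrix_inv A = matrix_inv A ** (A ** B)" "matrix_inv A ** A = mat 1" using assms by simp_all
  then show ?thesis by (simp add: matrix_mul_assoc)
qed

lemma Fm_simple:
  "e_simple 1 = Fm 0 1" "e_simple 2 = Fm 1 2" "e_simple 3 = Fm 2 3" "e_simple 4 = Fm 2 4"
  "f_simple 1 = Fm 1 0" "f_simple 2 = Fm 2 1" "f_simple 3 = Fm 3 2" "f_simple 4 = Fm 4 2"
  by (auto simp: f_simple_def e_simple_def Fm_def vec_eq_iff Em_def transpose_def)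

lemma matrix_diff_ldistrib: "A ** (B - C) = A ** B - A ** C" for A :: mat8
  by (simp add: matrix_matrix_mult_def vec_eq_iff right_diff_distrib sum_subtractf)

lemma matrix_diff_rdistrib: "(B - C) ** A = B ** A - C ** A" for A :: mat8
  by (simp add: matrix_matrix_mult_def vec_eq_iff left_diff_distrib sum_subtractf)

lemma bracket_Fm:
  assumes "i \<noteq> k" "j \<noteq> 7 - k" "j \<noteq> 7 - i"
  shows "bracket (Fm i j) (Fm j k) = Fm i k"
proof -
  have "7 - k \<noteq> j" "7 - i \<noteq> j" "7 - j \<noteq> i" "7 - j \<noteq> k" "k \<noteq> 7 - j" "i \<noteq> 7 - j" "k \<noteq> i"
    using assms by auto
  then show ?thesis using assms
    by (simp add: bracket_def Fm_def matrix_diff_ldistrib matrix_diff_rdistrib Em_mult)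
qed

lemma bracket_Fm_diag:
  assumes "i \<noteq> j" "j \<noteq> 7 - i"
  shows "bracket (Fm i j) (Fm j i) = Fm i i - Fm j j"
proof -
  have "7 - i \<noteq> j" "7 - j \<noteq> i" "i \<noteq> 7 - j" "j \<noteq> i"
    using assms by auto
  then show ?thesis using assms
    by (simp add: bracket_def Fm_def matrix_diff_ldistrib matrix_diff_rdistrib Em_mult)
qed

lemma Fm_swap: "Fm (7 - j) (7 - i) = - Fm i j"
  by (simp add: Fm_def)

text \<open>The halves compensate that \<open>Fm i j\<close> and \<open>Fm (7 - j) (7 - i)\<close>
  are the same matrix up to sign.\<close>

lemma so8_expand:
  assumes "x \<in> so8"
  shows "x = (\<Sum>i\<in>UNIV. \<Sum>j\<in>UNIV. cmul (x$i$j / 2) (Fm i j))"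
proof -
  have "x$p$q = (\<Sum>i\<in>UNIV. \<Sum>j\<in>UNIV. x$i$j / 2 * Fm i j$p$q)" for p q
  proof -
    have eq: "p = 7 - j \<longleftrightarrow> j = 7 - p" "q = 7 - i \<longleftrightarrow> i = 7 - q" for i j by auto
    have "(\<Sum>i\<in>UNIV. \<Sum>j\<in>UNIV. x$i$j / 2 * Fm i j$p$q)
      = (\<Sum>i\<in>UNIV. \<Sum>j\<in>UNIV. (if i = p then (if j = q then x$i$j / 2 else 0) else 0)
          - (if i = 7 - q then (if j = 7 - p then x$i$j / 2 else 0) else 0))"
      unfolding Fm_nth eq by (intro sum.cong refl) auto
    also have "\<dots> = x$p$q / 2 - x$(7-q)$(7-p) / 2"
    proof -
      have *: "(\<Sum>j\<in>UNIV. if P then f j else 0) = (if P then sum f UNIV else (0::complex))" for P and f :: "8 \<Rightarrow> complex"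
        by simp
      show ?thesis by (simp only: sum_subtractf * sum.delta finite UNIV_I if_True sum.delta')
    qed
    also have "\<dots> = x$p$q" using assms[unfolded so8_iff, rule_format, of p q] by simp
    finally show ?thesis by (rule sym)
  qed
  note * = this
  show ?thesis
    unfolding vec_eq_iff by (intro allI) (unfold sum_component cmul_def vec_lambda_beta, rule *)
qed

text \<open>Brackets of simple root vectors reach every off-diagonal \<open>Fm\<close>, and brackets
  of opposite ones give differences of diagonal ones. This yields the uniqueness behind the
  \<open>THE\<close> in \<open>diagram_aut\<close>.\<close>

lemma so8_induct:
  assumes x: "x \<in> so8"
    and e: "\<And>k. k \<in> {1..4} \<Longrightarrow> P (e_simple k)" and f: "\<And>k. k \<in> {1..4} \<Longrightarrow> P (f_simple k)"
    and add: "\<And>x y. x \<in> so8 \<Longrightarrow> y \<in> so8 \<Longrightarrow> P x \<Longrightarrow> P y \<Longrightarrow> P (x + y)"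
    and scale: "\<And>c x. x \<in> so8 \<Longrightarrow> P x \<Longrightarrow> P (cmul c x)"
    and bracket: "\<And>x y. x \<in> so8 \<Longrightarrow> y \<in> so8 \<Longrightarrow> P x \<Longrightarrow> P y \<Longrightarrow> P (bracket x y)"
  shows "P x"
proof -
  define Q where "Q i j \<longleftrightarrow> P (Fm i j)" for i j
  have base: "Q 0 1" "Q 1 2" "Q 2 3" "Q 2 4" "Q 1 0" "Q 2 1" "Q 3 2" "Q 4 2"
    using e[of 1] e[of 2] e[of 3] e[of 4] f[of 1] f[of 2] f[of 3] f[of 4] by (auto simp: Q_def Fm_simple[simplified] Fm_simple)
  have step: "Q i k" if "Q i j" "Q j k" "i \<noteq> k" "j \<noteq> 7 - k" "j \<noteq> 7 - i" for i j k
    using bracket[OF Fm_so8 Fm_so8] that by (metis Q_def bracket_Fm)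
  have neg: "P (- x)" if "P x" "x \<in> so8" for x
  proof -
    have "- x = cmul (-1) x" by (simp add: cmul_def vec_eq_iff)
    then show ?thesis using scale that by simp
  qed
  have dual: "Q i j \<Longrightarrow> Q (7 - j) (7 - i)" for i j
    using neg[of "Fm i j"] Fm_so8 by (simp add: Q_def Fm_swap)
  have q1: "Q 0 2" "Q 0 3" "Q 0 4" "Q 1 3" "Q 1 4" "Q 2 0" "Q 3 0" "Q 4 0" "Q 3 1" "Q 4 1"
    using step[OF base(1,2)] step[OF step[OF base(1,2)] base(3)] step[OF step[OF base(1,2)] base(4)]
      step[OF base(2,3)] step[OF base(2,4)]
      step[OF base(6,5)] step[OF base(7) step[OF base(6,5)]] step[OF base(8) step[OF base(6,5)]]
      step[OF base(7,6)] step[OF base(8,6)] by simp_all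
  have q2: "Q 3 5" "Q 5 3" "Q 4 5" "Q 5 4" "Q 5 6" "Q 6 5" "Q 6 7" "Q 7 6"
    using dual[OF base(4)] dual[OF base(8)] dual[OF base(3)] dual[OF base(7)] dual[OF base(2)] dual[OF base(6)]
       dual[OF base(1)] dual[OF base(5)] by simp_all
  have q3: "Q 1 5" "Q 5 1" "Q 0 5" "Q 5 0"
    using step[OF q1(4) q2(1)] step[OF q2(2) q1(9)] step[OF q1(2) q2(1)] step[OF q2(2) q1(7)] by simp_all
  have q4: "Q 2 6" "Q 6 2" "Q 2 7" "Q 7 2"
    using dual[OF q3(1)] dual[OF q3(2)] dual[OF q3(3)] dual[OF q3(4)] by simp_all
  have q5: "Q 0 6" "Q 6 0" "Q 1 7" "Q 7 1"
  proof -
    show "Q 0 6" "Q 6 0" using step[OF q1(1) q4(1)] step[OF q4(2) q1(6)] by simp_all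
    then show "Q 1 7" "Q 7 1" using dual[of 0 6] dual[of 6 0] by simp_all
  qed
  have q6: "Q 5 7" "Q 4 7" "Q 3 7" "Q 4 6" "Q 3 6" "Q 7 5" "Q 7 4" "Q 7 3" "Q 6 4" "Q 6 3"
    using q1[THEN dual] by simp_all
  have off: "Q i j" if "i \<noteq> j" "i \<noteq> 7 - j" for i j
  proof -
    have "\<forall>i j. i \<noteq> j \<longrightarrow> i \<noteq> 7 - j \<longrightarrow> Q i j"
      unfolding all_8 by (simp add: base q1 q2 q3 q4 q5 q6)
    then show ?thesis using that by blast
  qed
  have diff: "P (Fm i i - Fm j j)" if "i \<noteq> j" "j \<noteq> 7 - i" for i j
  proof -
    have "Q i j" "Q j i" using that by (auto intro!: off)
    then show ?thesis using bracket[OF Fm_so8 Fm_so8] bracket_Fm_diag[OF that] unfolding Q_def by metis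
  qed
  have so8_diff: "Fm i i - Fm j j \<in> so8" for i j
    using so8_add[OF Fm_so8 Fm_so8, of i i "7 - j" "7 - j"] by (simp add: Fm_swap)
  have d: "P (Fm i i)" for i
  proof -
    have F44: "Fm 4 4 = - Fm 3 3" using Fm_swap[of 3 3] by simp
    \<comment> \<open>Since \<open>Fm 4 4 = - Fm 3 3\<close>, the two differences add up to twice
      \<open>Fm 2 2\<close>; this produces a first diagonal element from differences alone.\<close>
    have "P ((Fm 2 2 - Fm 3 3) + (Fm 2 2 - Fm 4 4))"
      by (intro add so8_diff diff) simp_all
    then have "P (cmul (1/2) ((Fm 2 2 - Fm 3 3) + (Fm 2 2 - Fm 4 4)))"
      by (intro scale so8_add so8_diff)
    also have "cmul (1/2) ((Fm 2 2 - Fm 3 3) + (Fm 2 2 - Fm 4 4)) = Fm 2 2"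
      by (simp add: F44 cmul_def vec_eq_iff)
    finally have 2: "P (Fm 2 2)" .
    have 3: "P (Fm i i)" if "i \<noteq> 2" "i \<noteq> 5" for i
    proof -
      have "P ((Fm i i - Fm 2 2) + Fm 2 2)" by (intro add so8_diff diff 2 Fm_so8) (use that in auto)
      then show ?thesis by simp
    qed
    have "Fm 5 5 = - Fm 2 2" using Fm_swap[of 2 2] by simp
    then have "P (Fm 5 5)" using neg[OF 2] Fm_so8 by simp
    then show ?thesis using 2 3 by metis
  qed
  have "P 0"
  proof -
    have "cmul 0 (Fm 0 0) = 0" by (simp add: cmul_def vec_eq_iff)
    then show ?thesis using scale[OF Fm_so8 d, of 0 0] by simp
  qed
  moreover have "P (Fm i (7 - i))" for i
    using \<open>P 0\<close> by (simp add: Fm_def)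
  ultimately have all: "P (Fm i j)" for i j
    using d off[of i j] unfolding Q_def by (metis diff_diff_eq2 add_diff_cancel_left')
  have sum: "P (sum g I) \<and> sum g I \<in> so8" if "\<And>i. i \<in> I \<Longrightarrow> P (g i) \<and> g i \<in> so8" for g and I :: "8 set"
    using finite[of I] that by (induction I rule: finite_induct) (auto simp: \<open>P 0\<close> so8_zero add so8_add)
  show ?thesis
    by (subst so8_expand[OF x]) (intro sum[THEN conjunct1] sum conjI scale so8_cmul all Fm_so8)
qed

text \<open>Two candidates agree on generators of \<open>so8\<close>, and outside \<open>so8\<close>
  both are 0 by the convention in \<open>is_so8_aut\<close>.\<close>

lemma diagram_aut_eqI:
  assumes aut: "is_so8_aut \<phi>"
    and gens: "\<And>k. k \<in> {1..4} \<Longrightarrow> \<phi> (e_simple k) = e_simple (\<pi> k) \<and> \<phi> (f_simple k) = f_simple (\<pi> k)"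
  shows "diagram_aut \<pi> = \<phi>"
  unfolding diagram_aut_def
proof (rule the_equality)
  show "is_so8_aut \<phi> \<and> (\<forall>k\<in>{1..4}. \<phi> (e_simple k) = e_simple (\<pi> k) \<and> \<phi> (f_simple k) = f_simple (\<pi> k))"
    using assms by blast
next
  fix \<phi>' assume \<phi>': "is_so8_aut \<phi>' \<and> (\<forall>k\<in>{1..4}. \<phi>' (e_simple k) = e_simple (\<pi> k) \<and> \<phi>' (f_simple k) = f_simple (\<pi> k))"
  show "\<phi>' = \<phi>"
  proof
    fix x
    show "\<phi>' x = \<phi> x"
    proof (cases "x \<in> so8")
      case True
      then show ?thesis
        by (rule so8_induct[where P="\<lambda>x. \<phi>' x = \<phi> x"]) (use \<phi>' assms in \<open>simp_all add: is_so8_aut_def\<close>)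
    next
      case False
      then show ?thesis using \<phi>' aut by (simp add: is_so8_aut_def)
    qed
  qed
qed

lemma so8_bracket:
  assumes "x \<in> so8" "y \<in> so8"
  shows "bracket x y \<in> so8"
  unfolding so8_iff
proof (intro allI)
  fix i j
  have bij: "bij (\<lambda>k::8. 7 - k)" by (rule o_bij[of "\<lambda>k. 7 - k"]) (auto simp: fun_eq_iff)
  have neg: "x$p$q = - x$(7-q)$(7-p)" "y$p$q = - y$(7-q)$(7-p)" for p q using assms so8_iff by blast+
  have "bracket x y$(7-j)$(7-i) = (\<Sum>k\<in>UNIV. x$(7-j)$(7-k) * y$(7-k)$(7-i) - y$(7-j)$(7-k) * x$(7-k)$(7-i))"
    unfolding bracket_nth by (rule sum.reindex_bij_betw[OF bij, symmetric])
  also have "\<dots> = - bracket x y$i$j"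
    unfolding bracket_nth neg[of i] neg[of _ j] by (simp add: sum_negf[symmetric] algebra_simps)
  finally show "bracket x y$i$j = - bracket x y$(7-j)$(7-i)" by simp
qed

lemma coord_eqI: "cA k = cA k' \<Longrightarrow> cl k = cl k' \<Longrightarrow> (\<And>b. cv b k = cv b k') \<Longrightarrow> k = k'"
  unfolding cA_def cl_def cv_def prod_eq_iff by (metis (full_types))

lemma relab_relab: "relab a e (relab a' e' k) = relab (a' + e' * a) (e' * e) k"
  by (rule coord_eqI) (simp_all add: vec_eq_iff algebra_simps)

lemma relab_id: "relab 0 1 k = k"
  by (rule coord_eqI) (simp_all add: vec_eq_iff)

lemma relab_in_space:
  assumes "e = 1 \<or> e = -1" "k \<in> coord_space" shows "relab a e k \<in> coord_space"
  using assms(2) unit_sum[OF assms(1), where f="\<lambda>i. cl k$i"]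
  by (auto simp: coord_space_def relab_def cA_def cl_def)

lemma coords_of_inject: "x \<in> so8 \<Longrightarrow> y \<in> so8 \<Longrightarrow> coords_of x = coords_of y \<Longrightarrow> x = y"
  by (metis mat_of_coords_of)

lemma coords_of_add: "coords_of (x + y) = coords_of x + coords_of y"
  by (simp add: coords_of_def vtrace_def vec_eq_iff field_simps)

lemma coords_of_cmul:
  "cA (coords_of (cmul c x)) = (\<chi> a b. c * cA (coords_of x)$a$b)"
  "cl (coords_of (cmul c x)) = (\<chi> i. c * cl (coords_of x)$i)"
  "cv t (coords_of (cmul c x)) = (\<chi> i a. c * cv t (coords_of x)$i$a)"
  by (simp_all add: coords_of_def vtrace_def cA_def cl_def cv_def cmul_def vec_eq_iff field_simps)

lemma coord_add: "cA (k + k') = cA k + cA k'" "cl (k + k') = cl k + cl k'" "cv b (k + k') = cv b k + cv b k'"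
  by (simp_all add: cA_def cl_def cv_def)

lemma relab_bracket:
  "coord_bracket (relab a (-1) k) (relab a (-1) k') = relab a (-1) (coord_bracket k k')"
proof -
  obtain A l v c where k: "k = (A, l, v, c)" by (cases k)
  obtain A' l' v' c' where k': "k' = (A', l', v', c')" by (cases k')
  have "\<forall>a. coord_bracket (relab a (-1) k) (relab a (-1) k') = relab a (-1) (coord_bracket k k')"
    unfolding all_3 k k' coord_bracket_def relab_def cA_def cl_def cv_def
    by (simp add: Let_def vec_eq_iff all_3 sum_UNIV_3 numeral_3_simps algebra_simps)
  then show ?thesis by blast
qed

text \<open>The candidate for a diagram automorphism, exchanging two copies of \<open>V\<close> and
  its dual by \<open>i \<mapsto> a - i\<close>: \<open>a = 1\<close> swaps the indices of
  \<open>alpha_1\<close> and \<open>alpha_3\<close>, \<open>a = 0\<close> those of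
  \<open>alpha_3\<close> and \<open>alpha_4\<close>.\<close>

definition relab_aut :: "3 \<Rightarrow> mat8 \<Rightarrow> mat8" where
  "relab_aut a x = (if x \<in> so8 then mat_of (relab a (-1) (coords_of x)) else 0)"

lemma relab_aut_so8: "relab_aut a x \<in> so8"
  by (simp add: relab_aut_def mat_of_so8 so8_zero)

lemma coords_of_relab_aut: "x \<in> so8 \<Longrightarrow> coords_of (relab_aut a x) = relab a (-1) (coords_of x)"
  by (simp add: relab_aut_def coords_of_mat_of relab_in_space coords_of_in_space)

lemma relab_aut_eqI: "x \<in> so8 \<Longrightarrow> y \<in> so8 \<Longrightarrow> coords_of y = relab a (-1) (coords_of x) \<Longrightarrow> relab_aut a x = y"
  by (intro coords_of_inject) (simp_all add: relab_aut_so8 coords_of_relab_aut)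

lemma relab_aut_involution: "x \<in> so8 \<Longrightarrow> relab_aut a (relab_aut a x) = x"
  by (intro relab_aut_eqI) (simp_all add: relab_aut_so8 coords_of_relab_aut relab_relab relab_id)

lemma is_so8_aut_relab: "is_so8_aut (relab_aut a)"
  unfolding is_so8_aut_def
proof (intro conjI ballI allI impI)
  show "bij_betw (relab_aut a) so8 so8"
    by (rule bij_betw_byWitness[where f'="relab_aut a"]) (auto simp: relab_aut_involution relab_aut_so8)
next
  fix x y assume x: "x \<in> so8" and y: "y \<in> so8"
  show "relab_aut a (x + y) = relab_aut a x + relab_aut a y"
    by (intro relab_aut_eqI so8_add x y relab_aut_so8)
      (auto simp: coords_of_add coords_of_relab_aut x y coord_add vec_eq_iff intro!: coord_eqI)
  show "relab_aut a (bracket x y) = bracket (relab_aut a x) (relab_aut a y)"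
    by (intro relab_aut_eqI so8_bracket x y relab_aut_so8)
      (simp add: coords_of_bracket relab_aut_so8 x y coords_of_relab_aut relab_bracket)
next
  fix c x assume x: "x \<in> so8"
  show "relab_aut a (cmul c x) = cmul c (relab_aut a x)"
    by (intro relab_aut_eqI so8_cmul x relab_aut_so8)
      (auto simp: coords_of_cmul coords_of_relab_aut x vec_eq_iff intro!: coord_eqI)
next
  fix x assume "x \<notin> so8"
  then show "relab_aut a x = 0" by (simp add: relab_aut_def)
qed

lemma relab_aut_Fm:
  "coords_of (Fm p q) = relab a (-1) (coords_of (Fm i j)) \<Longrightarrow> relab_aut a (Fm i j) = Fm p q"
  by (intro relab_aut_eqI Fm_so8)

lemma atLeastAtMost_1_4: "k \<in> {1..4::nat} \<longleftrightarrow> k = 1 \<or> k = 2 \<or> k = 3 \<or> k = 4"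
  by auto

definition unit3 :: "3 \<Rightarrow> 3 \<Rightarrow> mat3" where
  "unit3 i a = (\<chi> p q. if p = i \<and> q = a then 1 else 0)"

lemma coords_of_Fm:
  "coords_of (Fm 0 1) = (0, 0, - unit3 0 2, 0)" "coords_of (Fm 1 2) = (unit3 1 2, 0, 0, 0)"
  "coords_of (Fm 2 3) = (0, 0, - unit3 1 2, 0)" "coords_of (Fm 2 4) = (0, 0, - unit3 2 2, 0)"
  "coords_of (Fm 1 0) = (0, 0, 0, unit3 0 2)" "coords_of (Fm 2 1) = (unit3 2 1, 0, 0, 0)"
  "coords_of (Fm 3 2) = (0, 0, 0, unit3 1 2)" "coords_of (Fm 4 2) = (0, 0, 0, unit3 2 2)"
  unfolding coords_of_def vtrace_def Fm_nth
  by (simp_all add: unit3_def vec_eq_iff all_3 vpos_simps)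

lemma relab_unit3:
  "relab a (-1) (0, 0, - unit3 i d, 0) = (0, 0, - unit3 (a - i) d, 0)"
  "relab a (-1) (0, 0, 0, unit3 i d) = (0, 0, 0, unit3 (a - i) d)"
  "relab a (-1) (A, 0, 0, 0) = (A, 0, 0, 0)"
proof -
  have "a - p = i \<longleftrightarrow> p = a - i" for p by auto
  then show "relab a (-1) (0, 0, - unit3 i d, 0) = (0, 0, - unit3 (a - i) d, 0)"
    "relab a (-1) (0, 0, 0, unit3 i d) = (0, 0, 0, unit3 (a - i) d)"
    "relab a (-1) (A, 0, 0, 0) = (A, 0, 0, 0)"
    by (simp_all add: relab_def cA_def cl_def cv_def unit3_def vec_eq_iff)
qed

lemma relab_aut_simple:
  "relab_aut 1 (Fm 0 1) = Fm 2 3" "relab_aut 1 (Fm 1 2) = Fm 1 2" "relab_aut 1 (Fm 2 3) = Fm 0 1" "relab_aut 1 (Fm 2 4) = Fm 2 4"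
  "relab_aut 1 (Fm 1 0) = Fm 3 2" "relab_aut 1 (Fm 2 1) = Fm 2 1" "relab_aut 1 (Fm 3 2) = Fm 1 0" "relab_aut 1 (Fm 4 2) = Fm 4 2"
  "relab_aut 0 (Fm 0 1) = Fm 0 1" "relab_aut 0 (Fm 1 2) = Fm 1 2" "relab_aut 0 (Fm 2 3) = Fm 2 4" "relab_aut 0 (Fm 2 4) = Fm 2 3"
  "relab_aut 0 (Fm 1 0) = Fm 1 0" "relab_aut 0 (Fm 2 1) = Fm 2 1" "relab_aut 0 (Fm 3 2) = Fm 4 2" "relab_aut 0 (Fm 4 2) = Fm 3 2"
  by (rule relab_aut_Fm, unfold coords_of_Fm relab_unit3, simp add: numeral_3_simps)+

lemma gamma13_eq: "gamma13 = relab_aut 1"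
  unfolding gamma13_def
  by (rule diagram_aut_eqI[OF is_so8_aut_relab])
    (auto simp only: atLeastAtMost_1_4, simp_all add: Fm_simple[simplified] Fm_simple relab_aut_simple)

lemma gamma34_eq: "gamma34 = relab_aut 0"
  unfolding gamma34_def
  by (rule diagram_aut_eqI[OF is_so8_aut_relab])
    (auto simp only: atLeastAtMost_1_4, simp_all add: Fm_simple[simplified] Fm_simple relab_aut_simple)

text \<open>\<open>torus_T\<close> squares to -1, so its inverse is its negative and conjugation
  only changes signs of entries.\<close>

lemma Ad_torus_T: "Ad torus_T x$i$j = - (torus_T$i$i * torus_T$j$j) * x$i$j"
proof -
  have T: "i \<noteq> j \<Longrightarrow> torus_T$i$j = 0" for i j by (simp add: torus_T_def)
  have 1: "(torus_T ** y)$i$k = torus_T$i$i * y$i$k" for y i k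
  proof -
    have "(torus_T ** y)$i$k = (\<Sum>r\<in>UNIV. if r = i then torus_T$i$i * y$i$k else 0)"
      unfolding matrix_matrix_mult_def vec_lambda_beta by (intro sum.cong refl) (simp add: T)
    then show ?thesis by simp
  qed
  have "torus_T ** (- torus_T) = mat 1"
    unfolding vec_eq_iff 1 by (simp add: torus_T_def mat_def)
  moreover from this have "(- torus_T) ** torus_T = mat 1" by (rule matrix_left_right_inverse[THEN iffD1])
  ultimately have inv: "matrix_inv torus_T = - torus_T" by (rule matrix_inv_eqI)
  have "Ad torus_T x$i$j = (\<Sum>k\<in>UNIV. if k = j then - ((torus_T ** x)$i$j * torus_T$j$j) else 0)"
    unfolding Ad_def inv matrix_matrix_mult_def[of "torus_T ** x"] vec_lambda_beta
    by (intro sum.cong refl) (simp add: T)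
  then show ?thesis by (simp add: 1)
qed

lemma Ad_torus_so8: "x \<in> so8 \<Longrightarrow> Ad torus_T x \<in> so8"
proof -
  assume "x \<in> so8"
  then have *: "x$i$j = - x$(7-j)$(7-i)" for i j using so8_iff by blast
  have "\<forall>i::8. torus_T$(7-i)$(7-i) = - torus_T$i$i"
    unfolding all_8 by (simp add: torus_T_def)
  then have T: "torus_T$(7-i)$(7-i) = - torus_T$i$i" for i by blast
  show ?thesis unfolding so8_iff
  proof (intro allI)
    fix i j
    show "Ad torus_T x$i$j = - Ad torus_T x$(7-j)$(7-i)"
      unfolding Ad_torus_T T using *[of i j] by simp
  qed
qed

lemma coords_of_Ad_torus: "coords_of (Ad torus_T x) = flip 2 (coords_of x)"
proof -
  have T: "torus_T$i$i = (if i \<in> {0,3,5,6} then \<i> else - \<i>)" for i by (simp add: torus_T_def)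
  show ?thesis
    unfolding coords_of_def flip_def cA_def cl_def cv_def vtrace_def Ad_torus_T T
    by (simp add: flip_sign_def vec_eq_iff all_3 vpos_simps)
qed

lemma coords_of_sigma:
  assumes "x \<in> so8"
  shows "coords_of (sigma12 x) = relab 1 (-1) (coords_of x)" "sigma12 x \<in> so8"
    "coords_of (sigma23 x) = relab 0 (-1) (coords_of x)" "sigma23 x \<in> so8"
    "coords_of (sigma34 x) = relab 1 (-1) (flip 2 (coords_of x))" "sigma34 x \<in> so8"
  using assms
  by (simp_all add: sigma12_def sigma23_def sigma34_def gamma13_eq gamma34_eq coords_of_relab_aut relab_aut_so8
      Ad_torus_so8 coords_of_Ad_torus)

text \<open>Links the generated set \<open>S4_action\<close> to maps of coordinates: an invariant
  function keeps its value along every realized map, which is what averaging uses.\<close>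

definition realized :: "(coord \<Rightarrow> coord) \<Rightarrow> bool" where
  "realized \<rho> \<longleftrightarrow> (\<exists>\<phi>\<in>S4_action. \<forall>x\<in>so8. \<phi> x \<in> so8 \<and> coords_of (\<phi> x) = \<rho> (coords_of x))"

lemma realized_id: "realized (\<lambda>k. k)"
  unfolding realized_def by (rule bexI[OF _ S4_action.ident]) simp

lemma realized_gen:
  assumes "realized \<rho>" "\<sigma> \<in> {sigma12, sigma23, sigma34}"
    "\<And>x. x \<in> so8 \<Longrightarrow> \<sigma> x \<in> so8 \<and> coords_of (\<sigma> x) = \<tau> (coords_of x)"
  shows "realized (\<lambda>k. \<tau> (\<rho> k))"
proof -
  obtain \<phi> where "\<phi> \<in> S4_action" "\<forall>x\<in>so8. \<phi> x \<in> so8 \<and> coords_of (\<phi> x) = \<rho> (coords_of x)"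
    using assms(1) realized_def by blast
  then show ?thesis
    unfolding realized_def using assms(3) by (intro bexI[OF _ S4_action.gen[OF _ assms(2)]]) auto
qed

lemma realized_step:
  assumes "realized \<rho>"
  shows "realized (\<lambda>k. relab 1 (-1) (\<rho> k))" "realized (\<lambda>k. relab 0 (-1) (\<rho> k))"
    "realized (\<lambda>k. relab 1 (-1) (flip 2 (\<rho> k)))"
  by (rule realized_gen[OF assms, of sigma12] realized_gen[OF assms, of sigma23]
      realized_gen[OF assms, of sigma34 "\<lambda>k. relab 1 (-1) (flip 2 k)"]; simp add: coords_of_sigma)+

lemma relab_flip: "relab a (-1) (flip m (relab a (-1) k)) = flip (a - m) k"
proof -
  have "a - i = m \<longleftrightarrow> i = a - m" for i by auto
  then show ?thesis by (intro coord_eqI) (simp_all add: vec_eq_iff flip_sign_def)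
qed

text \<open>\<open>sigma12\<close> after \<open>sigma34\<close> is \<open>flip 2\<close>;
  conjugation by transpositions moves the distinguished index to 1 and then to 0.\<close>

lemma realized_flip: "realized \<rho> \<Longrightarrow> realized (\<lambda>k. flip m (\<rho> k))"
proof -
  have 2: "realized (\<lambda>k. flip 2 (\<rho> k))" if "realized \<rho>" for \<rho>
    using realized_step(1)[OF realized_step(3)[OF that]] by (simp add: relab_relab relab_id)
  have 1: "realized (\<lambda>k. flip 1 (\<rho> k))" if "realized \<rho>" for \<rho>
    using realized_step(2)[OF 2[OF realized_step(2)[OF that]], unfolded relab_flip] by (simp add: numeral_3_simps)
  have 0: "realized (\<lambda>k. flip 0 (\<rho> k))" if "realized \<rho>" for \<rho>
    using realized_step(1)[OF 1[OF realized_step(1)[OF that]], unfolded relab_flip] by simp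
  have "\<forall>m. \<forall>\<rho>. realized \<rho> \<longrightarrow> realized (\<lambda>k. flip m (\<rho> k))"
    unfolding all_3 using 0 1 2 by blast
  then show "realized \<rho> \<Longrightarrow> realized (\<lambda>k. flip m (\<rho> k))" by blast
qed

lemma realized_relab: "e = 1 \<or> e = -1 \<Longrightarrow> realized (relab a e)"
proof -
  have r: "realized (relab 1 (-1))" "realized (relab 0 (-1))"
    using realized_step[OF realized_id] by simp_all
  have r01: "realized (relab 1 1)" "realized (relab 2 1)" 
    using realized_step(2)[OF r(1)] realized_step(1)[OF r(2)] by (simp_all add: relab_relab numeral_3_simps)
  have r2: "realized (relab 2 (-1))"
    using realized_step(1)[OF r01(1)] by (simp add: relab_relab numeral_3_simps)
  have r0: "realized (relab 0 1)" using realized_id by (simp add: relab_id[abs_def])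
  have "\<forall>a. realized (relab a 1) \<and> realized (relab a (-1))"
    unfolding all_3 using r r01 r2 r0 by blast
  then show "e = 1 \<or> e = -1 \<Longrightarrow> realized (relab a e)" by blast
qed

lemma tgt_of_relab: "e = 1 \<or> e = -1 \<Longrightarrow> tgt_of (relab a e k) = tgt_of k"
  by (simp add: tgt_of_def unit_sum[where f="\<lambda>i. cv _ k$i$_ * cv _ k$i$_"])

lemma tgt_of_flip: "tgt_of (flip m k) = tgt_of k"
  unfolding tgt_of_def coord_proj_simps vec_lambda_beta flip_sign_cancel ..

lemma S4_action_tgt:
  assumes "\<sigma> \<in> S4_action" "x \<in> so8"
  shows "\<sigma> x \<in> so8 \<and> tgt_of (coords_of (\<sigma> x)) = tgt_of (coords_of x)"
  using assms
proof (induction arbitrary: x)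
  case (gen \<phi> \<sigma>)
  then have "\<phi> x \<in> so8" "tgt_of (coords_of (\<phi> x)) = tgt_of (coords_of x)" by auto
  then show ?case using gen.hyps(2) by (auto simp: coords_of_sigma tgt_of_relab tgt_of_flip)
qed simp

section \<open>The minimal orbit\<close>

definition bil :: "complex^8 \<Rightarrow> complex^8 \<Rightarrow> complex" where
  "bil x y = (\<Sum>i\<in>UNIV. x$i * y$(7 - i))"

definition wedge :: "complex^8 \<Rightarrow> complex^8 \<Rightarrow> mat8" where
  "wedge u w = (\<chi> i j. u$i * w$(7 - j) - w$i * u$(7 - j))"

definition O8 :: "mat8 set" where
  "O8 = {h. transpose h ** J8 ** h = J8}"

lemma sum_reverse_8: "(\<Sum>k\<in>UNIV. f (7 - k :: 8)) = (\<Sum>k\<in>UNIV. f k)"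
  by (rule sum.reindex_bij_betw) (rule o_bij[of "\<lambda>k. 7 - k"], auto simp: fun_eq_iff)

lemma sum_eq_7: "i + j = 7 \<longleftrightarrow> j = 7 - i" for i j :: 8
  by (auto simp: algebra_simps)

lemma J8_mult_left: "(J8 ** x)$i$j = x$(7 - i)$j"
proof -
  have "(J8 ** x)$i$j = (\<Sum>k\<in>UNIV. if k = 7 - i then x$(7 - i)$j else 0)"
    unfolding matrix_matrix_mult_def J8_def vec_lambda_beta sum_eq_7 by (intro sum.cong refl) simp
  then show ?thesis by simp
qed

lemma J8_mult_right: "(x ** J8)$i$j = x$i$(7 - j)"
proof -
  have "(x ** J8)$i$j = (\<Sum>k\<in>UNIV. if k = 7 - j then x$i$(7 - j) else 0)"
    unfolding matrix_matrix_mult_def J8_def vec_lambda_beta add.commute[of _ j] sum_eq_7 by (intro sum.cong refl) simp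
  then show ?thesis by simp
qed

lemma J8_square: "J8 ** J8 = mat 1"
  unfolding vec_eq_iff J8_mult_left by (auto simp: J8_def mat_def)

text \<open>Allows orthogonal matrices to be built from eight vectors with prescribed
  pairings.\<close>

lemma O8_iff: "h \<in> O8 \<longleftrightarrow> (\<forall>i j. bil (column i h) (column j h) = (if i + j = 7 then 1 else 0))"
proof -
  have "(transpose h ** J8 ** h)$i$j = bil (column i h) (column j h)" for i j
    unfolding matrix_matrix_mult_def[of "transpose h ** J8"] vec_lambda_beta J8_mult_right
    by (subst sum_reverse_8[symmetric]) (simp add: bil_def transpose_def column_def)
  then show ?thesis by (simp add: O8_def vec_eq_iff J8_def)
qed

lemma O8_inverse:
  assumes "h \<in> O8"
  shows "matrix_inv h = J8 ** transpose h ** J8" "matrix_inv h ** h = mat 1"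
proof -
  have "J8 ** transpose h ** J8 ** h = J8 ** (transpose h ** J8 ** h)" by (simp add: matrix_mul_assoc)
  also have "\<dots> = mat 1" using assms by (simp add: O8_def J8_square)
  finally have 1: "J8 ** transpose h ** J8 ** h = mat 1" .
  show inv: "matrix_inv h = J8 ** transpose h ** J8"
    by (rule matrix_inv_eqI[OF matrix_left_right_inverse[THEN iffD1, OF 1] 1])
  show "matrix_inv h ** h = mat 1" unfolding inv by (rule 1)
qed

lemma O8_mult:
  assumes "g \<in> O8" "h \<in> O8"
  shows "g ** h \<in> O8"
proof -
  have "transpose (g ** h) ** J8 ** (g ** h) = transpose h ** (transpose g ** J8 ** g) ** h"
    by (simp add: matrix_transpose_mul matrix_mul_assoc)
  then show ?thesis using assms by (simp add: O8_def)
qed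

text \<open>Equivariance of the identification of the exterior square with \<open>so8\<close>. It
  turns the orbit into the set of wedges of the first two columns of orthogonal matrices.\<close>

lemma wedge_conj:
  assumes "h \<in> O8"
  shows "h ** wedge u w ** matrix_inv h = wedge (h *v u) (h *v w)"
proof -
  have inv: "matrix_inv h$k$j = h$(7 - j)$(7 - k)" for k j
    unfolding O8_inverse(1)[OF assms] J8_mult_right by (simp add: J8_mult_left transpose_def)
  have l: "(h ** wedge u w)$i$k = (h *v u)$i * w$(7 - k) - (h *v w)$i * u$(7 - k)" for i k
    unfolding matrix_matrix_mult_def matrix_vector_mult_def wedge_def vec_lambda_beta
      sum_distrib_right sum_subtractf[symmetric]
    by (intro sum.cong refl) (simp add: algebra_simps)
  have r: "(\<Sum>k\<in>UNIV. x$(7 - k) * h$j$(7 - k)) = (h *v x)$j" for x j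
    unfolding sum_reverse_8[of "\<lambda>k. x$k * h$j$k"] matrix_vector_mult_def by (simp add: mult.commute)
  show ?thesis unfolding vec_eq_iff
  proof (intro allI)
    fix i j
    have "(h ** wedge u w ** matrix_inv h)$i$j
      = (\<Sum>k\<in>UNIV. (h *v u)$i * (w$(7 - k) * h$(7 - j)$(7 - k)) - (h *v w)$i * (u$(7 - k) * h$(7 - j)$(7 - k)))"
      unfolding matrix_matrix_mult_def[of "h ** wedge u w"] vec_lambda_beta inv l by (simp add: algebra_simps)
    also have "\<dots> = wedge (h *v u) (h *v w)$i$j"
      by (simp only: sum_subtractf sum_distrib_left[symmetric] r wedge_def vec_lambda_beta)
    finally show "(h ** wedge u w ** matrix_inv h)$i$j = wedge (h *v u) (h *v w)$i$j" .
  qed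
qed

lemma e_theta_wedge: "e_theta = wedge (axis 0 1) (axis 1 1)"
proof -
  have "7 - j = 0 \<longleftrightarrow> j = 7" "7 - j = 1 \<longleftrightarrow> j = 6" for j :: 8 by (auto simp: algebra_simps)
  then show ?thesis by (auto simp: e_theta_def wedge_def Em_def axis_def vec_eq_iff)
qed

lemma mult_axis: "h *v axis k 1 = column k h" for h :: mat8
  by (simp add: matrix_vector_mult_def axis_def column_def if_distrib cong: if_cong)

lemma column_mult: "column k (h ** g) = h *v column k g" for h :: mat8
  by (simp add: matrix_vector_mult_def matrix_matrix_mult_def column_def vec_eq_iff)

lemma orbit_wedge: "h \<in> O8 \<Longrightarrow> h ** e_theta ** matrix_inv h = wedge (column 0 h) (column 1 h)"
  by (simp add: e_theta_wedge wedge_conj mult_axis)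

lemma SO8_O8: "SO8 \<subseteq> O8"
  by (auto simp: SO8_def O8_def)

lemma det_O8:
  assumes "h \<in> O8" shows "det h = 1 \<or> det h = -1"
proof -
  have "det J8 * det J8 = 1" using det_mul[of J8 J8] by (simp add: J8_square)
  moreover have "det h * det J8 * det h = det J8"
  proof -
    have "det (transpose h ** J8 ** h) = det J8" using assms by (simp add: O8_def)
    then show ?thesis by (simp only: det_mul det_transpose)
  qed
  ultimately have "(det h)\<^sup>2 = 1" by algebra
  then show ?thesis by (simp add: power2_eq_1_iff)
qed

text \<open>The reflection exchanging the two middle basis vectors fixes the highest root vector and
  has determinant \<open>-1\<close>, so the full orthogonal group has the same orbit.\<close>
lemma wedge_columns_O_min:
  assumes h: "h \<in> O8"
  shows "wedge (column 0 h) (column 1 h) \<in> O_min"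
proof (cases "det h = 1")
  case True
  then have "h \<in> SO8" using h by (simp add: SO8_def O8_def)
  then show ?thesis unfolding O_min_def orbit_wedge[OF h, symmetric] by blast
next
  case False
  define p :: "8 \<Rightarrow> 8" where "p = Transposition.transpose 3 4"
  define r :: mat8 where "r = (\<chi> i. mat 1$p i)"
  have p: "p i = (if i = 3 then 4 else if i = 4 then 3 else i)" for i by (simp add: p_def Transposition.transpose_def)
  have c: "column j r = axis (p j) 1" for j
    by (auto simp: column_def r_def mat_def axis_def vec_eq_iff p)
  have b: "bil (axis i 1) (axis j 1) = (if i + j = 7 then 1 else 0)" for i j
  proof -
    have "bil (axis i 1) (axis j 1) = (\<Sum>k\<in>UNIV. if k = i then (if i + j = 7 then 1 else 0) else 0)"
      unfolding bil_def by (intro sum.cong refl) (auto simp: axis_def algebra_simps)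
    then show ?thesis by simp
  qed
  have "\<forall>i j. (p i + p j = 7) = (i + j = 7)"
    unfolding all_8 by (simp add: p)
  then have rO: "r \<in> O8" by (simp add: O8_iff c b)
  have "p permutes UNIV" unfolding p_def by (rule permutes_swap_id) auto
  then have "det r = - 1"
    unfolding r_def by (subst det_permute_rows) (simp_all add: p_def sign_swap_id)
  moreover have "det h = -1" using det_O8[OF h] False by blast
  ultimately have "det (h ** r) = 1" by (simp add: det_mul)
  then have "h ** r \<in> SO8" using O8_mult[OF h rO] by (simp add: SO8_def O8_def)
  moreover have "column 0 (h ** r) = column 0 h" "column 1 (h ** r) = column 1 h"
    by (simp_all add: column_mult c p mult_axis)
  ultimately show ?thesis unfolding O_min_def using orbit_wedge[OF O8_mult[OF h rO], symmetric] by auto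
qed

lemma O_minE:
  assumes "y \<in> O_min"
  obtains h where "h \<in> O8" "y = wedge (column 0 h) (column 1 h)"
  using assms SO8_O8 orbit_wedge unfolding O_min_def by blast

lemma O_min_conj:
  assumes "y \<in> O_min" "h \<in> O8"
  shows "h ** y ** matrix_inv h \<in> O_min"
proof -
  obtain g where g: "g \<in> O8" "y = wedge (column 0 g) (column 1 g)" by (rule O_minE[OF assms(1)])
  have "h ** y ** matrix_inv h = wedge (column 0 (h ** g)) (column 1 (h ** g))"
    unfolding g(2) wedge_conj[OF assms(2)]
    by (simp add: column_mult)
  then show ?thesis using wedge_columns_O_min[OF O8_mult[OF assms(2) g(1)]] by simp
qed

lemma wedge_so8: "wedge u w \<in> so8"
  by (simp add: so8_iff wedge_def)

lemma O_min_so8: "y \<in> O_min \<Longrightarrow> y \<in> so8"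
  by (erule O_minE) (simp add: wedge_so8)

lemma O_min_nonzero:
  assumes "y \<in> O_min" shows "y \<noteq> 0"
proof
  assume "y = 0"
  obtain g where g: "g \<in> SO8" "g ** e_theta ** matrix_inv g = 0" using assms \<open>y = 0\<close> unfolding O_min_def by auto
  have gi: "matrix_inv g ** g = mat 1"
    using O8_inverse(2) g(1) SO8_O8 by blast
  have "e_theta = (matrix_inv g ** g) ** e_theta ** (matrix_inv g ** g)" by (simp add: gi)
  also have "\<dots> = matrix_inv g ** (g ** e_theta ** matrix_inv g) ** g" by (simp add: matrix_mul_assoc)
  also have "\<dots> = 0" using g(2) by simp
  finally have "e_theta$0$6 = 0" by simp
  then show False by (simp add: e_theta_def Em_def)
qed

section \<open>Unipotent shears and density of the generic part of the orbit\<close>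

lemma polyfun_continuous:
  assumes "f \<in> polyfun {\<lambda>t::complex. t}"
  shows "isCont f x"
  using assms by induction auto

lemma bracket_Fm_nth:
  "bracket (Fm i j) y$p$q = (if p = i then y$j$q else 0) - (if p = 7 - j then y$(7 - i)$q else 0)
     - (if q = j then y$p$i else 0) + (if q = 7 - i then y$p$(7 - j) else 0)"
proof -
  have E: "(Em a b ** y)$p$q = (if p = a then y$b$q else 0)" "(y ** Em a b)$p$q = (if q = b then y$p$a else 0)" for a b
  proof -
    have "(Em a b ** y)$p$q = (\<Sum>k\<in>UNIV. if k = b then (if p = a then y$b$q else 0) else 0)"
      unfolding matrix_matrix_mult_def Em_def vec_lambda_beta by (intro sum.cong refl) auto
    then show "(Em a b ** y)$p$q = (if p = a then y$b$q else 0)" by simp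
    have "(y ** Em a b)$p$q = (\<Sum>k\<in>UNIV. if k = a then (if q = b then y$p$a else 0) else 0)"
      unfolding matrix_matrix_mult_def Em_def vec_lambda_beta by (intro sum.cong refl) auto
    then show "(y ** Em a b)$p$q = (if q = b then y$p$a else 0)" by simp
  qed
  show ?thesis
    unfolding bracket_def Fm_def matrix_diff_ldistrib matrix_diff_rdistrib vector_minus_component E by simp
qed

lemma Fm_square: "i \<noteq> j \<Longrightarrow> j \<noteq> 7 - i \<Longrightarrow> Fm i j ** Fm i j = 0"
proof -
  assume "i \<noteq> j" "j \<noteq> 7 - i"
  then have "j \<noteq> i" "7 - i \<noteq> j" "7 - j \<noteq> i" "i \<noteq> 7 - j" by auto
  moreover have "\<forall>i::8. 2 * i \<noteq> 7" unfolding all_8 by simp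
  ultimately show ?thesis by (simp add: Fm_def matrix_diff_ldistrib matrix_diff_rdistrib Em_mult)
qed

lemma matrix_add_rdistrib: "(B + C) ** A = B ** A + C ** A" for A :: mat8
  by (simp add: matrix_matrix_mult_def vec_eq_iff distrib_right sum.distrib)

lemma cmul_mult: "cmul c x ** y = cmul c (x ** y)" "x ** cmul c y = cmul c (x ** y)"
  by (simp_all add: cmul_def matrix_matrix_mult_def vec_eq_iff sum_distrib_left algebra_simps)

lemma cmul_add: "cmul c (x + y) = cmul c x + cmul c y"
  by (simp add: cmul_def vec_eq_iff algebra_simps)

text \<open>As \<open>F\<close> squares to zero, \<open>mat 1 + cmul t F\<close> is the exponential
  of \<open>t F\<close>. Conjugation by it is therefore quadratic in \<open>t\<close>.\<close>

lemma unipotent_O8: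
  assumes F: "F \<in> so8" "F ** F = 0"
  shows "mat 1 + cmul t F \<in> O8" "matrix_inv (mat 1 + cmul t F) = mat 1 - cmul t F"
proof -
  have FJ: "transpose F ** J8 = - (J8 ** F)"
    using F(1) by (simp add: so8_def eq_neg_iff_add_eq_0)
  have "transpose (mat 1 + cmul t F) = mat 1 + cmul t (transpose F)"
    by (auto simp: transpose_def cmul_def mat_def vec_eq_iff)
  then have "transpose (mat 1 + cmul t F) ** J8 ** (mat 1 + cmul t F)
    = J8 + cmul t (J8 ** F) + cmul t (transpose F ** J8) + cmul t (cmul t (transpose F ** J8 ** F))"
    by (simp add: matrix_add_ldistrib matrix_add_rdistrib cmul_mult cmul_add algebra_simps)
  also have "transpose F ** J8 ** F = 0"
  proof -
    have "transpose F ** J8 ** F = - (J8 ** F) ** F" by (simp add: FJ)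
    also have "\<dots> = - (J8 ** F ** F)" by (simp add: vec_eq_iff matrix_matrix_mult_def sum_negf)
    also have "\<dots> = - (J8 ** (F ** F))" by (simp only: matrix_mul_assoc)
    finally show ?thesis by (simp add: F(2))
  qed
  finally show "mat 1 + cmul t F \<in> O8"
    by (simp add: O8_def FJ) (simp add: cmul_def vec_eq_iff)
  have 1: "(mat 1 + cmul t F) ** (mat 1 - cmul t F) = mat 1"
    by (simp add: matrix_add_rdistrib matrix_diff_ldistrib cmul_mult F(2)) (simp add: cmul_def vec_eq_iff)
  show "matrix_inv (mat 1 + cmul t F) = mat 1 - cmul t F"
    by (rule matrix_inv_eqI[OF 1 matrix_left_right_inverse[THEN iffD1, OF 1]])
qed

lemma O_min_shear:
  assumes "y \<in> O_min" "i \<noteq> j" "j \<noteq> 7 - i"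
  shows "y + cmul t (bracket (Fm i j) y) - cmul (t\<^sup>2) (Fm i j ** y ** Fm i j) \<in> O_min"
proof -
  let ?F = "Fm i j"
  note O = unipotent_O8[OF Fm_so8 Fm_square[OF assms(2,3)], of t]
  have "(mat 1 + cmul t ?F) ** y ** matrix_inv (mat 1 + cmul t ?F)
    = y + cmul t (bracket ?F y) - cmul (t\<^sup>2) (?F ** y ** ?F)"
    unfolding O(2) bracket_def
    by (simp add: matrix_add_rdistrib matrix_diff_ldistrib cmul_mult)
       (simp add: cmul_def vec_eq_iff algebra_simps power2_eq_square)
  then show ?thesis using O_min_conj[OF assms(1) O(1)] by simp
qed

text \<open>Functionals vanishing wherever \<open>f\<close> does not are stable under the coadjoint action of the
  root vectors, because \<open>f\<close> stays nonzero along short unipotent arcs.\<close>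
lemma vanishing_functional_step:
  assumes f: "f \<in> polyfun coords8"
    and lin: "\<And>x y. \<Lambda> (x + y) = \<Lambda> x + \<Lambda> y" "\<And>c x. \<Lambda> (cmul c x) = c * \<Lambda> x"
    and van: "\<And>y. y \<in> O_min \<Longrightarrow> f y \<noteq> 0 \<Longrightarrow> \<Lambda> y = 0"
    and y: "y \<in> O_min" "f y \<noteq> 0" and ij: "i \<noteq> j" "j \<noteq> 7 - i"
  shows "\<Lambda> (bracket (Fm i j) y) = 0"
proof -
  let ?B = "bracket (Fm i j) y" and ?D = "Fm i j ** y ** Fm i j"
  define c where "c t = y + cmul t ?B - cmul (t\<^sup>2) ?D" for t
  have "(\<lambda>t. f (c t)) \<in> polyfun {\<lambda>t. t}"
  proof (rule polyfun_compose[OF f])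
    fix q assume "q \<in> coords8"
    then obtain a b where "q = (\<lambda>A. A$a$b)" by (auto simp: coords8_def)
    then have "(\<lambda>t. q (c t)) = (\<lambda>t. y$a$b + t * ?B$a$b - t^2 * ?D$a$b)" by (simp add: c_def cmul_def)
    moreover have "(\<lambda>t. t) \<in> polyfun {\<lambda>t::complex. t}" by (rule polyfun.coord) simp
    ultimately show "(\<lambda>t. q (c t)) \<in> polyfun {\<lambda>t. t}" by (auto intro!: polyfun_intros)
  qed
  then have "isCont (\<lambda>t. f (c t)) 0" by (rule polyfun_continuous)
  moreover have "c 0 = y" by (simp add: c_def cmul_def vec_eq_iff)
  ultimately obtain e :: real where e: "e > 0" "\<And>t. dist 0 t < e \<Longrightarrow> f (c t) \<noteq> 0"
    using y(2) continuous_at_avoid[of 0 "\<lambda>t. f (c t)" 0] by auto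
  have O: "c t \<in> O_min" for t unfolding c_def by (rule O_min_shear[OF y(1) ij])
  have sub: "\<Lambda> (x - y) = \<Lambda> x - \<Lambda> y" for x y
  proof -
    have "x - y = x + cmul (-1) y" by (simp add: cmul_def vec_eq_iff)
    then show ?thesis by (simp only: lin) simp
  qed
  have L: "\<Lambda> (c t) = \<Lambda> y + t * \<Lambda> ?B - t^2 * \<Lambda> ?D" for t
    by (simp only: c_def sub lin)
  \<comment> \<open>Both \<open>s\<close> and \<open>-s\<close> lie in the disc where
    \<open>f\<close> stays nonzero; subtracting the two values cancels the quadratic term and
    isolates the bracket.\<close>
  define s where "s = complex_of_real (e / 2)"
  have s: "dist 0 s < e" "dist 0 (-s) < e" "s \<noteq> 0" using e(1) by (auto simp: s_def)
  have "\<Lambda> (c s) = 0" "\<Lambda> (c (-s)) = 0" using van[OF O] e(2) s by blast+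
  then have "2 * s * \<Lambda> ?B = 0" unfolding L by (simp add: algebra_simps)
  then show ?thesis using s(3) by simp
qed

lemma exists_other_pair: "\<exists>j::8. j \<noteq> i \<and> j \<noteq> 7 - i \<and> j \<noteq> k \<and> j \<noteq> 7 - k" for i k :: 8
proof -
  have "\<forall>(i::8) (k::8). (0 \<noteq> i \<and> 0 \<noteq> 7 - i \<and> 0 \<noteq> k \<and> 0 \<noteq> 7 - k) \<or> (1 \<noteq> i \<and> 1 \<noteq> 7 - i \<and> 1 \<noteq> k \<and> 1 \<noteq> 7 - k)
     \<or> (2 \<noteq> i \<and> 2 \<noteq> 7 - i \<and> 2 \<noteq> k \<and> 2 \<noteq> 7 - k)"
    unfolding all_8 by simp
  then show ?thesis by metis
qed

text \<open>By the previous lemma a single vanishing off-diagonal entry spreads to all entries.\<close>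
lemma vanishing_entry_zero:
  assumes f: "f \<in> polyfun coords8" and start: "\<And>y. y \<in> O_min \<Longrightarrow> f y \<noteq> 0 \<Longrightarrow> y$i$k = 0"
    and ik: "i \<noteq> k" "k \<noteq> 7 - i" and y: "y \<in> O_min"
  shows "f y = 0"
proof (rule ccontr)
  assume fy: "f y \<noteq> 0"
  define Ent where "Ent i j \<longleftrightarrow> (\<forall>y. y \<in> O_min \<longrightarrow> f y \<noteq> 0 \<longrightarrow> y$i$j = 0)" for i j
  have step0: "bracket (Fm p q) y$i$j = 0" if "Ent i j" "y \<in> O_min" "f y \<noteq> 0" "p \<noteq> q" "q \<noteq> 7 - p" for i j p q y
    by (rule vanishing_functional_step[OF f, of "\<lambda>x. x$i$j"]) (use that in \<open>auto simp: Ent_def cmul_def\<close>)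
  \<comment> \<open>The bracket with \<open>Fm j k\<close> carries the entry in column
    \<open>j\<close> of row \<open>i\<close>, up to sign, to column \<open>k\<close>.\<close>
  have step: "Ent i j" if "Ent i k" "k \<noteq> i" "k \<noteq> 7 - i" "j \<noteq> i" "j \<noteq> k" "j \<noteq> 7 - k" for i j k
    unfolding Ent_def
  proof (intro allI impI)
    fix y assume "y \<in> O_min" "f y \<noteq> 0"
    moreover have "k \<noteq> 7 - j" "i \<noteq> 7 - k" using that by auto
    ultimately have "bracket (Fm j k) y$i$k = 0" using step0[OF that(1)] that by blast
    then show "y$i$j = 0" using that \<open>k \<noteq> 7 - j\<close> \<open>i \<noteq> 7 - k\<close> by (simp add: bracket_Fm_nth)
  qed
  have row: "Ent i j" if "Ent i k" "k \<noteq> i" "k \<noteq> 7 - i" "j \<noteq> i" "j \<noteq> 7 - i" for i j k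
  proof -
    obtain m where m: "m \<noteq> i" "m \<noteq> 7 - i" "m \<noteq> k" "m \<noteq> 7 - k" using exists_other_pair[of i k] by blast
    have "Ent i m" by (rule step[OF that(1)]) (use that m in auto)
    then have "Ent i (7 - k)" by (rule step) (use that m in auto)
    then show ?thesis using step[OF that(1), of j] that by (cases "j = k"; cases "j = 7 - k") auto
  qed
  have dual: "Ent i j \<Longrightarrow> Ent (7 - j) (7 - i)" for i j
    unfolding Ent_def using O_min_so8 so8_iff by (metis neg_equal_0_iff_equal)
  have start': "Ent i k" using start by (simp add: Ent_def)
  have far: "Ent p (7 - i)" if "Ent i k" "k \<noteq> i" "k \<noteq> 7 - i" "p \<noteq> i" "p \<noteq> 7 - i" for p i k
  proof -
    have "Ent i (7 - p)" by (rule row[OF that(1-3)]) (use that in auto)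
    from dual[OF this] show ?thesis by simp
  qed
  have off: "Ent p q" if "p \<noteq> q" "q \<noteq> 7 - p" for p q
  proof -
    consider "p = i" | "p \<noteq> i" "p \<noteq> 7 - i" | "p = 7 - i" by blast
    then show ?thesis
    proof cases
      case 1
      then show ?thesis using row[OF start'] ik that by auto
    next
      case 2
      show ?thesis by (rule row[OF far[OF start']]) (use 2 ik that in auto)
    next
      case 3
      obtain m where m: "m \<noteq> i" "m \<noteq> 7 - i" using exists_other_pair[of i i] by blast
      have "Ent m (7 - i)" by (rule far[OF start']) (use ik m in auto)
      then have "Ent p (7 - m)" by (rule far) (use m 3 in auto)
      then show ?thesis by (rule row) (use m 3 that in auto)
    qed
  qed
  have so8: "y$p$q = - y$(7-q)$(7-p)" for p q using O_min_so8[OF y] so8_iff by blast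
  \<comment> \<open>The entry equals both \<open>y$q$q\<close> and \<open>y$(7-q)$(7-q)\<close>,
    which are opposite.\<close>
  have diag: "y$p$p = 0" for p
  proof -
    obtain q where q: "q \<noteq> p" "q \<noteq> 7 - p" using exists_other_pair[of p p] by blast
    have eq: "y$p$p = y$q$q" if "q \<noteq> p" "q \<noteq> 7 - p" for q
    proof -
      have "bracket (Fm p q) y$p$q = 0" by (rule step0[OF off]) (use that y fy in auto)
      moreover have "p \<noteq> 7 - q" using that by auto
      ultimately show ?thesis using that by (simp add: bracket_Fm_nth)
    qed
    have "y$p$p = y$(7-q)$(7-q)" by (rule eq) (use q in auto)
    then show ?thesis using eq[OF q] so8[of q q] by simp
  qed
  have "y$p$q = 0" for p q
  proof -
    consider "p = q" | "q = 7 - p" | "p \<noteq> q" "q \<noteq> 7 - p" by blast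
    then show ?thesis
    proof cases
      case 2
      then show ?thesis using so8[of p q] by simp
    qed (use diag off y fy in \<open>auto simp: Ent_def\<close>)
  qed
  then show False using O_min_nonzero[OF y] by (simp add: vec_eq_iff)
qed

lemma coords8_poly: "(\<lambda>A. A$i$j) \<in> polyfun coords8"
  by (rule polyfun.coord) (auto simp: coords8_def)

text \<open>In the normal form the three functionals are, up to a factor, the differences of the
  eigenvalues. Each can be cancelled because one shear turns it into an off-diagonal entry, to which
  \<open>vanishing_entry_zero\<close> applies.\<close>

lemma generic_functionals:
  assumes f: "f \<in> polyfun coords8"
  shows "(\<And>y. y \<in> O_min \<Longrightarrow> f y * y$3$3 = 0) \<Longrightarrow> y \<in> O_min \<Longrightarrow> f y = 0"
    "(\<And>y. y \<in> O_min \<Longrightarrow> f y * (vtrace y + y$3$3) = 0) \<Longrightarrow> y \<in> O_min \<Longrightarrow> f y = 0"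
    "(\<And>y. y \<in> O_min \<Longrightarrow> f y * (vtrace y - y$3$3) = 0) \<Longrightarrow> y \<in> O_min \<Longrightarrow> f y = 0"
proof -
  assume *: "\<And>y. y \<in> O_min \<Longrightarrow> f y * y$3$3 = 0" and y: "y \<in> O_min"
  have "z$3$1 = 0" if "z \<in> O_min" "f z \<noteq> 0" for z
  proof -
    have "bracket (Fm 1 3) z$3$3 = 0"
      by (rule vanishing_functional_step[OF f, of "\<lambda>x. x$3$3"]) (use * that in \<open>auto simp: cmul_def\<close>)
    then show ?thesis by (simp add: bracket_Fm_nth)
  qed
  then show "f y = 0" by (rule vanishing_entry_zero[OF f]) (use y in auto)
next
  assume *: "\<And>y. y \<in> O_min \<Longrightarrow> f y * (vtrace y + y$3$3) = 0" and y: "y \<in> O_min"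
  have "z$0$1 = 0" if "z \<in> O_min" "f z \<noteq> 0" for z
  proof -
    have "vtrace y + y$3$3 = 0" if "y \<in> O_min" "f y \<noteq> 0" for y using *[OF that(1)] that(2) by simp
    then have "vtrace (bracket (Fm 1 0) z) + bracket (Fm 1 0) z$3$3 = 0"
      by (intro vanishing_functional_step[OF f, of "\<lambda>x. vtrace x + x$3$3"] that)
        (simp_all add: cmul_def vtrace_def algebra_simps)
    then show ?thesis using so8_rel(13)[OF O_min_so8[OF that(1)]] by (simp add: bracket_Fm_nth vtrace_def)
  qed
  then show "f y = 0" by (rule vanishing_entry_zero[OF f]) (use y in auto)
next
  assume *: "\<And>y. y \<in> O_min \<Longrightarrow> f y * (vtrace y - y$3$3) = 0" and y: "y \<in> O_min"
  have "z$0$1 = 0" if "z \<in> O_min" "f z \<noteq> 0" for z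
  proof -
    have "vtrace y - y$3$3 = 0" if "y \<in> O_min" "f y \<noteq> 0" for y using *[OF that(1)] that(2) by simp
    then have "vtrace (bracket (Fm 1 0) z) - bracket (Fm 1 0) z$3$3 = 0"
      by (intro vanishing_functional_step[OF f, of "\<lambda>x. vtrace x - x$3$3"] that)
        (simp_all add: cmul_def vtrace_def algebra_simps)
    then show ?thesis using so8_rel(13)[OF O_min_so8[OF that(1)]] by (simp add: bracket_Fm_nth vtrace_def)
  qed
  then show "f y = 0" by (rule vanishing_entry_zero[OF f]) (use y in auto)
qed

lemma generic_dense:
  assumes f: "f \<in> polyfun coords8"
    and van: "\<And>y. y \<in> O_min \<Longrightarrow> y$3$3 \<noteq> 0 \<Longrightarrow> vtrace y + y$3$3 \<noteq> 0 \<Longrightarrow> vtrace y - y$3$3 \<noteq> 0 \<Longrightarrow> f y = 0"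
    and y: "y \<in> O_min"
  shows "f y = 0"
proof -
  have vt: "vtrace \<in> polyfun coords8"
    unfolding vtrace_def[abs_def] by (intro polyfun_intros coords8_poly)
  let ?g = "\<lambda>y. f y * (vtrace y + y$3$3)" and ?h = "\<lambda>y. f y * (vtrace y + y$3$3) * (vtrace y - y$3$3)"
  have g: "?g \<in> polyfun coords8" "?h \<in> polyfun coords8"
    using vt by (auto intro!: polyfun_intros coords8_poly f)
  have "?h y * y$3$3 = 0" if "y \<in> O_min" for y using van[OF that] by auto
  then have "?h y = 0" if "y \<in> O_min" for y using generic_functionals(1)[OF g(2)] that by blast
  then have "?g y = 0" if "y \<in> O_min" for y using generic_functionals(3)[OF g(1)] that by blast
  then show ?thesis using generic_functionals(2)[OF f] y by blast
qed

section \<open>The normal form and the quotient map\<close>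

definition dot3 :: "complex^3 \<Rightarrow> complex^3 \<Rightarrow> complex" where
  "dot3 a b = (\<Sum>i\<in>UNIV. a$i * b$i)"

definition vec8 :: "complex^3 \<Rightarrow> complex^3 \<Rightarrow> complex \<Rightarrow> complex \<Rightarrow> complex^8" where
  "vec8 a \<alpha> r s = (\<chi> p. if p = 7 then a$0 else if p = 1 then a$1 else if p = 2 then a$2
     else if p = 0 then \<alpha>$0 else if p = 6 then \<alpha>$1 else if p = 5 then \<alpha>$2 else if p = 3 then r else s)"

lemma vec8_nth: "vec8 a \<alpha> r s$vpos i = a$i" "vec8 a \<alpha> r s$dpos i = \<alpha>$i" "vec8 a \<alpha> r s$3 = r" "vec8 a \<alpha> r s$4 = s"
proof -
  have "\<forall>i. vec8 a \<alpha> r s$vpos i = a$i \<and> vec8 a \<alpha> r s$dpos i = \<alpha>$i"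
    unfolding all_3 by (simp add: vec8_def vpos_simps)
  then show "vec8 a \<alpha> r s$vpos i = a$i" "vec8 a \<alpha> r s$dpos i = \<alpha>$i" by blast+
qed (simp_all add: vec8_def)

lemma bil_vec8: "bil (vec8 a \<alpha> r s) (vec8 b \<beta> r' s') = dot3 a \<beta> + dot3 \<alpha> b + r * s' + s * r'"
  by (simp add: bil_def dot3_def sum_UNIV_8 sum_UNIV_3 vec8_def)

lemma vec8_expand: "x = vec8 (\<chi> a. x$vpos a) (\<chi> a. x$dpos a) (x$3) (x$4)"
  by (simp add: vec_eq_iff all_8 vec8_def vpos_simps)

lemma wedge_vec8:
  fixes a \<alpha> b \<beta> :: "complex^3" and r s r' s' :: complex
  defines "y \<equiv> wedge (vec8 a \<alpha> r s) (vec8 b \<beta> r' s')"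
  shows "y$vpos i$vpos j = a$i * \<beta>$j - b$i * \<alpha>$j" "y$vpos i$dpos j = a$i * b$j - b$i * a$j"
    "y$dpos i$vpos j = \<alpha>$i * \<beta>$j - \<beta>$i * \<alpha>$j"
    "y$3$vpos i = r * \<beta>$i - r' * \<alpha>$i" "y$3$dpos i = r * b$i - r' * a$i"
    "y$4$vpos i = s * \<beta>$i - s' * \<alpha>$i" "y$4$dpos i = s * b$i - s' * a$i" "y$3$3 = r * s' - r' * s"
    "vtrace y = dot3 a \<beta> - dot3 \<alpha> b"
proof -
  have d: "7 - vpos i = dpos i" "7 - dpos i = vpos i" for i by (simp_all add: dpos_def)
  show "y$vpos i$vpos j = a$i * \<beta>$j - b$i * \<alpha>$j" "y$vpos i$dpos j = a$i * b$j - b$i * a$j"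
    "y$dpos i$vpos j = \<alpha>$i * \<beta>$j - \<beta>$i * \<alpha>$j"
    "y$3$vpos i = r * \<beta>$i - r' * \<alpha>$i" "y$3$dpos i = r * b$i - r' * a$i"
    "y$4$vpos i = s * \<beta>$i - s' * \<alpha>$i" "y$4$dpos i = s * b$i - s' * a$i" "y$3$3 = r * s' - r' * s"
    unfolding y_def wedge_def by (simp_all add: d vec8_nth)
  show "vtrace y = dot3 a \<beta> - dot3 \<alpha> b"
    by (simp add: y_def wedge_def vtrace_def vec8_def dot3_def sum_UNIV_3)
qed

text \<open>The cofactor formula for the inverse; cyclic indices absorb its signs.\<close>

lemma cofactor_inverse:
  fixes g G :: mat3
  assumes "G ** g = mat 1" "det g = 1"
  shows "g$(a+1)$(i+1) * g$(a+2)$(i+2) - g$(a+2)$(i+1) * g$(a+1)$(i+2) = G$i$a"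
proof -
  define N :: mat3 where "N = (\<chi> i a. g$(a+1)$(i+1) * g$(a+2)$(i+2) - g$(a+2)$(i+1) * g$(a+1)$(i+2))"
  have "\<forall>i j. (N ** g)$i$j = (if i = j then det g else 0)"
    unfolding all_3 by (simp add: N_def matrix_matrix_mult_def sum_UNIV_3 det_3 numeral_3_simps algebra_simps)
  then have "N ** g = mat 1" using assms(2) by (simp add: vec_eq_iff mat_def)
  moreover have "g ** G = mat 1" using assms(1) by (rule matrix_left_right_inverse[THEN iffD1])
  ultimately have "N = G" by (metis matrix_mul_assoc matrix_mul_lid matrix_mul_rid)
  then show ?thesis by (auto simp: N_def vec_eq_iff)
qed

lemma cofactor_inverse_dual:
  fixes g G :: mat3
  assumes "G ** g = mat 1" "det g = 1"
  shows "G$(i+1)$(a+1) * G$(i+2)$(a+2) - G$(i+1)$(a+2) * G$(i+2)$(a+1) = g$a$i"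
proof -
  have "transpose g ** transpose G = mat 1" using assms(1) by (metis matrix_transpose_mul transpose_mat)
  moreover have "det (transpose G) = 1"
    using assms det_mul[of G g] by (simp add: det_transpose)
  ultimately show ?thesis using cofactor_inverse[of "transpose g" "transpose G" a i] by (simp add: transpose_def)
qed

lemma matrix_inv_left_right:
  fixes g :: mat3
  assumes "det g = 1"
  shows "matrix_inv g ** g = mat 1" "g ** matrix_inv g = mat 1"
proof -
  have "invertible g" using assms by (simp add: invertible_det_nz)
  then have "g ** matrix_inv g = mat 1 \<and> matrix_inv g ** g = mat 1"
    unfolding invertible_def matrix_inv_def by (rule someI_ex)
  then show "matrix_inv g ** g = mat 1" "g ** matrix_inv g = mat 1" by auto
qed

lemma inverse_sums:
  fixes g :: mat3
  assumes "det g = 1"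
  shows "(\<Sum>a\<in>UNIV. matrix_inv g$i$a * g$a$j) = (if i = j then 1 else 0)"
    "(\<Sum>i\<in>UNIV. g$a$i * matrix_inv g$i$b) = (if a = b then 1 else 0)"
proof -
  have "(matrix_inv g ** g)$i$j = mat 1$i$j" "(g ** matrix_inv g)$a$b = mat 1$a$b"
    using matrix_inv_left_right[OF assms] by simp_all
  then show "(\<Sum>a\<in>UNIV. matrix_inv g$i$a * g$a$j) = (if i = j then 1 else 0)"
    "(\<Sum>i\<in>UNIV. g$a$i * matrix_inv g$i$b) = (if a = b then 1 else 0)"
    by (simp_all add: matrix_matrix_mult_def mat_def)
qed

definition normal_coords :: "mat3 \<Rightarrow> complex^3 \<Rightarrow> coord" where
  "normal_coords g z = ((\<chi> a b. \<Sum>i\<in>UNIV. z$i * (g$a$i * matrix_inv g$i$b)), z,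
     (\<chi> i a. (z$i - z$(i+1)) * g$a$i), (\<chi> i a. (z$i - z$(i-1)) * matrix_inv g$i$a))"

text \<open>\<open>uPhi\<close> and \<open>wPhi\<close> form the basis of a plane, normalized by the
  middle entries \<open>(1, 0)\<close> and \<open>(0, z$2 - z$1)\<close>. The other entries are
  chosen so that the wedge has the coordinates \<open>normal_coords g z\<close>.\<close>

definition uPhi :: "mat3 \<Rightarrow> complex^8" where
  "uPhi g = vec8 (\<chi> p. g$p$1) (\<chi> p. - matrix_inv g$2$p) 1 0"

definition wPhi :: "mat3 \<Rightarrow> complex^3 \<Rightarrow> complex^8" where
  "wPhi g z = vec8 (\<chi> p. (z$2 - z$0) * g$p$2) (\<chi> p. (z$1 - z$0) * matrix_inv g$1$p) 0 (z$2 - z$1)"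

definition Phi :: "mat3 \<Rightarrow> complex^3 \<Rightarrow> mat8" where
  "Phi g z = wedge (uPhi g) (wPhi g z)"

lemma coords_of_Phi:
  assumes g: "det g = 1" and z: "(\<Sum>i\<in>UNIV. z$i) = 0"
  shows "coords_of (Phi g z) = normal_coords g z"
proof -
  let ?G = "matrix_inv g"
  have z0: "z$0 = - z$1 - z$2" using z by (simp add: sum_UNIV_3 eq_neg_iff_add_eq_0 algebra_simps)
  note I = inverse_sums[OF g]
  note w = wedge_vec8[of "\<chi> p. g$p$1" "\<chi> p. - ?G$2$p" 1 0 "\<chi> p. (z$2 - z$0) * g$p$2"
      "\<chi> p. (z$1 - z$0) * ?G$1$p" 0 "z$2 - z$1", folded uPhi_def wPhi_def Phi_def, unfolded vec_lambda_beta]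
  have vt: "vtrace (Phi g z) = - 3 * z$0"
  proof -
    have "vtrace (Phi g z) = (z$1 - z$0) * (\<Sum>a\<in>UNIV. ?G$1$a * g$a$1) + (z$2 - z$0) * (\<Sum>a\<in>UNIV. ?G$2$a * g$a$2)"
      unfolding w(9) dot3_def sum_UNIV_3 by (simp add: algebra_simps)
    then show ?thesis unfolding I by (simp add: z0)
  qed
  have A: "Phi g z$vpos a$vpos b - (if a = b then - z$0 else 0) = (\<Sum>i\<in>UNIV. z$i * (g$a$i * ?G$i$b))" for a b
  proof -
    have e: "(if a = b then - z$0 else 0) = - z$0 * (\<Sum>i\<in>UNIV. g$a$i * ?G$i$b)" unfolding I by simp
    show ?thesis unfolding e w sum_UNIV_3 by (simp add: algebra_simps)
  qed
  \<comment> \<open>At index 0 the entries are cross products: columns 1 and 2 of \<open>g\<close>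
    give row 0 of its inverse, and dually in \<open>v0\<close>.\<close>
  have c0: "Phi g z$vpos (a+2)$dpos (a+1) = (z$0 - z$2) * ?G$0$a" for a
    unfolding w cofactor_inverse[OF matrix_inv_left_right(1)[OF g] g, symmetric] by (simp add: algebra_simps)
  have v0: "Phi g z$dpos (a+2)$vpos (a+1) = (z$0 - z$1) * g$a$0" for a
    unfolding w cofactor_inverse_dual[OF matrix_inv_left_right(1)[OF g] g, symmetric, of a 0] by (simp add: algebra_simps)
  have "vtrace (Phi g z) / 3 = - z$0" unfolding vt by simp
  note vt' = this
  show ?thesis
    unfolding coords_of_def normal_coords_def minus_divide_left[symmetric] vt' prod.inject
  proof (intro conjI)
    show "(\<chi> i. if i = 0 then - (- z$0) else if i = 1 then (- z$0 - Phi g z$3$3) / 2 else (- z$0 + Phi g z$3$3) / 2) = z"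
      unfolding w by (simp add: vec_eq_iff all_3 z0)
    show "(\<chi> i a. if i = 0 then Phi g z$dpos (a + 2)$vpos (a + 1) else if i = 1 then Phi g z$4$dpos a else Phi g z$3$dpos a)
      = (\<chi> i a. (z$i - z$(i+1)) * g$a$i)"
      unfolding v0 unfolding w by (simp add: vec_eq_iff all_3 numeral_3_simps algebra_simps)
    show "(\<chi> i a. if i = 0 then Phi g z$vpos (a + 2)$dpos (a + 1) else if i = 1 then Phi g z$3$vpos a else Phi g z$4$vpos a)
      = (\<chi> i a. (z$i - z$(i-1)) * ?G$i$a)"
      unfolding c0 unfolding w by (simp add: vec_eq_iff all_3 numeral_3_simps algebra_simps)
  qed (simp add: A)
qed

lemma tgt_of_normal_coords: "tgt_of (normal_coords g z) = psi g z"
proof -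
  have "(g ** (\<chi> i j. if i = j then z$i else 0) ** matrix_inv g)$a$b = (\<Sum>i\<in>UNIV. z$i * (g$a$i * matrix_inv g$i$b))" for a b
    by (simp add: matrix_matrix_mult_def sum_UNIV_3 algebra_simps)
  then show ?thesis
    by (simp add: tgt_of_def normal_coords_def psi_def cA_def cv_def vec_eq_iff power2_eq_square algebra_simps)
qed

text \<open>The components of \<open>w\<close> are those of \<open>x a * y e - y a * x e\<close>.
  Applying \<open>B - lx\<close> in the variable \<open>e\<close> kills \<open>x\<close> and
  multiplies \<open>y\<close> by \<open>ly - lx\<close>.\<close>

lemma cross_eigen:
  fixes B :: "3 \<Rightarrow> 3 \<Rightarrow> complex"
  assumes x: "\<And>b. (\<Sum>e\<in>UNIV. B b e * x e) = lx * x b" and y: "\<And>b. (\<Sum>e\<in>UNIV. B b e * y e) = ly * y b"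
    and w: "\<And>d. w d = x (d+1) * y (d+2) - x (d+2) * y (d+1)"
  shows "(B b (a+1) - (if b = a+1 then lx else 0)) * w (a+2) - (B b (a+2) - (if b = a+2 then lx else 0)) * w (a+1)
     = (ly - lx) * (x a * y b)"
proof -
  have "\<forall>a b. (B b (a+1) - (if b = a+1 then lx else 0)) * w (a+2) - (B b (a+2) - (if b = a+2 then lx else 0)) * w (a+1)
     = x a * ((\<Sum>e\<in>UNIV. B b e * y e) - lx * y b) - y a * ((\<Sum>e\<in>UNIV. B b e * x e) - lx * x b)"
    unfolding all_3 w by (simp add: sum_UNIV_3 numeral_3_simps algebra_simps)
  then have "(B b (a+1) - (if b = a+1 then lx else 0)) * w (a+2) - (B b (a+2) - (if b = a+2 then lx else 0)) * w (a+1)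
     = x a * ((\<Sum>e\<in>UNIV. B b e * y e) - lx * y b) - y a * ((\<Sum>e\<in>UNIV. B b e * x e) - lx * x b)" by blast
  also have "\<dots> = (ly - lx) * (x a * y b)" unfolding x y by (simp add: algebra_simps)
  finally show ?thesis .
qed

lemma index_3:
  "(i::3) + 1 + 1 = i + 2" "i + 1 + 2 = i" "i + 2 + 1 = i" "i + 2 + 2 = i + 1" "i - 1 = i + 2"
  "- i - (i + 1) = i + 2" "- i - (i + 2) = i + 1"
proof -
  have "\<forall>i::3. i + 1 + 1 = i + 2 \<and> i + 1 + 2 = i \<and> i + 2 + 1 = i \<and> i + 2 + 2 = i + 1 \<and> i - 1 = i + 2
    \<and> - i - (i + 1) = i + 2 \<and> - i - (i + 2) = i + 1" unfolding all_3 by simp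
  then show "i + 1 + 1 = i + 2" "i + 1 + 2 = i" "i + 2 + 1 = i" "i + 2 + 2 = i + 1" "i - 1 = i + 2"
    "- i - (i + 1) = i + 2" "- i - (i + 2) = i + 1" by blast+
qed

lemma distinct_3: "(i::3) \<noteq> j \<Longrightarrow> j = i + 1 \<or> j = i + 2"
proof -
  have "\<forall>i j::3. i \<noteq> j \<longrightarrow> j = i + 1 \<or> j = i + 2" unfolding all_3 by simp
  then show "i \<noteq> j \<Longrightarrow> j = i + 1 \<or> j = i + 2" by blast
qed

lemma normal_coords_rels:
  assumes g: "det g = 1" and z: "(\<Sum>i\<in>UNIV. z$i) = 0"
  shows "normal_coords g z \<in> rels"
proof -
  let ?G = "matrix_inv g"
  note I = inverse_sums[OF g]
  have z0: "z$0 = - z$1 - z$2" using z by (simp add: sum_UNIV_3 eq_neg_iff_add_eq_0 algebra_simps)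
  \<comment> \<open>\<open>D n\<close> is the matrix \<open>A^n = g diag(z)^n g^-1\<close>; in
    particular \<open>D 0\<close> is the identity.\<close>
  define D where "D n a b = (\<Sum>i\<in>UNIV. z$i ^ n * (g$a$i * ?G$i$b))" for n a b
  have DD: "(\<Sum>e\<in>UNIV. D m a e * D n e b) = D (m + n) a b" for m n a b
  proof -
    have "(\<Sum>e\<in>UNIV. D m a e * D n e b)
      = (\<Sum>i\<in>UNIV. \<Sum>j\<in>UNIV. z$i^m * z$j^n * g$a$i * ?G$j$b * (\<Sum>e\<in>UNIV. ?G$i$e * g$e$j))"
      unfolding D_def sum_UNIV_3 by (simp add: algebra_simps)
    also have "\<dots> = D (m + n) a b"
      unfolding I D_def by (simp add: sum_UNIV_3 power_add algebra_simps)
    finally show ?thesis .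
  qed
  have trD: "(\<Sum>a\<in>UNIV. D n a a) = (\<Sum>i\<in>UNIV. z$i ^ n)" for n
  proof -
    have "(\<Sum>a\<in>UNIV. D n a a) = (\<Sum>i\<in>UNIV. z$i^n * (\<Sum>a\<in>UNIV. ?G$i$a * g$a$i))"
      unfolding D_def sum_UNIV_3 by (simp add: algebra_simps)
    then show ?thesis unfolding I by simp
  qed
  have Dg: "(\<Sum>e\<in>UNIV. D 1 a e * g$e$i) = z$i * g$a$i" for a i
  proof -
    have "(\<Sum>e\<in>UNIV. D 1 a e * g$e$i) = (\<Sum>j\<in>UNIV. z$j * g$a$j * (\<Sum>e\<in>UNIV. ?G$j$e * g$e$i))"
      unfolding D_def sum_UNIV_3 by (simp add: algebra_simps)
    then show ?thesis unfolding I by (simp add: if_distrib cong: if_cong)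
  qed
  have GD: "(\<Sum>e\<in>UNIV. D 1 e a * ?G$i$e) = z$i * ?G$i$a" for a i
  proof -
    have "(\<Sum>e\<in>UNIV. D 1 e a * ?G$i$e) = (\<Sum>j\<in>UNIV. z$j * ?G$j$a * (\<Sum>e\<in>UNIV. ?G$i$e * g$e$j))"
      unfolding D_def sum_UNIV_3 by (simp add: algebra_simps)
    then show ?thesis unfolding I by (simp add: if_distrib cong: if_cong)
  qed
  have cA: "cA (normal_coords g z)$a$b = D 1 a b" for a b by (simp add: normal_coords_def cA_def D_def)
  have cl: "cl (normal_coords g z) = z" by (simp add: normal_coords_def cl_def)
  have cv: "cv True (normal_coords g z)$i$a = (z$i - z$(i+1)) * g$a$i" "cv False (normal_coords g z)$i$a = (z$i - z$(i-1)) * ?G$i$a" for i a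
    by (simp_all add: normal_coords_def cv_def)
  have t2: "tr2 (cA (normal_coords g z)) = (\<Sum>i\<in>UNIV. z$i ^ 2)"
    unfolding tr2_def cA DD trD by (simp add: power2_eq_square)
  have t3: "tr3 (cA (normal_coords g z)) = (\<Sum>i\<in>UNIV. z$i ^ 3)"
  proof -
    have "tr3 (cA (normal_coords g z)) = (\<Sum>a\<in>UNIV. \<Sum>b\<in>UNIV. D 1 a b * (\<Sum>d\<in>UNIV. D 1 b d * D 1 d a))"
      unfolding tr3_def cA by (simp add: sum_distrib_left mult.assoc)
    then show ?thesis unfolding DD trD by (simp add: numeral_3_eq_3)
  qed
  note cof = cofactor_inverse[OF matrix_inv_left_right(1)[OF g] g]
    and cof' = cofactor_inverse_dual[OF matrix_inv_left_right(1)[OF g] g]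
  have R4: "cv True (normal_coords g z)$i$a * cv True (normal_coords g z)$j$a' =
          (D 1 a' (a+1) - (if a' = a+1 then z$i else 0)) * cv False (normal_coords g z)$(-i-j)$(a+2)
           - (D 1 a' (a+2) - (if a' = a+2 then z$i else 0)) * cv False (normal_coords g z)$(-i-j)$(a+1)" if ij: "i \<noteq> j" for i j a a'
    using distinct_3[OF ij]
  proof
    assume j: "j = i + 1"
    note E = cross_eigen[of "D 1" "\<lambda>p. g$p$i" "z$i" "\<lambda>p. g$p$(i+1)" "z$(i+1)" "\<lambda>d. ?G$(i+2)$d" a' a,
        OF Dg Dg cof[of _ "i+2", unfolded index_3, symmetric]]
    have "x * (n * w) - x' * (n * w') = n * (x * w - x' * w')" for x n w x' w' :: complex by (simp add: algebra_simps)
    then show ?thesis unfolding j cv index_3 by (simp only: E) (simp add: algebra_simps)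
  next
    assume j: "j = i + 2"
    note E = cross_eigen[of "D 1" "\<lambda>p. g$p$i" "z$i" "\<lambda>p. g$p$(i+2)" "z$(i+2)" "\<lambda>d. - ?G$(i+1)$d" a' a,
        OF Dg Dg]
    have W: "- ?G$(i+1)$d = g$(d+1)$i * g$(d+2)$(i+2) - g$(d+2)$i * g$(d+1)$(i+2)" for d
      unfolding cof[of d "i+1", unfolded index_3, symmetric] by (simp add: algebra_simps)
    have "x * (n * w) - x' * (n * w') = - n * (x * - w - x' * - w')" for x n w x' w' :: complex by (simp add: algebra_simps)
    then show ?thesis unfolding j cv index_3 by (simp only: E[OF W]) (simp add: algebra_simps)
  qed
  have R4': "cv False (normal_coords g z)$i$a * cv False (normal_coords g z)$j$a' =
          - ((D 1 (a+1) a' - (if a' = a+1 then z$i else 0)) * cv True (normal_coords g z)$(-i-j)$(a+2)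
           - (D 1 (a+2) a' - (if a' = a+2 then z$i else 0)) * cv True (normal_coords g z)$(-i-j)$(a+1))" if ij: "i \<noteq> j" for i j a a'
    using distinct_3[OF ij]
  proof
    assume j: "j = i + 1"
    note E = cross_eigen[of "\<lambda>b e. D 1 e b" "\<lambda>p. ?G$i$p" "z$i" "\<lambda>p. ?G$(i+1)$p" "z$(i+1)" "\<lambda>d. g$d$(i+2)" a' a,
        OF GD GD cof'[of "i+2", unfolded index_3, symmetric]]
    have "- (x * (n * w) - x' * (n * w')) = - n * (x * w - x' * w')" for x n w x' w' :: complex by (simp add: algebra_simps)
    then show ?thesis unfolding j cv index_3 by (simp only: E) (simp add: algebra_simps)
  next
    assume j: "j = i + 2"
    note E = cross_eigen[of "\<lambda>b e. D 1 e b" "\<lambda>p. ?G$i$p" "z$i" "\<lambda>p. ?G$(i+2)$p" "z$(i+2)" "\<lambda>d. - g$d$(i+1)" a' a,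
        OF GD GD]
    have W: "- g$d$(i+1) = ?G$i$(d+1) * ?G$(i+2)$(d+2) - ?G$i$(d+2) * ?G$(i+2)$(d+1)" for d
      unfolding cof'[of "i+1" d, unfolded index_3, symmetric] by (simp add: algebra_simps)
    have "- (x * (n * w) - x' * (n * w')) = n * (x * - w - x' * - w')" for x n w x' w' :: complex by (simp add: algebra_simps)
    then show ?thesis unfolding j cv index_3 by (simp only: E[OF W]) (simp add: algebra_simps)
  qed
  have R3: "cv True (normal_coords g z)$i$a * cv False (normal_coords g z)$i$a' = (\<Sum>e\<in>UNIV. D 1 a e * D 1 e a') + z$i * D 1 a a'
          + (if a = a' then (z$i)^2 - (\<Sum>i\<in>UNIV. z$i ^ 2) / 2 else 0)" for i a a'
  proof -
    have e: "(if a = a' then (z$i)^2 - (\<Sum>i\<in>UNIV. z$i ^ 2) / 2 else 0)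
      = ((z$i)^2 - (\<Sum>i\<in>UNIV. z$i ^ 2) / 2) * D 0 a a'"
      unfolding D_def using I(2)[of a a'] by simp
    \<comment> \<open>Interpolation: the polynomial \<open>(x - z_(i+1)) (x - z_(i-1))\<close>
      vanishes at the two other eigenvalues, so at \<open>A\<close> only the component along the
      eigenvector of \<open>z_i\<close> remains.\<close>
    have "\<forall>i. (z$i - z$(i+1)) * g$a$i * ((z$i - z$(i-1)) * ?G$i$a') = D (1+1) a a' + z$i * D 1 a a'
          + ((z$i)^2 - (\<Sum>i\<in>UNIV. z$i ^ 2) / 2) * D 0 a a'"
      unfolding all_3 D_def sum_UNIV_3 z0 by (simp add: numeral_3_simps z0 field_simps power2_eq_square)
    then show ?thesis unfolding cv DD e by blast
  qed
  show ?thesis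
    unfolding rels_def mem_Collect_eq cl t2 t3 cA
  proof (intro conjI allI impI)
    fix b i a
    show "z$i * cv b (normal_coords g z)$i$a = (\<Sum>e\<in>UNIV. cAt b (normal_coords g z) a e * cv b (normal_coords g z)$i$e)"
    proof (cases b)
      case True
      have "(\<Sum>e\<in>UNIV. D 1 a e * ((z$i - z$(i+1)) * g$e$i)) = (z$i - z$(i+1)) * (\<Sum>e\<in>UNIV. D 1 a e * g$e$i)"
        by (simp add: sum_distrib_left algebra_simps)
      then show ?thesis using True unfolding Dg by (simp add: cAt_def cA cv algebra_simps)
    next
      case False
      have "(\<Sum>e\<in>UNIV. D 1 e a * ((z$i - z$(i-1)) * ?G$i$e)) = (z$i - z$(i-1)) * (\<Sum>e\<in>UNIV. D 1 e a * ?G$i$e)"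
        by (simp add: sum_distrib_left algebra_simps)
      then show ?thesis using False unfolding GD by (simp add: cAt_def cA cv algebra_simps)
    qed
  next
    fix b i j a a' assume ij: "i \<noteq> (j::3)"
    show "cv b (normal_coords g z)$i$a * cv b (normal_coords g z)$j$a' =
          (if b then 1 else -1) *
          ((cAt b (normal_coords g z) a' (a+1) - (if a' = a+1 then z$i else 0)) * cv (\<not>b) (normal_coords g z)$(-i-j)$(a+2)
           - (cAt b (normal_coords g z) a' (a+2) - (if a' = a+2 then z$i else 0)) * cv (\<not>b) (normal_coords g z)$(-i-j)$(a+1))"
    proof (cases b)
      case True
      then show ?thesis unfolding cAt_def cA using R4[OF ij, of a a'] by (simp only: if_True not_True_eq_False simp_thms mult_1)
    next
      case False
      then show ?thesis unfolding cAt_def cA using R4'[OF ij, of a a']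
        by (simp only: if_False not_False_eq_True simp_thms mult_minus1)
    qed
  qed (simp_all only: z R3)
qed

lemma dot3_simps:
  "dot3 0 a = 0" "dot3 a 0 = 0"
  by (simp_all add: dot3_def)

text \<open>\<open>uPhi\<close> and \<open>wPhi\<close> are completed to a basis with antidiagonal
  Gram matrix. The vector paired with \<open>wPhi\<close> needs division by
  \<open>z$2 - z$0\<close>.\<close>

lemma Phi_O_min:
  assumes g: "det g = 1" and z: "z$2 \<noteq> z$0"
  shows "Phi g z \<in> O_min"
proof -
  let ?G = "matrix_inv g"
  define \<nu> where "\<nu> = z$2 - z$0"
  have \<nu>: "\<nu> \<noteq> 0" using z by (simp add: \<nu>_def)
  define gv hv where "gv i c = (\<chi> p. c * g$p$i)" and "hv i c = (\<chi> p. c * ?G$i$p)" for i c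
  have d: "dot3 (gv i c) (hv j e) = (if i = j then c * e else 0)"
    "dot3 (hv j e) (gv i c) = (if i = j then c * e else 0)" for i j c e
  proof -
    have "dot3 (gv i c) (hv j e) = c * e * (\<Sum>a\<in>UNIV. ?G$j$a * g$a$i)"
      by (simp add: dot3_def gv_def hv_def sum_distrib_left algebra_simps)
    then show 1: "dot3 (gv i c) (hv j e) = (if i = j then c * e else 0)"
      unfolding inverse_sums[OF g] by simp
    show "dot3 (hv j e) (gv i c) = (if i = j then c * e else 0)"
      unfolding 1[symmetric] dot3_def by (simp add: mult.commute)
  qed
  define col where "col j = (if j = 0 then vec8 (gv 1 1) (hv 2 (-1)) 1 0
    else if j = 1 then vec8 (gv 2 \<nu>) (hv 1 (z$1 - z$0)) 0 (z$2 - z$1)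
    else if j = 2 then vec8 (gv 0 1) 0 0 0 else if j = 3 then vec8 0 (hv 2 (- (z$2 - z$1) / \<nu>)) 1 0
    else if j = 4 then vec8 0 (hv 1 (-1)) 0 1 else if j = 5 then vec8 0 (hv 0 1) 0 0
    else if j = 6 then vec8 0 (hv 2 (1 / \<nu>)) 0 0 else vec8 0 (hv 1 1) 0 0)" for j :: 8
  define h :: mat8 where "h = (\<chi> p j. col j$p)"
  have c: "column j h = col j" for j by (simp add: column_def h_def vec_eq_iff)
  have "\<forall>i j. bil (col i) (col j) = (if i + j = 7 then 1 else 0)"
    unfolding all_8 col_def using \<nu> by (simp add: bil_vec8 d dot3_simps) (simp add: \<nu>_def)
  then have "h \<in> O8" by (simp add: O8_iff c)
  from wedge_columns_O_min[OF this] show ?thesis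
    unfolding c by (simp add: Phi_def uPhi_def wPhi_def col_def \<nu>_def gv_def hv_def)
qed

lemma Phi_closure:
  assumes g: "det g = 1"
  shows "Phi g z \<in> zariski_closure coords8 O_min"
  unfolding zariski_closure_def mem_Collect_eq
proof (intro ballI impI)
  fix f assume f: "f \<in> polyfun coords8" and van: "\<forall>y\<in>O_min. f y = 0"
  show "f (Phi g z) = 0"
  proof (cases "z$2 = z$0")
    case False
    then show ?thesis using Phi_O_min[OF g] van by blast
  next
    case True
    \<comment> \<open>Since \<open>z$2 = z$0\<close>, this perturbation makes their difference equal
      to \<open>t\<close>; the point is then a limit of orbit points.\<close>
    define zz where "zz t = (\<chi> i. z$i + (if i = 2 then t else 0))" for t
    have O: "Phi g (zz t) \<in> O_min" if "t \<noteq> 0" for t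
      by (rule Phi_O_min[OF g]) (use that True in \<open>simp add: zz_def\<close>)
    have t: "(\<lambda>t. t) \<in> polyfun {\<lambda>t::complex. t}" by (rule polyfun.coord) simp
    have "(\<lambda>t. wPhi g (zz t)$p) \<in> polyfun {\<lambda>t. t}" for p
      unfolding wPhi_def vec8_def zz_def
      by (cases "p = 7"; cases "p = 1"; cases "p = 2"; cases "p = 0"; cases "p = 6"; cases "p = 5"; cases "p = 3")
        (auto intro!: polyfun_intros t)
    then have "(\<lambda>t. Phi g (zz t)$i$j) \<in> polyfun {\<lambda>t. t}" for i j
      unfolding Phi_def wedge_def by (auto intro!: polyfun_intros)
    then have "(\<lambda>t. f (Phi g (zz t))) \<in> polyfun {\<lambda>t. t}"
      by (intro polyfun_compose[OF f]) (auto simp: coords8_def)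
    then have "isCont (\<lambda>t. f (Phi g (zz t))) 0" by (rule polyfun_continuous)
    then have "((\<lambda>t. f (Phi g (zz t))) \<longlongrightarrow> f (Phi g (zz 0))) (at 0)" by (simp add: isCont_def)
    moreover have "((\<lambda>t. f (Phi g (zz t))) \<longlongrightarrow> 0) (at 0)"
    proof (rule tendsto_eventually)
      show "\<forall>\<^sub>F t in at 0. f (Phi g (zz t)) = 0"
        using O van by (auto simp: eventually_at_filter)
    qed
    ultimately have "f (Phi g (zz 0)) = 0" by (rule tendsto_unique[OF at_neq_bot])
    moreover have "zz 0 = z" by (simp add: zz_def vec_eq_iff)
    ultimately show ?thesis by simp
  qed
qed

lemma wedge_basis_change:
  "p * q' - p' * q = 1 \<Longrightarrow> wedge (p *s u + p' *s w) (q *s u + q' *s w) = wedge u w"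
proof -
  assume *: "p * q' - p' * q = 1"
  have "wedge (p *s u + p' *s w) (q *s u + q' *s w)$i$j = (p * q' - p' * q) * wedge u w$i$j" for i j
    by (simp add: wedge_def algebra_simps)
  then show ?thesis by (simp add: * vec_eq_iff)
qed

lemma bil_add_smult:
  "bil (p *s u + p' *s w) (q *s x + q' *s y) = p * q * bil u x + p * q' * bil u y + p' * q * bil w x + p' * q' * bil w y"
  by (simp add: bil_def sum_UNIV_8 algebra_simps)

text \<open>A wedge depends on the pair of vectors only up to a change of basis of determinant one.
  After normalizing the middle entries, isotropy of the plane supplies the orthogonality between
  columns of \<open>g\<close> and rows of its inverse.\<close>

lemma generic_Phi:
  assumes y: "y \<in> O_min" and gen: "y$3$3 \<noteq> 0" "vtrace y + y$3$3 \<noteq> 0" "vtrace y - y$3$3 \<noteq> 0"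
  shows "\<exists>g z. det g = 1 \<and> (\<Sum>i\<in>UNIV. z$i) = 0 \<and> y = Phi g z"
proof -
  obtain h where h: "h \<in> O8" "y = wedge (column 0 h) (column 1 h)" by (rule O_minE[OF y])
  define u w where "u = column 0 h" and "w = column 1 h"
  have b: "bil u u = 0" "bil u w = 0" "bil w u = 0" "bil w w = 0"
    using h(1) unfolding O8_iff u_def w_def by simp_all
  have yuw: "y = wedge u w" by (simp add: h(2) u_def w_def)
  define t where "t = u$3 * w$4 - w$3 * u$4"
  have t: "t = y$3$3" by (simp add: t_def yuw wedge_def)
  have t0: "t \<noteq> 0" using gen(1) t by simp
  define u' w' where "u' = (w$4 / t) *s u + (- u$4 / t) *s w" and "w' = (- w$3) *s u + u$3 *s w"
  have y': "y = wedge u' w'"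
    unfolding yuw u'_def w'_def using t0
    by (intro wedge_basis_change[symmetric]) (simp add: field_simps, simp add: t_def algebra_simps)
  have b': "bil u' u' = 0" "bil u' w' = 0" "bil w' w' = 0"
    unfolding u'_def w'_def bil_add_smult b by simp_all
  define a \<alpha> b \<beta> :: "complex^3" where "a = (\<chi> i. u'$vpos i)" and "\<alpha> = (\<chi> i. u'$dpos i)"
    and "b = (\<chi> i. w'$vpos i)" and "\<beta> = (\<chi> i. w'$dpos i)"
  have u': "u' = vec8 a \<alpha> 1 0"
  proof -
    have "u'$3 = 1" "u'$4 = 0" using t0 by (simp_all add: u'_def field_simps) (simp add: t_def algebra_simps)
    then show ?thesis using vec8_expand[of u'] by (simp add: a_def \<alpha>_def)
  qed
  have w': "w' = vec8 b \<beta> 0 t"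
  proof -
    have "w'$3 = 0" "w'$4 = t" by (simp_all add: w'_def t_def algebra_simps)
    then show ?thesis using vec8_expand[of w'] by (simp add: b_def \<beta>_def)
  qed
  have comm: "dot3 x y = dot3 y x" for x y by (simp add: dot3_def mult.commute)
  have iso: "dot3 a \<alpha> = 0" "dot3 b \<beta> = 0" "dot3 a \<beta> + dot3 \<alpha> b + t = 0"
    using b' unfolding u' w' bil_vec8 by (simp_all add: comm[of \<alpha> a] comm[of \<beta> b])
  define P \<nu> where "P = dot3 a \<beta>" and "\<nu> = - dot3 \<alpha> b"
  have vt: "vtrace y = P + \<nu>" unfolding y' u' w' wedge_vec8 P_def \<nu>_def by simp
  have tP: "t = \<nu> - P" using iso(3) by (simp add: P_def \<nu>_def algebra_simps eq_neg_iff_add_eq_0)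
  have nz: "P \<noteq> 0" "\<nu> \<noteq> 0" using gen(2,3) unfolding vt t[symmetric] tP by auto
  \<comment> \<open>The plane supplies two columns and two rows of the inverse; the missing ones are
    cross products. Their pairing is \<open>P * \<nu>\<close> by the Lagrange identity, hence the
    divisors.\<close>
  define g :: mat3 where "g = (\<chi> p i. if i = 0 then (\<alpha>$(p+1) * \<beta>$(p+2) - \<alpha>$(p+2) * \<beta>$(p+1)) / P
     else if i = 1 then a$p else b$p / \<nu>)"
  define G :: mat3 where "G = (\<chi> i p. if i = 0 then (a$(p+1) * b$(p+2) - a$(p+2) * b$(p+1)) / \<nu>
     else if i = 1 then \<beta>$p / P else - \<alpha>$p)"
  have lagrange: "(\<Sum>p\<in>UNIV. (a$(p+1) * b$(p+2) - a$(p+2) * b$(p+1)) * (\<alpha>$(p+1) * \<beta>$(p+2) - \<alpha>$(p+2) * \<beta>$(p+1)))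
      = P * \<nu>"
  proof -
    have "(\<Sum>p\<in>UNIV. (a$(p+1) * b$(p+2) - a$(p+2) * b$(p+1)) * (\<alpha>$(p+1) * \<beta>$(p+2) - \<alpha>$(p+2) * \<beta>$(p+1)))
      = dot3 a \<alpha> * dot3 b \<beta> - dot3 a \<beta> * dot3 \<alpha> b"
      by (simp add: dot3_def sum_UNIV_3 numeral_3_simps algebra_simps)
    then show ?thesis by (simp add: iso P_def \<nu>_def)
  qed
  have Gg0: "(\<Sum>p\<in>UNIV. G$0$p * g$p$0) = 1"
  proof -
    have "(\<Sum>p\<in>UNIV. G$0$p * g$p$0) = (\<Sum>p\<in>UNIV. (a$(p+1) * b$(p+2) - a$(p+2) * b$(p+1)) * (\<alpha>$(p+1) * \<beta>$(p+2) - \<alpha>$(p+2) * \<beta>$(p+1))) / (P * \<nu>)"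
      by (simp add: G_def g_def sum_divide_distrib mult.commute)
    then show ?thesis unfolding lagrange using nz by simp
  qed
  have Gg: "G ** g = mat 1"
  proof -
    have e: "dot3 a \<beta> = P" "dot3 \<alpha> b = - \<nu>" by (simp_all add: P_def \<nu>_def)
    have entries: "(\<Sum>p\<in>UNIV. G$1$p * g$p$1) = dot3 a \<beta> / P" "(\<Sum>p\<in>UNIV. G$1$p * g$p$2) = dot3 b \<beta> / (P * \<nu>)"
      "(\<Sum>p\<in>UNIV. G$2$p * g$p$1) = - dot3 a \<alpha>" "(\<Sum>p\<in>UNIV. G$2$p * g$p$2) = - dot3 \<alpha> b / \<nu>"
      using nz by (simp_all add: G_def g_def dot3_def sum_UNIV_3 field_simps)
    have zero: "(\<Sum>p\<in>UNIV. G$0$p * g$p$1) = 0" "(\<Sum>p\<in>UNIV. G$0$p * g$p$2) = 0"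
      "(\<Sum>p\<in>UNIV. G$1$p * g$p$0) = 0" "(\<Sum>p\<in>UNIV. G$2$p * g$p$0) = 0"
      using nz by (simp_all add: G_def g_def sum_UNIV_3 numeral_3_simps field_simps)
    show ?thesis
      unfolding vec_eq_iff all_3 matrix_matrix_mult_def vec_lambda_beta Gg0 entries zero iso e
      using nz by (simp add: mat_def)
  qed
  have det: "det g = 1"
  proof -
    have "det g = (\<Sum>p\<in>UNIV. G$0$p * g$p$0)"
      using nz by (simp add: det_3 G_def g_def sum_UNIV_3 numeral_3_simps field_simps)
    then show ?thesis using Gg0 by simp
  qed
  have inv: "matrix_inv g = G"
    by (rule matrix_inv_eqI[OF matrix_left_right_inverse[THEN iffD1, OF Gg] Gg])
  \<comment> \<open>The triple of sum zero with \<open>z$1 - z$0 = P\<close> and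
    \<open>z$2 - z$0 = \<nu>\<close>.\<close>
  define z :: "complex^3" where "z = (\<chi> i. - (P + \<nu>) / 3 + (if i = 0 then 0 else if i = 1 then P else \<nu>))"
  have zd: "z$1 - z$0 = P" "z$2 - z$0 = \<nu>" "z$2 - z$1 = t" by (simp_all add: z_def tP)
  have "(\<Sum>i\<in>UNIV. z$i) = 0" by (simp add: z_def sum_UNIV_3 field_simps)
  moreover have "uPhi g = u'" unfolding uPhi_def inv u' by (simp add: g_def G_def vec_lambda_eta)
  moreover have "wPhi g z = w'" unfolding wPhi_def inv w' zd using nz by (simp add: g_def G_def vec_lambda_eta)
  ultimately show ?thesis using det y' unfolding Phi_def by metis
qed

text \<open>The test principle for the closure: generic orbit points are values of
  \<open>Phi\<close>, and a polynomial vanishing at them vanishes on the whole orbit.\<close>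

lemma closure_Phi:
  assumes f: "f \<in> polyfun coords8" "\<And>g z. det g = 1 \<Longrightarrow> (\<Sum>i\<in>UNIV. z$i) = 0 \<Longrightarrow> f (Phi g z) = 0"
    and x: "x \<in> zariski_closure coords8 O_min"
  shows "f x = 0"
proof -
  have "f y = 0" if "y \<in> O_min" for y
    by (rule generic_dense[OF f(1) _ that]) (use generic_Phi f(2) in blast)
  then show ?thesis using x f(1) by (auto simp: zariski_closure_def)
qed

lemma closure_Phi_eq:
  assumes "p \<in> polyfun coords8" "q \<in> polyfun coords8"
    and "\<And>g z. det g = 1 \<Longrightarrow> (\<Sum>i\<in>UNIV. z$i) = 0 \<Longrightarrow> p (Phi g z) = q (Phi g z)"
    and "x \<in> zariski_closure coords8 O_min"
  shows "p x = q x"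
  using closure_Phi[OF polyfun_diff[OF assms(1,2)] _ assms(4)] assms(3) by simp

lemma closure_so8: "x \<in> zariski_closure coords8 O_min \<Longrightarrow> x \<in> so8"
  unfolding so8_iff
proof (intro allI)
  fix i j assume x: "x \<in> zariski_closure coords8 O_min"
  have "Phi g z$i$j = - Phi g z$(7-j)$(7-i)" for g z
    using wedge_so8 unfolding Phi_def so8_iff by blast
  then show "x$i$j = - x$(7-j)$(7-i)"
    by (intro closure_Phi_eq[OF _ _ _ x, of "\<lambda>x. x$i$j" "\<lambda>x. - x$(7-j)$(7-i)"] polyfun_intros coords8_poly)
qed

lemma coords_of_poly:
  "(\<lambda>x. cA (coords_of x)$a$b) \<in> polyfun coords8" "(\<lambda>x. cl (coords_of x)$i) \<in> polyfun coords8"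
  "(\<lambda>x. cv t (coords_of x)$i$a) \<in> polyfun coords8"
proof -
  have h: "(\<lambda>x. vtrace x / 3) \<in> polyfun coords8"
    unfolding vtrace_def divide_inverse by (intro polyfun_intros coords8_poly)
  show "(\<lambda>x. cA (coords_of x)$a$b) \<in> polyfun coords8"
    by (cases "a = b") (auto simp: cA_def coords_of_def intro!: polyfun_intros coords8_poly h)
  have half: "(\<lambda>x. f x / 2) \<in> polyfun coords8" if "f \<in> polyfun coords8" for f
    unfolding divide_inverse by (intro polyfun_intros that)
  show "(\<lambda>x. cl (coords_of x)$i) \<in> polyfun coords8"
    using polyfun_uminus[OF h]
    by (cases "i = 0"; cases "i = 1") (auto simp: cl_def coords_of_def intro!: half polyfun_diff polyfun.add coords8_poly h)
  show "(\<lambda>x. cv t (coords_of x)$i$a) \<in> polyfun coords8"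
    by (cases t; cases "i = 0"; cases "i = 1") (auto simp: cv_def coords_of_def intro!: coords8_poly)
qed

text \<open>Each relation is an equality of polynomial functions of the matrix, so it passes from
  the normal forms to the closure.\<close>

lemma closure_rels:
  assumes x: "x \<in> zariski_closure coords8 O_min"
  shows "coords_of x \<in> rels"
proof -
  note R = relsD[OF normal_coords_rels]
  have At: "(\<lambda>x. cAt b (coords_of x) a e) \<in> polyfun coords8" for b a e
    unfolding cAt_def by (cases b) (auto intro: coords_of_poly)
  have tr: "(\<lambda>x. tr2 (cA (coords_of x))) \<in> polyfun coords8" "(\<lambda>x. tr3 (cA (coords_of x))) \<in> polyfun coords8"
    unfolding tr2_def tr3_def by (intro polyfun_intros coords_of_poly)+
  have half: "(\<lambda>x. f x / 2) \<in> polyfun coords8" if "f \<in> polyfun coords8" for f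
    unfolding divide_inverse by (intro polyfun_intros that)
  have ifp: "(\<lambda>x. if Q then f x else 0) \<in> polyfun coords8" if "f \<in> polyfun coords8" for f Q
    using that by (cases Q) (auto intro: polyfun.const)
  note I = polyfun_intros coords_of_poly At tr half ifp
  show ?thesis
    unfolding rels_def mem_Collect_eq
  proof (intro conjI allI impI)
    show "(\<Sum>i\<in>UNIV. cl (coords_of x)$i) = 0"
      by (rule closure_Phi_eq[OF _ _ _ x, of "\<lambda>x. \<Sum>i\<in>UNIV. cl (coords_of x)$i" "\<lambda>x. 0"])
        (intro I, intro I, simp only: coords_of_Phi R)
    show "(\<Sum>i\<in>UNIV. (cl (coords_of x)$i)^2) = tr2 (cA (coords_of x))"
      by (rule closure_Phi_eq[OF _ _ _ x, of "\<lambda>x. \<Sum>i\<in>UNIV. (cl (coords_of x)$i)^2" "\<lambda>x. tr2 (cA (coords_of x))"])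
        (intro I, intro I, simp only: coords_of_Phi R)
    show "(\<Sum>i\<in>UNIV. (cl (coords_of x)$i)^3) = tr3 (cA (coords_of x))"
      by (rule closure_Phi_eq[OF _ _ _ x, of "\<lambda>x. \<Sum>i\<in>UNIV. (cl (coords_of x)$i)^3" "\<lambda>x. tr3 (cA (coords_of x))"])
        (intro I, intro I, simp only: coords_of_Phi R)
  next
    fix b i a
    show "cl (coords_of x)$i * cv b (coords_of x)$i$a = (\<Sum>e\<in>UNIV. cAt b (coords_of x) a e * cv b (coords_of x)$i$e)"
      by (rule closure_Phi_eq[OF _ _ _ x, of "\<lambda>x. cl (coords_of x)$i * cv b (coords_of x)$i$a"
            "\<lambda>x. \<Sum>e\<in>UNIV. cAt b (coords_of x) a e * cv b (coords_of x)$i$e"])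
        (intro I, intro I, simp only: coords_of_Phi R)
  next
    fix i a a'
    show "cv True (coords_of x)$i$a * cv False (coords_of x)$i$a' =
        (\<Sum>e\<in>UNIV. cA (coords_of x)$a$e * cA (coords_of x)$e$a') + cl (coords_of x)$i * cA (coords_of x)$a$a'
          + (if a = a' then (cl (coords_of x)$i)^2 - tr2 (cA (coords_of x)) / 2 else 0)"
      by (rule closure_Phi_eq[OF _ _ _ x, of "\<lambda>x. cv True (coords_of x)$i$a * cv False (coords_of x)$i$a'"
          "\<lambda>x. (\<Sum>e\<in>UNIV. cA (coords_of x)$a$e * cA (coords_of x)$e$a') + cl (coords_of x)$i * cA (coords_of x)$a$a'
          + (if a = a' then (cl (coords_of x)$i)^2 - tr2 (cA (coords_of x)) / 2 else 0)"])
        (intro I, intro I, simp only: coords_of_Phi R)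
  next
    fix b i j a a' assume ij: "i \<noteq> (j::3)"
    show "cv b (coords_of x)$i$a * cv b (coords_of x)$j$a' =
          (if b then 1 else -1) *
          ((cAt b (coords_of x) a' (a+1) - (if a' = a+1 then cl (coords_of x)$i else 0)) * cv (\<not>b) (coords_of x)$(-i-j)$(a+2)
           - (cAt b (coords_of x) a' (a+2) - (if a' = a+2 then cl (coords_of x)$i else 0)) * cv (\<not>b) (coords_of x)$(-i-j)$(a+1))"
      by (rule closure_Phi_eq[OF _ _ _ x, of "\<lambda>x. cv b (coords_of x)$i$a * cv b (coords_of x)$j$a'"
          "\<lambda>x. (if b then 1 else -1) *
          ((cAt b (coords_of x) a' (a+1) - (if a' = a+1 then cl (coords_of x)$i else 0)) * cv (\<not>b) (coords_of x)$(-i-j)$(a+2)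
           - (cAt b (coords_of x) a' (a+2) - (if a' = a+2 then cl (coords_of x)$i else 0)) * cv (\<not>b) (coords_of x)$(-i-j)$(a+1))"])
        (intro I, intro I, simp only: coords_of_Phi R(6)[OF _ _ ij])
  qed
qed

lemma mat_of_poly: "(\<lambda>k. mat_of k$p$q) \<in> polyfun coords_coord"
proof -
  have c: "(\<lambda>k. cA k$a$b) \<in> polyfun coords_coord" "(\<lambda>k. cl k$i) \<in> polyfun coords_coord"
    "(\<lambda>k. cv t k$i$a) \<in> polyfun coords_coord" for a b i t
  proof -
    show "(\<lambda>k. cA k$a$b) \<in> polyfun coords_coord"
      by (rule polyfun.coord) (auto simp: coords_coord_def)
    show "(\<lambda>k. cl k$i) \<in> polyfun coords_coord"
      by (rule polyfun.coord) (auto simp: coords_coord_def lcoords_def)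
    have "(\<lambda>k. cv t k$i$a) = letter (t, i, a)" by (simp add: letter_def)
    then show "(\<lambda>k. cv t k$i$a) \<in> polyfun coords_coord"
      by (intro polyfun.coord) (simp add: coords_coord_def)
  qed
  have ifp: "(\<lambda>k. if Q then f k else 0) \<in> polyfun coords_coord" if "f \<in> polyfun coords_coord" for f Q
    using that by (cases Q) (auto intro: polyfun.const)
  have e: "mat_of k = 
     (\<Sum>a\<in>UNIV. \<Sum>b\<in>UNIV. cmul (cA k$a$b - (if a = b then cl k$0 else 0)) (Fm (vpos a) (vpos b)))
     + cmul (cl k$2 - cl k$1) (Fm 3 3)
     + (\<Sum>a\<in>UNIV. cmul (cv True k$0$a) (Fm (dpos (a + 2)) (vpos (a + 1)))
          + cmul (cv True k$1$a) (Fm 4 (dpos a)) + cmul (cv True k$2$a) (Fm 3 (dpos a))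
          + cmul (cv False k$0$a) (Fm (vpos (a + 2)) (dpos (a + 1)))
          + cmul (cv False k$1$a) (Fm 3 (vpos a)) + cmul (cv False k$2$a) (Fm 4 (vpos a)))" for k
    unfolding mat_of_def cA_def cl_def cv_def case_prod_unfold if_True if_False ..
  show ?thesis
    unfolding e cmul_def vector_add_component sum_component vec_lambda_beta
    by (intro polyfun_intros c ifp)
qed

lemma tgt_of_coords_poly:
  assumes "p \<in> polyfun coords_tgt"
  shows "(\<lambda>x. p (tgt_of (coords_of x))) \<in> polyfun coords8"
  by (rule polyfun_compose[OF assms])
    (auto simp: coords_tgt_def tgt_of_def intro!: polyfun_sum polyfun.mult coords_of_poly)

text \<open>Each of the 24 summands is the value of \<open>q\<close> at the image of
  \<open>x\<close> under some element of \<open>S4_action\<close>.\<close>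

lemma invariant_average:
  assumes q: "\<And>\<sigma>. \<sigma> \<in> S4_action \<Longrightarrow> q (\<sigma> x) = q x" and x: "x \<in> so8"
  shows "avg (\<lambda>k. q (mat_of k)) (coords_of x) = 24 * q x"
proof -
  have r: "q (mat_of (\<rho> (coords_of x))) = q x" if real: "realized \<rho>" for \<rho>
  proof -
    obtain \<phi> where "\<phi> \<in> S4_action" "\<phi> x \<in> so8" "coords_of (\<phi> x) = \<rho> (coords_of x)"
      using real x unfolding realized_def by blast
    then show ?thesis using q mat_of_coords_of by metis
  qed
  have "avg (\<lambda>k. q (mat_of k)) (coords_of x) = (\<Sum>e\<in>{1,-1::3}. \<Sum>a\<in>(UNIV::3 set). q x + (\<Sum>m\<in>(UNIV::3 set). q x))"
    unfolding avg_def
    by (intro sum.cong refl arg_cong2[where f="(+)"] r realized_relab r[OF realized_flip[OF realized_relab]]) auto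
  then show ?thesis by simp
qed

theorem theorem4p6:
  shows "quotient_iso coords8 (zariski_closure coords8 O_min) S4_action
           coords_tgt (zariski_closure coords_tgt psi_image)"
  unfolding quotient_iso_def
proof (intro exI[of _ "\<lambda>x. tgt_of (coords_of x)"] conjI ballI impI)
  let ?X = "zariski_closure coords8 O_min" and ?F = "\<lambda>x. tgt_of (coords_of x)"
  have F_Phi: "?F (Phi g z) = psi g z" if "det g = 1" "(\<Sum>i\<in>UNIV. z$i) = 0" for g z
    using that by (simp add: coords_of_Phi tgt_of_normal_coords)
  show "(\<lambda>x. c (?F x)) \<in> polyfun coords8" if "c \<in> coords_tgt" for c
    by (rule tgt_of_coords_poly[OF polyfun.coord[OF that]])
  show "?F ` ?X \<subseteq> zariski_closure coords_tgt psi_image"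
  proof (rule image_subsetI)
    fix x assume x: "x \<in> ?X"
    show "?F x \<in> zariski_closure coords_tgt psi_image"
      unfolding zariski_closure_def mem_Collect_eq
    proof (intro ballI impI)
      fix p assume p: "p \<in> polyfun coords_tgt" "\<forall>y\<in>psi_image. p y = 0"
      show "p (?F x) = 0"
        by (rule closure_Phi[OF tgt_of_coords_poly[OF p(1)] _ x])
          (use p(2) in \<open>auto simp: F_Phi psi_image_def\<close>)
    qed
  qed
  show "?F (\<sigma> x) = ?F x" if "\<sigma> \<in> S4_action" "x \<in> ?X" for \<sigma> x
    using S4_action_tgt[OF that(1) closure_so8[OF that(2)]] by blast
  show "p y = 0" if p: "p \<in> polyfun coords_tgt" "\<forall>x\<in>?X. p (?F x) = 0"
    and y: "y \<in> zariski_closure coords_tgt psi_image" for p y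
  proof -
    \<comment> \<open>Dominance of the quotient map: each \<open>psi g z\<close> is the image of
      \<open>Phi g z\<close>, which lies in the closure even when eigenvalues coincide.\<close>
    have "p (psi g z) = 0" if "det g = 1" "(\<Sum>i\<in>UNIV. z$i) = 0" for g z
      using p(2) Phi_closure[OF that(1)] F_Phi[OF that] by metis
    then have "\<forall>y\<in>psi_image. p y = 0" by (auto simp: psi_image_def)
    then show ?thesis using y p(1) by (auto simp: zariski_closure_def)
  qed
  show "\<exists>p\<in>polyfun coords_tgt. \<forall>x\<in>?X. p (?F x) = q x"
    if q: "q \<in> polyfun coords8" "\<forall>\<sigma>\<in>S4_action. \<forall>x\<in>?X. q (\<sigma> x) = q x" for q
  proof -
    have "(\<lambda>k. q (mat_of k)) \<in> polyfun coords_coord"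
      by (rule polyfun_compose[OF q(1)]) (auto simp: coords8_def mat_of_poly)
    then obtain p where p: "p \<in> polyfun coords_tgt" "\<forall>k\<in>rels. avg (\<lambda>k. q (mat_of k)) k = p (tgt_of k)"
      using avgood_polyfun unfolding avgood_def good_def by blast
    \<comment> \<open>For an invariant \<open>q\<close> the sum \<open>avg\<close> is 24 times
      \<open>q\<close>, so the postponed division recovers \<open>q\<close> itself.\<close>
    have "1 / 24 * p (?F x) = q x" if x: "x \<in> ?X" for x
    proof -
      have "p (?F x) = 24 * q x"
        using p(2) closure_rels[OF x] invariant_average[OF _ closure_so8[OF x], of q] q(2) x by metis
      then show ?thesis by simp
    qed
    then show ?thesis by (intro bexI[OF _ polyfun.mult[OF polyfun.const p(1)]] ballI)
  qed
qed

end
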